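(* Let $E_*=(E_1,\dots,E_n)$ be a complete exceptional sequence for the linearly oriented quiver of type $A_n$, and let $1\le i\le n$. Then $E_i$ is relatively projective in $E_*$ if and only if either the support of $E_i$ is maximal under inclusion among the supports of $E_1,\dots,E_n$ (i.e. the corresponding node $v_i$ is a root of the rooted labeled forest of $E_*$), or $i<j$, where $E_j$ is the object ($j\neq i$) of the sequence with smallest support containing the support of $E_i$ (i.e. $v_j$ is the parent of $v_i$). Dually, $E_i$ is relatively injective in $E_*$ if and only if either $v_i$ is a root of the forest or $i>j$, where $E_j$ is the object ($j\ne i$) of the sequence with smallest support containing the support of $E_i$.
   Context: Let $K$ be a field, $Q: 1\to 2\to\cdots\to n$, $\Lambda=KQ$. $\Lambda$-modules are finite-dimensional representations of $Q$ over $K$. The indecomposable modules are, up to isomorphism, the $M_{ab}$, $1\le a\le b\le n$, with $K$ at vertices $a,\dots,b$, identity maps between them, and $0$ elsewhere; the support of $M_{ab}$ is $[a,b]$. $\mathrm{Ext}$ means $\mathrm{Ext}^1_\Lambda$. A complete exceptional sequence is a sequence $(E_1,\dots,E_n)$ of rigid indecomposable modules such that $\mathrm{Hom}(E_j,E_i)=0=\mathrm{Ext}(E_j,E_i)$ for all $i<j$. Its rooted labeled forest has vertices $v_1,\dots,v_n$ and is the Hasse diagram of the partial order $v_i\le v_j$ iff $\mathrm{supp}\,E_i\subseteq\mathrm{supp}\,E_j$; this is a forest in which each node has at most one parent and the roots are the maximal elements. For a module $Z$, $Z^\perp$ is the full subcategory of modules $Y$ with $\mathrm{Hom}(Z,Y)=0=\mathrm{Ext}(Z,Y)$,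 and ${}^\perp Z$ is the full subcategory of modules $X$ with $\mathrm{Hom}(X,Z)=0=\mathrm{Ext}(X,Z)$. $E_i$ is called relatively projective in $E_*$ if it is a projective object of $(E_{i+1}\oplus\cdots\oplus E_n)^\perp$, and relatively injective in $E_*$ if it is an injective object of ${}^\perp(E_1\oplus\cdots\oplus E_{i-1})$. *)

theory Defs
  imports "Jordan_Normal_Form.Matrix_Kernel"
begin

text \<open>
  Finite-dimensional representations over a field of the quiver with vertices
  \<open>1, \<dots>, n\<close> and arrows \<open>v \<rightarrow> v + 1\<close>. The space at \<open>v\<close> is \<open>K ^ vdim M v\<close>, and
  \<open>arr M v\<close> is the matrix of the map from vertex \<open>v\<close> to vertex \<open>v + 1\<close>, acting on column vectors.
  The values of \<open>vdim M\<close> outside \<open>{1..n}\<close> and of \<open>arr M\<close> outside \<open>{1..<n}\<close> are irrelevant.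
\<close>

datatype 'k rep = Rep (vdim: "nat \<Rightarrow> nat") (arr: "nat \<Rightarrow> 'k mat")

definition is_rep :: "nat \<Rightarrow> 'k rep \<Rightarrow> bool" where
  "is_rep n M \<longleftrightarrow> (\<forall>v\<in>{1..<n}. arr M v \<in> carrier_mat (vdim M (Suc v)) (vdim M v))"

definition supp :: "nat \<Rightarrow> 'k rep \<Rightarrow> nat set" where
  "supp n M = {v\<in>{1..n}. vdim M v \<noteq> 0}"

definition is_zero_rep :: "nat \<Rightarrow> 'k rep \<Rightarrow> bool" where
  "is_zero_rep n M \<longleftrightarrow> (\<forall>v\<in>{1..n}. vdim M v = 0)"


text \<open>
  Morphisms are extensional on \<open>{1..n}\<close>, so that equality of morphisms is equality in HOL.
\<close>

definition Hom :: "nat \<Rightarrow> 'k::field rep \<Rightarrow> 'k rep \<Rightarrow> (nat \<Rightarrow> 'k mat) set" where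
  "Hom n M N = {f \<in> (\<Pi>\<^sub>E v\<in>{1..n}. carrier_mat (vdim N v) (vdim M v)).
     \<forall>v\<in>{1..<n}. f (Suc v) * arr M v = arr N v * f v}"

definition comp_hom :: "nat \<Rightarrow> (nat \<Rightarrow> 'k::field mat) \<Rightarrow> (nat \<Rightarrow> 'k mat) \<Rightarrow> nat \<Rightarrow> 'k mat" where
  "comp_hom n g f = (\<lambda>v\<in>{1..n}. g v * f v)"

definition id_hom :: "nat \<Rightarrow> 'k::field rep \<Rightarrow> nat \<Rightarrow> 'k mat" where
  "id_hom n M = (\<lambda>v\<in>{1..n}. 1\<^sub>m (vdim M v))"

definition zero_hom :: "nat \<Rightarrow> 'k::field rep \<Rightarrow> 'k rep \<Rightarrow> nat \<Rightarrow> 'k mat" where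
  "zero_hom n M N = (\<lambda>v\<in>{1..n}. 0\<^sub>m (vdim N v) (vdim M v))"

definition Hom_vanishes :: "nat \<Rightarrow> 'k::field rep \<Rightarrow> 'k rep \<Rightarrow> bool" where
  "Hom_vanishes n M N \<longleftrightarrow> Hom n M N = {zero_hom n M N}"

definition isomorphic :: "nat \<Rightarrow> 'k::field rep \<Rightarrow> 'k rep \<Rightarrow> bool" where
  "isomorphic n M N \<longleftrightarrow> (\<exists>f\<in>Hom n M N. \<exists>g\<in>Hom n N M.
     comp_hom n g f = id_hom n M \<and> comp_hom n f g = id_hom n N)"


definition zero_rep :: "'k::field rep" where
  "zero_rep = Rep (\<lambda>v. 0) (\<lambda>v. 0\<^sub>m 0 0)"

definition rep_sum :: "'k::field rep \<Rightarrow> 'k rep \<Rightarrow> 'k rep" where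
  "rep_sum M N = Rep (\<lambda>v. vdim M v + vdim N v)
     (\<lambda>v. four_block_mat (arr M v) (0\<^sub>m (vdim M (Suc v)) (vdim N v))
                          (0\<^sub>m (vdim N (Suc v)) (vdim M v)) (arr N v))"

definition rep_sum_list :: "'k::field rep list \<Rightarrow> 'k rep" where
  "rep_sum_list Ms = foldr rep_sum Ms zero_rep"

definition indecomposable :: "nat \<Rightarrow> 'k::field rep \<Rightarrow> bool" where
  "indecomposable n M \<longleftrightarrow> is_rep n M \<and> \<not> is_zero_rep n M \<and>
     (\<forall>A B. is_rep n A \<and> is_rep n B \<and> isomorphic n M (rep_sum A B)
        \<longrightarrow> is_zero_rep n A \<or> is_zero_rep n B)"


text \<open>
  \<open>0 \<rightarrow> Y \<rightarrow> M \<rightarrow> X \<rightarrow> 0\<close> is exact iff it is exact at every vertex.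
\<close>

definition short_exact ::
  "nat \<Rightarrow> 'k::field rep \<Rightarrow> (nat \<Rightarrow> 'k mat) \<Rightarrow> 'k rep \<Rightarrow> (nat \<Rightarrow> 'k mat) \<Rightarrow> 'k rep \<Rightarrow> bool" where
  "short_exact n Y f M g X \<longleftrightarrow> f \<in> Hom n Y M \<and> g \<in> Hom n M X \<and>
     (\<forall>v\<in>{1..n}.
        inj_on ((*\<^sub>v) (f v)) (carrier_vec (vdim Y v)) \<and>
        (*\<^sub>v) (f v) ` carrier_vec (vdim Y v) = mat_kernel (g v) \<and>
        (*\<^sub>v) (g v) ` carrier_vec (vdim M v) = carrier_vec (vdim X v))"

text \<open>
  \<open>Ext1 n X Y\<close> is the set of Yoneda classes of extensions \<open>0 \<rightarrow> Y \<rightarrow> M \<rightarrow> X \<rightarrow> 0\<close>.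
  It underlies a group (with the Baer sum, and with the class of the split extensions as
  neutral element), which vanishes iff there is exactly one class.
\<close>

definition extensions ::
  "nat \<Rightarrow> 'k::field rep \<Rightarrow> 'k rep \<Rightarrow> ('k rep \<times> (nat \<Rightarrow> 'k mat) \<times> (nat \<Rightarrow> 'k mat)) set" where
  "extensions n X Y = {(M, f, g). is_rep n M \<and> short_exact n Y f M g X}"

definition yoneda_equiv ::
  "nat \<Rightarrow> 'k::field rep \<Rightarrow> 'k rep \<Rightarrow> ('k rep \<times> (nat \<Rightarrow> 'k mat) \<times> (nat \<Rightarrow> 'k mat)) rel" where
  "yoneda_equiv n X Y = {((M, f, g), (M', f', g')).
     (M, f, g) \<in> extensions n X Y \<and> (M', f', g') \<in> extensions n X Y \<and>
     (\<exists>h\<in>Hom n M M'. comp_hom n h f = f' \<and> comp_hom n g' h = g)}"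

definition Ext1 ::
  "nat \<Rightarrow> 'k::field rep \<Rightarrow> 'k rep \<Rightarrow> ('k rep \<times> (nat \<Rightarrow> 'k mat) \<times> (nat \<Rightarrow> 'k mat)) set set" where
  "Ext1 n X Y = extensions n X Y // yoneda_equiv n X Y"

definition Ext_vanishes :: "nat \<Rightarrow> 'k::field rep \<Rightarrow> 'k rep \<Rightarrow> bool" where
  "Ext_vanishes n X Y \<longleftrightarrow> is_singleton (Ext1 n X Y)"

definition rigid :: "nat \<Rightarrow> 'k::field rep \<Rightarrow> bool" where
  "rigid n M \<longleftrightarrow> Ext_vanishes n M M"


text \<open>Sequences \<open>(E 1, \<dots>, E n)\<close> are indexed from 1; other values of \<open>E\<close> are irrelevant.\<close>

definition complete_exceptional_sequence :: "nat \<Rightarrow> (nat \<Rightarrow> 'k::field rep) \<Rightarrow> bool" where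
  "complete_exceptional_sequence n E \<longleftrightarrow>
     (\<forall>i\<in>{1..n}. is_rep n (E i) \<and> rigid n (E i) \<and> indecomposable n (E i)) \<and>
     (\<forall>i\<in>{1..n}. \<forall>j\<in>{1..n}. i < j \<longrightarrow>
        Hom_vanishes n (E j) (E i) \<and> Ext_vanishes n (E j) (E i))"


text \<open>A full subcategory is given by its set of objects.\<close>

definition right_perp :: "nat \<Rightarrow> 'k::field rep \<Rightarrow> 'k rep set" where
  "right_perp n Z = {Y. is_rep n Y \<and> Hom_vanishes n Z Y \<and> Ext_vanishes n Z Y}"

definition left_perp :: "nat \<Rightarrow> 'k::field rep \<Rightarrow> 'k rep set" where
  "left_perp n Z = {X. is_rep n X \<and> Hom_vanishes n X Z \<and> Ext_vanishes n X Z}"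

definition epi_in ::
  "nat \<Rightarrow> 'k::field rep set \<Rightarrow> 'k rep \<Rightarrow> 'k rep \<Rightarrow> (nat \<Rightarrow> 'k mat) \<Rightarrow> bool" where
  "epi_in n C X Y f \<longleftrightarrow> f \<in> Hom n X Y \<and>
     (\<forall>Z\<in>C. \<forall>g\<in>Hom n Y Z. \<forall>h\<in>Hom n Y Z. comp_hom n g f = comp_hom n h f \<longrightarrow> g = h)"

definition mono_in ::
  "nat \<Rightarrow> 'k::field rep set \<Rightarrow> 'k rep \<Rightarrow> 'k rep \<Rightarrow> (nat \<Rightarrow> 'k mat) \<Rightarrow> bool" where
  "mono_in n C X Y f \<longleftrightarrow> f \<in> Hom n X Y \<and>
     (\<forall>Z\<in>C. \<forall>g\<in>Hom n Z X. \<forall>h\<in>Hom n Z X. comp_hom n f g = comp_hom n f h \<longrightarrow> g = h)"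

definition projective_in :: "nat \<Rightarrow> 'k::field rep set \<Rightarrow> 'k rep \<Rightarrow> bool" where
  "projective_in n C P \<longleftrightarrow> P \<in> C \<and>
     (\<forall>X\<in>C. \<forall>Y\<in>C. \<forall>f. epi_in n C X Y f \<longrightarrow>
        (\<forall>h\<in>Hom n P Y. \<exists>k\<in>Hom n P X. comp_hom n f k = h))"

definition injective_in :: "nat \<Rightarrow> 'k::field rep set \<Rightarrow> 'k rep \<Rightarrow> bool" where
  "injective_in n C I \<longleftrightarrow> I \<in> C \<and>
     (\<forall>X\<in>C. \<forall>Y\<in>C. \<forall>f. mono_in n C X Y f \<longrightarrow>
        (\<forall>h\<in>Hom n X I. \<exists>k\<in>Hom n Y I. comp_hom n k f = h))"

definition relatively_projective :: "nat \<Rightarrow> (nat \<Rightarrow> 'k::field rep) \<Rightarrow> nat \<Rightarrow> bool" where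
  "relatively_projective n E i \<longleftrightarrow>
     projective_in n (right_perp n (rep_sum_list (map E [Suc i..<Suc n]))) (E i)"

definition relatively_injective :: "nat \<Rightarrow> (nat \<Rightarrow> 'k::field rep) \<Rightarrow> nat \<Rightarrow> bool" where
  "relatively_injective n E i \<longleftrightarrow>
     injective_in n (left_perp n (rep_sum_list (map E [1..<i]))) (E i)"


text \<open>
  The rooted labeled forest is the Hasse diagram of \<open>forest_le\<close>. The parent of \<open>i\<close> is the
  \<open>j \<noteq> i\<close> whose support is the smallest (the least under inclusion) of those containing the
  support of \<open>E i\<close>.
\<close>

definition forest_le :: "nat \<Rightarrow> (nat \<Rightarrow> 'k rep) \<Rightarrow> nat \<Rightarrow> nat \<Rightarrow> bool" where
  "forest_le n E i j \<longleftrightarrow> supp n (E i) \<subseteq> supp n (E j)"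

definition forest_root :: "nat \<Rightarrow> (nat \<Rightarrow> 'k rep) \<Rightarrow> nat \<Rightarrow> bool" where
  "forest_root n E i \<longleftrightarrow> i \<in> {1..n} \<and>
     (\<forall>j\<in>{1..n}. forest_le n E i j \<longrightarrow> supp n (E j) = supp n (E i))"

definition forest_parent :: "nat \<Rightarrow> (nat \<Rightarrow> 'k rep) \<Rightarrow> nat \<Rightarrow> nat \<Rightarrow> bool" where
  "forest_parent n E j i \<longleftrightarrow> j \<in> {1..n} \<and> j \<noteq> i \<and> forest_le n E i j \<and>
     (\<forall>k\<in>{1..n}. k \<noteq> i \<and> forest_le n E i k \<longrightarrow> forest_le n E j k)"

end

theory Submission
  imports Defs "Jordan_Normal_Form.Determinant"
begin

text \<open>
  Every indecomposable is an interval module \<open>[a, b]\<close>, and \<open>Y\<close> lies in the right perpendicular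
  category of \<open>[a, b]\<close> iff the map \<open>Y\<^sub>a \<rightarrow> Y\<^bsub>b+1\<^esub>\<close> is bijective, where \<open>Y\<^bsub>n+1\<^esub> = 0\<close>. So
  \<open>E\<^sub>i = [a, b]\<close> is to be tested in the category \<open>C\<close> of those \<open>Y\<close> for which these maps are bijective
  for all \<open>E\<^sub>k\<close> with \<open>k > i\<close>. Epimorphisms of \<open>C\<close> are surjective because \<open>C\<close> has cokernels, and
  \<open>Hom([a, b], Y)\<close> consists of the elements of \<open>Y\<^sub>a\<close> that die in \<open>Y\<^bsub>b+1\<^esub>\<close>.

  If the parent \<open>[c, d]\<close> of \<open>E\<^sub>i\<close> comes before \<open>E\<^sub>i\<close>, then \<open>b < d\<close> and \<open>[a, d]\<close> lies in \<open>C\<close>, so that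
  \<open>[a, d] \<rightarrow> [a, b]\<close> is a nonsplit epimorphism of \<open>C\<close>. If it comes after \<open>E\<^sub>i\<close>, then the children
  of \<open>[c, d]\<close> to the right of \<open>E\<^sub>i\<close> tile \<open>[b + 1, d]\<close> and come after \<open>E\<^sub>i\<close>, so both
  \<open>Y\<^bsub>b+1\<^esub> \<rightarrow> Y\<^bsub>d+1\<^esub>\<close> and \<open>Y\<^sub>c \<rightarrow> Y\<^bsub>d+1\<^esub>\<close> are bijective on \<open>C\<close>, and a preimage in \<open>X\<^sub>a\<close> of an element
  dying in \<open>Y\<^bsub>b+1\<^esub>\<close> can be corrected by an element coming from \<open>X\<^sub>c\<close>. A root is treated in the
  same way, with the fictitious parent \<open>[0, n]\<close>. Injectivity follows by duality.
\<close>

section \<open>Matrices\<close>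

text \<open>The tiling to the right of \<open>E_i\<close> is the combinatorial core. As there are as
  many intervals as vertices, the edges from \<open>a k\<close> to \<open>b k + 1\<close> connect
  the vertices 1, ..., n + 1; \<open>connected\<close> gets this from a determinant rather than from
  graph theory. If a child ended before \<open>d\<close> and no child began at the next vertex, a
  block of vertices reaching from a gap to that vertex would be cut off from the rest. Such a gap to
  the left of \<open>E_i\<close> exists because \<open>E_i\<close> comes before its parent, and
  exceptionality forces the indices to increase along the tiles, so that all of them come after
  \<open>E_i\<close>. The other obstacle is \<open>Ext_vanishes\<close>, which counts Yoneda
  classes. Everything is computed with the two-term complex behind \<open>Ext0\<close> instead. The
  bridge \<open>Ext_vanishes_iff\<close> compares a cocycle extension with the split one in one
  direction and, in the other, corrects splittings chosen vertex by vertex until they commute with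
  the arrows. Elements of \<open>Y_a\<close> appear as one-column matrices, since a morphism from
  \<open>[a, b]\<close> is determined by such a matrix at \<open>a\<close>.\<close>

lemma mat_eq_if_no_entries:
  assumes "dim_row A = dim_row B" "dim_col A = dim_col B" "dim_row A = 0 \<or> dim_col A = 0"
  shows "A = B"
  using assms by (intro eq_matI) auto

text \<open>The side conditions are equations between dimensions, which simplification can discharge
  by rewriting; carrier premises would contain dimensions that the product being rewritten does not
  determine.\<close>

lemma mult_assoc_dim:
  fixes A :: "'a::semiring_0 mat"
  shows "dim_col A = dim_row B \<Longrightarrow> dim_col B = dim_row C \<Longrightarrow> A * B * C = A * (B * C)"
  by (rule assoc_mult_mat[of A "dim_row A" "dim_row B" B "dim_row C" C "dim_col C"]) auto

lemma add_mult_dim: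
  fixes A :: "'a::semiring_0 mat"
  shows "dim_row A = dim_row B \<Longrightarrow> dim_col A = dim_row C \<Longrightarrow> dim_col B = dim_row C \<Longrightarrow>
    (A + B) * C = A * C + B * C"
  by (rule add_mult_distrib_mat[of A "dim_row A" "dim_row C" B C "dim_col C"]) auto

lemma mult_add_dim:
  fixes A :: "'a::semiring_0 mat"
  shows "dim_col A = dim_row B \<Longrightarrow> dim_row C = dim_row B \<Longrightarrow> dim_col C = dim_col B \<Longrightarrow>
    A * (B + C) = A * B + A * C"
  by (rule mult_add_distrib_mat[of A "dim_row A" "dim_row B" B "dim_col B" C]) auto

lemma minus_mult_dim:
  fixes A :: "'a::ring mat"
  shows "dim_row A = dim_row B \<Longrightarrow> dim_col A = dim_row C \<Longrightarrow> dim_col B = dim_row C \<Longrightarrow>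
    (A - B) * C = A * C - B * C"
  by (rule minus_mult_distrib_mat[of A "dim_row A" "dim_row C" B C "dim_col C"]) auto

lemma mult_minus_dim:
  fixes A :: "'a::ring mat"
  shows "dim_col A = dim_row B \<Longrightarrow> dim_row C = dim_row B \<Longrightarrow> dim_col C = dim_col B \<Longrightarrow>
    A * (B - C) = A * B - A * C"
  by (rule mult_minus_distrib_mat[of A "dim_row A" "dim_row B" B "dim_col B" C]) auto

lemma right_mult_zero_dim:
  fixes A :: "'a::semiring_0 mat"
  shows "dim_col A = k \<Longrightarrow> A * 0\<^sub>m k m = 0\<^sub>m (dim_row A) m"
  by (intro eq_matI) auto

lemma add_zero_dim:
  fixes A :: "'a::comm_monoid_add mat"
  shows "dim_row A = m \<Longrightarrow> dim_col A = k \<Longrightarrow> A + 0\<^sub>m m k = A"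
    "dim_row A = m \<Longrightarrow> dim_col A = k \<Longrightarrow> 0\<^sub>m m k + A = A"
  by (auto intro!: eq_matI)

lemmas mat_algebra = mult_assoc_dim add_mult_dim mult_add_dim minus_mult_dim mult_minus_dim
  right_mult_zero_dim add_zero_dim

text \<open>Once products are bracketed to the right, the left-hand side of a known equation is no
  longer a subterm. This and the next two lemmas apply such an equation in front of a tail
  \<open>X\<close>.\<close>

lemma mult_eq_mult_right:
  fixes A :: "'a::semiring_0 mat"
  assumes "A * B = C * D" "dim_col A = dim_row B" "dim_col B = dim_row X"
    "dim_col C = dim_row D" "dim_col D = dim_row X"
  shows "A * (B * X) = C * (D * X)"
  using assms mult_assoc_dim[of A B X] mult_assoc_dim[of C D X] by simp

lemma mult_eq_one_right:
  fixes A :: "'a::semiring_1 mat"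
  assumes "A * B = 1\<^sub>m m" "dim_col A = dim_row B" "dim_col B = dim_row X" "dim_row X = m"
  shows "A * (B * X) = X"
  using assms mult_assoc_dim[of A B X] by simp

lemma mult_eq_zero_right:
  fixes A :: "'a::semiring_1 mat"
  assumes "A * B = 0\<^sub>m m k" "dim_col A = dim_row B" "dim_col B = dim_row X" "dim_row X = k"
  shows "A * (B * X) = 0\<^sub>m m (dim_col X)"
  using assms mult_assoc_dim[of A B X] by simp

lemma add_eq_imp_eq_minus_mat:
  fixes A :: "'a::ab_group_add mat"
  assumes "A + B = C" "dim_row A = dim_row B" "dim_col A = dim_col B"
  shows "A = C - B"
proof -
  have "A = (A + B) - B" using assms(2,3) by (intro eq_matI) auto
  then show ?thesis using assms(1) by simp
qed

lemma one_mat_eq_zero_iff: "(1\<^sub>m k :: 'a::zero_neq_one mat) = 0\<^sub>m k k \<longleftrightarrow> k = 0"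
proof
  assume h: "(1\<^sub>m k :: 'a mat) = 0\<^sub>m k k"
  show "k = 0"
  proof (rule ccontr)
    assume "k \<noteq> 0"
    then have "(1\<^sub>m k :: 'a mat) $$ (0,0) = 1" "(0\<^sub>m k k :: 'a mat) $$ (0,0) = 0" by auto
    with h show False by simp
  qed
qed auto

text \<open>The columns of \<open>D\<close> are its values on unit vectors, and preimages of them
  under \<open>A\<close> are the columns of \<open>R\<close>. This turns the elementwise exactness
  conditions into matrix equations.\<close>

lemma matrix_factor_if_image_subset:
  fixes A :: "'a::field mat"
  assumes D: "D \<in> carrier_mat m k" and A: "A \<in> carrier_mat m l"
    and im: "\<And>x. x \<in> carrier_vec k \<Longrightarrow> D *\<^sub>v x \<in> (*\<^sub>v) A ` carrier_vec l"
  shows "\<exists>R\<in>carrier_mat l k. D = A * R"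
proof -
  have "\<forall>j<k. \<exists>w. w \<in> carrier_vec l \<and> col D j = A *\<^sub>v w"
  proof (intro allI impI)
    fix j assume j: "j < k"
    have "D *\<^sub>v unit_vec k j = col D j" using D j by (intro eq_vecI) auto
    with im[of "unit_vec k j"] show "\<exists>w. w \<in> carrier_vec l \<and> col D j = A *\<^sub>v w" by auto
  qed
  then obtain w where w: "\<And>j. j < k \<Longrightarrow> w j \<in> carrier_vec l \<and> col D j = A *\<^sub>v w j" by metis
  define R where "R = mat l k (\<lambda>(i,j). w j $ i)"
  have R: "R \<in> carrier_mat l k" by (simp add: R_def)
  have "col R j = w j" if "j < k" for j using w[OF that] that by (intro eq_vecI) (auto simp: R_def)
  then have "D = A * R" using D A R w
    by (intro mat_col_eqI) (auto simp: col_mult2[of A m l R k])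
  with R show ?thesis by blast
qed

lemma left_cancel_if_inj_on:
  fixes A :: "'a::field mat"
  assumes inj: "inj_on ((*\<^sub>v) A) (carrier_vec l)" and A: "A \<in> carrier_mat m l"
    and M: "M \<in> carrier_mat l k" and N: "N \<in> carrier_mat l k" and eq: "A * M = A * N"
  shows "M = N"
proof (rule mat_col_eqI)
  fix j assume j: "j < dim_col N"
  then have "A *\<^sub>v col M j = A *\<^sub>v col N j"
    using col_mult2[OF A M, of j] col_mult2[OF A N, of j] eq N by simp
  then show "col M j = col N j" using inj_onD[OF inj] M N j by auto
qed (use M N in auto)

section \<open>Cokernels of matrices over a field\<close>

lemma column_cokernel:
  fixes w :: "'a::field mat"
  assumes w: "w \<in> carrier_mat q 1" and t: "t < q" and wt: "w $$ (t,0) \<noteq> 0"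
  shows "\<exists>P\<in>carrier_mat (q-1) q. \<exists>S\<in>carrier_mat q (q-1). \<exists>B\<in>carrier_mat 1 q.
    P * S = 1\<^sub>m (q-1) \<and> P * w = 0\<^sub>m (q-1) 1 \<and> S * P + w * B = 1\<^sub>m q"
proof -
  let ?d = "insert_index t"
  have inj: "?d i = ?d j \<longleftrightarrow> i = j" for i j by (metis delete_insert_index)
  have neq: "?d i \<noteq> t" for i by (simp add: insert_index_def)
  have lt: "?d i < q" if "i < q - 1" for i using that by (auto simp: insert_index_def)
  \<comment> \<open>Elimination with pivot \<open>w $$ (t,0)\<close>: \<open>B\<close> reads off the
    multiple of \<open>w\<close> that clears coordinate \<open>t\<close>, \<open>P\<close> subtracts
    this multiple and drops the coordinate, and \<open>S\<close> puts a zero back there. Hence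
    \<open>S * P = 1 - w * B\<close>.\<close>
  define P where "P = mat (q-1) q (\<lambda>(i,l). (if l = ?d i then 1 else 0) -
      (if l = t then w $$ (?d i,0) / w $$ (t,0) else 0))"
  define S where "S = mat q (q-1) (\<lambda>(r,j). if r = ?d j then 1 else (0::'a))"
  define B where "B = mat 1 q (\<lambda>(_,l). if l = t then 1 / w $$ (t,0) else 0)"
  have "P * S = 1\<^sub>m (q-1)"
    using t lt neq by (intro eq_matI)
      (auto simp: P_def S_def scalar_prod_def inj if_distrib[of "\<lambda>x. x * _"] if_distrib[of "\<lambda>x. _ * x"]
        sum.delta left_diff_distrib sum_subtractf cong: if_cong)
  moreover have "P * w = 0\<^sub>m (q-1) 1"
    using t lt neq w wt by (intro eq_matI)
      (auto simp: P_def scalar_prod_def if_distrib[of "\<lambda>x. x * _"]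
        sum.delta left_diff_distrib sum_subtractf cong: if_cong)
  moreover have "S * P + w * B = 1\<^sub>m q"
  proof (intro eq_matI)
    fix r l assume rl: "r < dim_row (1\<^sub>m q :: 'a mat)" "l < dim_col (1\<^sub>m q :: 'a mat)"
    show "(S * P + w * B) $$ (r,l) = (1\<^sub>m q) $$ (r,l)"
    proof (cases "r = t")
      case True
      then show ?thesis using rl w wt neq[symmetric]
        by (auto simp: S_def P_def B_def scalar_prod_def)
    next
      case False
      define i where "i = delete_index t r"
      have ri: "r = ?d i" using insert_delete_index[OF False] by (simp add: i_def)
      have i: "i < q - 1" using rl False t by (auto simp: i_def delete_index_def split: if_splits)
      show ?thesis using rl w wt i neq unfolding ri
        by (auto simp: S_def P_def B_def scalar_prod_def inj if_distrib[of "\<lambda>x. x * _"]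
            sum.delta cong: if_cong)
    qed
  qed (auto simp: S_def B_def w carrier_matD[OF w] P_def)
  moreover have "P \<in> carrier_mat (q-1) q" "S \<in> carrier_mat q (q-1)" "B \<in> carrier_mat 1 q"
    by (auto simp: P_def S_def B_def)
  ultimately show ?thesis by blast
qed

text \<open>Columns are divided out one at a time: the cokernel of the first \<open>k\<close>
  columns is divided further by the image of the last column. In the result \<open>P\<close> is the
  projection to the cokernel, \<open>S\<close> a section of it, and the last equation makes
  \<open>B\<close> write each element killed by \<open>P\<close> as an element of the image of
  \<open>A\<close>.\<close>

lemma matrix_cokernel:
  fixes A :: "'a::field mat"
  assumes "A \<in> carrier_mat m k"
  shows "\<exists>q P S B. P \<in> carrier_mat q m \<and> S \<in> carrier_mat m q \<and> B \<in> carrier_mat k m \<and>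
    P * S = 1\<^sub>m q \<and> P * A = 0\<^sub>m q k \<and> S * P + A * B = 1\<^sub>m m"
  using assms
proof (induction k arbitrary: A)
  case 0
  then have "1\<^sub>m m \<in> carrier_mat m m \<and> 1\<^sub>m m \<in> carrier_mat m m \<and> 0\<^sub>m 0 m \<in> carrier_mat 0 m \<and>
    1\<^sub>m m * 1\<^sub>m m = (1\<^sub>m m :: 'a mat) \<and> 1\<^sub>m m * A = 0\<^sub>m m 0 \<and> 1\<^sub>m m * 1\<^sub>m m + A * 0\<^sub>m 0 m = 1\<^sub>m m"
    by (auto intro!: mat_eq_if_no_entries[of A] simp: mat_algebra)
  then show ?case by blast
next
  case (Suc k)
  define A' where "A' = mat m k (\<lambda>(i,j). A $$ (i,j))"
  define u where "u = mat m 1 (\<lambda>(i,j). A $$ (i,k))"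
  \<comment> \<open>\<open>I\<close> and \<open>J\<close> include the first \<open>k\<close>
    coordinates and the last one; \<open>I'\<close> and \<open>J'\<close> below are the
    corresponding projections. They cut \<open>A\<close> into \<open>A'\<close> and the last column
    \<open>u\<close>.\<close>
  define I where "I = mat (Suc k) k (\<lambda>(i,j). if i = j then 1 else (0::'a))"
  define J where "J = mat (Suc k) 1 (\<lambda>(i,j). if i = k then 1 else (0::'a))"
  have dims: "dim_row A = m" "dim_col A = Suc k" "dim_row A' = m" "dim_col A' = k" "dim_row u = m" "dim_col u = 1"
    "dim_row I = Suc k" "dim_col I = k" "dim_row J = Suc k" "dim_col J = 1"
    using Suc.prems by (auto simp: A'_def u_def I_def J_def)
  define I' where "I' = mat k (Suc k) (\<lambda>(i,j). if i = j then 1 else (0::'a))"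
  define J' where "J' = mat 1 (Suc k) (\<lambda>(i,j). if j = k then 1 else (0::'a))"
  have dims': "dim_row I' = k" "dim_col I' = Suc k" "dim_row J' = 1" "dim_col J' = Suc k"
    by (simp_all add: I'_def J'_def)
  have AI: "A * I = A'" and AJ: "A * J = u" using dims
    by (auto intro!: eq_matI simp: I_def J_def A'_def u_def scalar_prod_def if_distrib[of "\<lambda>x. _ * x"]
       sum.delta cong: if_cong)
  have A_split: "A = A' * I' + u * J'" using dims
    by (auto intro!: eq_matI simp: I'_def J'_def A'_def u_def scalar_prod_def if_distrib[of "\<lambda>x. _ * x"]
       sum.delta less_Suc_eq cong: if_cong)
  have A': "A' \<in> carrier_mat m k" using dims by auto
  from Suc.IH[OF this] obtain q P S B where IH: "P \<in> carrier_mat q m" "S \<in> carrier_mat m q"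
    "B \<in> carrier_mat k m" "P * S = 1\<^sub>m q" "P * A' = 0\<^sub>m q k" "S * P + A' * B = 1\<^sub>m m" by blast
  note IHd = carrier_matD[OF IH(1)] carrier_matD[OF IH(2)] carrier_matD[OF IH(3)]
  show ?case
  proof (cases "P * u = 0\<^sub>m q 1")
    case True
    have "P * A = 0\<^sub>m q (Suc k)"
      unfolding A_split using True IH(5) dims dims' IHd
      by (simp add: mat_algebra mult_eq_zero_right[OF IH(5)] mult_eq_zero_right[OF True])
    moreover have "S * P + A * (I * B) = 1\<^sub>m m"
      using IH(6) AI mult_assoc_dim[of A I B] dims IHd by simp
    moreover have "I * B \<in> carrier_mat (Suc k) m" using dims IHd by auto
    ultimately show ?thesis using IH by blast
  next
    case False
    then obtain t where t: "t < q" "(P * u) $$ (t,0) \<noteq> 0"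
      using dims IHd by (force intro!: eq_matI)
    have Pu: "P * u \<in> carrier_mat q 1" using dims IHd by auto
    from column_cokernel[OF Pu t] obtain P' S' \<beta> where c: "P' \<in> carrier_mat (q-1) q"
      "S' \<in> carrier_mat q (q-1)" "\<beta> \<in> carrier_mat 1 q" "P' * S' = 1\<^sub>m (q-1)"
      "P' * (P * u) = 0\<^sub>m (q-1) 1" "S' * P' + (P * u) * \<beta> = 1\<^sub>m q" by blast
    note cd = carrier_matD[OF c(1)] carrier_matD[OF c(2)] carrier_matD[OF c(3)]
    let ?P = "P' * P" and ?S = "S * S'"
    \<comment> \<open>With \<open>U = u * (\<beta> * P)\<close> one has
      \<open>?S * ?P = S * P - S * P * U\<close>, so the missing part of the identity is
      \<open>A' * B + S * P * U = A' * (B - B * U) + U\<close>. The first summand gives the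
      coefficients for the first \<open>k\<close> columns, and \<open>U\<close> has coefficient
      \<open>\<beta> * P\<close> at the last column.\<close>
    let ?B = "I * (B - B * (u * (\<beta> * P))) + J * (\<beta> * P)"
    have "?P * ?S = 1\<^sub>m (q-1)"
      using IH(4) c(4) IHd cd by (simp add: mult_assoc_dim mult_eq_one_right)
    moreover have "?P * A = 0\<^sub>m (q-1) (Suc k)"
    proof -
      have "P' * (P * (u * J')) = 0\<^sub>m (q-1) (Suc k)"
        using mult_eq_zero_right[OF c(5), of J'] dims dims' IHd cd by (simp add: mult_assoc_dim)
      then show ?thesis unfolding A_split using dims dims' IHd cd
        by (simp add: mat_algebra mult_eq_zero_right[OF IH(5)])
    qed
    moreover have "?S * ?P + A * ?B = 1\<^sub>m m"
    proof -
      let ?U = "u * (\<beta> * P)"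
      have "S' * P' = 1\<^sub>m q - (P * u) * \<beta>" using c(6) dims IHd cd by (intro add_eq_imp_eq_minus_mat) auto
      then have "?S * ?P = S * ((1\<^sub>m q - (P * u) * \<beta>) * P)"
        using dims IHd cd by (metis mult_assoc_dim index_mult_mat(2,3))
      also have "\<dots> = S * P - S * (P * ?U)"
        using dims IHd cd by (simp add: mat_algebra)
      finally have 1: "?S * ?P = S * P - S * (P * ?U)" .
      have "(S * P + A' * B) * ?U = ?U" using IH(6) dims IHd cd by simp
      then have 2: "S * (P * ?U) + A' * (B * ?U) = ?U" using dims IHd cd by (simp add: mat_algebra)
      have 3: "A * ?B = A' * B - A' * (B * ?U) + ?U"
        using dims IHd cd unfolding AI[symmetric] AJ[symmetric]
        by (simp add: mat_algebra)
      have e2: "(S * (P * ?U)) $$ (i,j) + (A' * (B * ?U)) $$ (i,j) = ?U $$ (i,j)"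
        if "i < m" "j < m" for i j
        using arg_cong[OF 2, of "\<lambda>X. X $$ (i,j)"] that dims IHd cd by (simp del: index_mult_mat(1))
      have e6: "(S * P) $$ (i,j) + (A' * B) $$ (i,j) = 1\<^sub>m m $$ (i,j)" if "i < m" "j < m" for i j
        using arg_cong[OF IH(6), of "\<lambda>X. X $$ (i,j)"] that dims IHd cd by (simp del: index_mult_mat(1) index_one_mat(1))
      have "(S * P - S * (P * ?U)) + (A' * B - A' * (B * ?U) + ?U) = 1\<^sub>m m"
      proof (rule eq_matI)
        fix i j assume ij: "i < dim_row (1\<^sub>m m :: 'a mat)" "j < dim_col (1\<^sub>m m :: 'a mat)"
        then show "((S * P - S * (P * ?U)) + (A' * B - A' * (B * ?U) + ?U)) $$ (i,j) = 1\<^sub>m m $$ (i,j)"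
          using e2[of i j] e6[of i j] dims IHd cd
          by (simp del: index_mult_mat(1) index_one_mat(1) add: algebra_simps)
      qed (use dims IHd cd in auto)
      then show ?thesis using 1 3 by simp
    qed
    moreover have "?P \<in> carrier_mat (q-1) m" "?S \<in> carrier_mat m (q-1)" "?B \<in> carrier_mat (Suc k) m"
      using dims IHd cd by auto
    ultimately show ?thesis by blast
  qed
qed

section \<open>Representations on all natural numbers\<close>

text \<open>
  Representations are extended by zero to all natural numbers, which makes range conditions
  unnecessary and provides the zero spaces at the vertices \<open>0\<close> and \<open>n + 1\<close>.
\<close>

definition total_rep :: "'k rep \<Rightarrow> bool" where
  "total_rep M \<longleftrightarrow> (\<forall>v. arr M v \<in> carrier_mat (vdim M (Suc v)) (vdim M v))"

definition total_hom :: "'k::field rep \<Rightarrow> 'k rep \<Rightarrow> (nat \<Rightarrow> 'k mat) \<Rightarrow> bool" where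
  "total_hom M N f \<longleftrightarrow> (\<forall>v. f v \<in> carrier_mat (vdim N v) (vdim M v)) \<and>
     (\<forall>v. f (Suc v) * arr M v = arr N v * f v)"

definition nat_rep :: "nat \<Rightarrow> 'k rep \<Rightarrow> bool" where
  "nat_rep n M \<longleftrightarrow> total_rep M \<and> (\<forall>v. v \<notin> {1..n} \<longrightarrow> vdim M v = 0)"

definition extend :: "nat \<Rightarrow> 'k::field rep \<Rightarrow> 'k rep" where
  "extend n M = (let d = \<lambda>v. if v \<in> {1..n} then vdim M v else 0 in
     Rep d (\<lambda>v. if v \<in> {1..<n} then arr M v else 0\<^sub>m (d (Suc v)) (d v)))"

definition extend_hom :: "nat \<Rightarrow> (nat \<Rightarrow> 'k::field mat) \<Rightarrow> nat \<Rightarrow> 'k mat" where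
  "extend_hom n f v = (if v \<in> {1..n} then f v else 0\<^sub>m 0 0)"

definition Hom0 :: "'k::field rep \<Rightarrow> 'k rep \<Rightarrow> bool" where
  "Hom0 M N \<longleftrightarrow> (\<forall>f. total_hom M N f \<longrightarrow> (\<forall>v. f v = 0\<^sub>m (vdim N v) (vdim M v)))"

text \<open>
  \<open>Ext\<^sup>1\<close> is the cokernel of \<open>\<Prod>\<^sub>v Hom(M\<^sub>v, N\<^sub>v) \<rightarrow> \<Prod>\<^sub>v Hom(M\<^sub>v, N\<^sub>v\<^sub>+\<^sub>1)\<close>,
  \<open>f \<mapsto> (f\<^sub>v\<^sub>+\<^sub>1 M\<^sub>v - N\<^sub>v f\<^sub>v)\<^sub>v\<close>, whose kernel is \<open>Hom\<close>.
\<close>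

definition Ext0 :: "'k::field rep \<Rightarrow> 'k rep \<Rightarrow> bool" where
  "Ext0 M N \<longleftrightarrow> (\<forall>c. (\<forall>v. c v \<in> carrier_mat (vdim N (Suc v)) (vdim M v)) \<longrightarrow>
     (\<exists>f. (\<forall>v. f v \<in> carrier_mat (vdim N v) (vdim M v)) \<and>
       (\<forall>v. f (Suc v) * arr M v = arr N v * f v + c v)))"

definition perp0 :: "'k::field rep \<Rightarrow> 'k rep \<Rightarrow> bool" where
  "perp0 M N \<longleftrightarrow> Hom0 M N \<and> Ext0 M N"

lemma vdim_extend: "vdim (extend n M) v = (if v \<in> {1..n} then vdim M v else 0)"
  by (simp add: extend_def Let_def)

lemma arr_extend: "v \<in> {1..<n} \<Longrightarrow> arr (extend n M) v = arr M v"
  by (simp add: extend_def Let_def)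

lemma nat_rep_extend:
  assumes "is_rep n M"
  shows "nat_rep n (extend n M)"
proof -
  have "arr (extend n M) v \<in> carrier_mat (vdim (extend n M) (Suc v)) (vdim (extend n M) v)" for v
    using assms by (cases "v \<in> {1..<n}") (auto simp: extend_def Let_def is_rep_def)
  then show ?thesis by (auto simp: nat_rep_def total_rep_def vdim_extend)
qed

lemma nat_rep_is_rep: "nat_rep n M \<Longrightarrow> is_rep n M"
  by (auto simp: nat_rep_def total_rep_def is_rep_def)

lemma nat_rep_total: "nat_rep n M \<Longrightarrow> total_rep M"
  by (simp add: nat_rep_def)

lemma total_rep_dims:
  "total_rep M \<Longrightarrow> dim_row (arr M v) = vdim M (Suc v)"
  "total_rep M \<Longrightarrow> dim_col (arr M v) = vdim M v"
  unfolding total_rep_def by (metis carrier_matD)+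

lemma total_hom_dims:
  "total_hom M N f \<Longrightarrow> dim_row (f v) = vdim N v"
  "total_hom M N f \<Longrightarrow> dim_col (f v) = vdim M v"
  unfolding total_hom_def by (metis carrier_matD)+

lemma total_hom_commute: "total_hom M N f \<Longrightarrow> f (Suc v) * arr M v = arr N v * f v"
  by (simp add: total_hom_def)

lemma rep_eqI:
  assumes "\<And>v. vdim M v = vdim N v" "\<And>v. arr M v = arr N v"
  shows "M = N"
  using assms by (cases M; cases N) auto

lemma outside_no_entries:
  assumes "nat_rep n M" "v \<notin> {1..<n}"
  shows "vdim M (Suc v) = 0 \<or> vdim M v = 0"
  using assms by (auto simp: nat_rep_def)

lemma nat_rep_eqI:
  assumes "nat_rep n M" "nat_rep n N" "\<And>v. v \<in> {1..n} \<Longrightarrow> vdim M v = vdim N v"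
    "\<And>v. v \<in> {1..<n} \<Longrightarrow> arr M v = arr N v"
  shows "M = N"
proof (rule rep_eqI)
  show d: "vdim M v = vdim N v" for v
    using assms(1-3) by (cases "v \<in> {1..n}") (auto simp: nat_rep_def)
  show "arr M v = arr N v" for v
  proof (cases "v \<in> {1..<n}")
    case False
    then show ?thesis using outside_no_entries[OF assms(1) False] assms(1,2)
      by (intro mat_eq_if_no_entries) (auto simp: nat_rep_def total_rep_dims d)
  qed (use assms in auto)
qed

lemma extend_nat_rep: "nat_rep n M \<Longrightarrow> extend n M = M"
  by (rule nat_rep_eqI[of n]) (auto simp: nat_rep_extend nat_rep_is_rep vdim_extend arr_extend)

text \<open>At a place outside the arrows of the quiver, the start space in \<open>M\<close> or the
  end space in \<open>N\<close> is zero, so the square commutes for lack of entries.\<close>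

lemma total_homI:
  assumes "nat_rep n M" "nat_rep n N" "\<And>v. f v \<in> carrier_mat (vdim N v) (vdim M v)"
    "\<And>v. v \<in> {1..<n} \<Longrightarrow> f (Suc v) * arr M v = arr N v * f v"
  shows "total_hom M N f"
  unfolding total_hom_def
proof (intro conjI allI)
  fix v
  note d = carrier_matD[OF assms(3)] total_rep_dims[OF nat_rep_total[OF assms(1)]]
    total_rep_dims[OF nat_rep_total[OF assms(2)]]
  show "f (Suc v) * arr M v = arr N v * f v"
  proof (cases "v \<in> {1..<n}")
    case False
    then have "v = 0 \<or> v \<ge> n" by auto
    then have "vdim M v = 0 \<or> vdim N (Suc v) = 0" using assms(1,2) by (auto simp: nat_rep_def)
    then show ?thesis by (intro mat_eq_if_no_entries) (auto simp: d)
  qed (rule assms(4))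
qed (rule assms(3))

text \<open>Inverse to restriction to \<open>{1..n}\<close> by \<open>extend_hom_restrict\<close>
  and \<open>restrict_extend_hom\<close>; through this pair every statement about \<open>Hom\<close>
  moves to \<open>total_hom\<close> and back.\<close>

lemma total_hom_extend_hom:
  assumes "is_rep n M" "is_rep n N" "f \<in> Hom n M N"
  shows "total_hom (extend n M) (extend n N) (extend_hom n f)"
proof (rule total_homI[OF nat_rep_extend[OF assms(1)] nat_rep_extend[OF assms(2)]])
  fix v
  show "extend_hom n f v \<in> carrier_mat (vdim (extend n N) v) (vdim (extend n M) v)"
    using assms(3) by (auto simp: extend_hom_def Hom_def vdim_extend PiE_iff)
next
  fix v assume "v \<in> {1..<n}"
  then show "extend_hom n f (Suc v) * arr (extend n M) v = arr (extend n N) v * extend_hom n f v"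
    using assms(3) by (auto simp: extend_hom_def Hom_def arr_extend)
qed

lemma restrict_mem_Hom:
  assumes "total_hom (extend n M) (extend n N) f"
  shows "restrict f {1..n} \<in> Hom n M N"
proof -
  have "f v \<in> carrier_mat (vdim N v) (vdim M v)" if "v \<in> {1..n}" for v
    using assms that vdim_extend[of n M v] vdim_extend[of n N v] unfolding total_hom_def by metis
  moreover have "f (Suc v) * arr M v = arr N v * f v" if "v \<in> {1..<n}" for v
    using assms that arr_extend[of v n M] arr_extend[of v n N] unfolding total_hom_def by metis
  ultimately show ?thesis by (auto simp: Hom_def)
qed

lemma extend_hom_restrict:
  assumes "\<And>v. f v \<in> carrier_mat (vdim (extend n N) v) (vdim (extend n M) v)"
  shows "extend_hom n (restrict f {1..n}) = f"
proof
  fix v show "extend_hom n (restrict f {1..n}) v = f v"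
    using assms[of v] by (auto simp: extend_hom_def vdim_extend)
qed

lemma restrict_extend_hom: "f \<in> Hom n M N \<Longrightarrow> restrict (extend_hom n f) {1..n} = f"
  by (auto simp: Hom_def extend_hom_def PiE_iff extensional_def)

lemma Hom_vanishes_iff:
  assumes "is_rep n M" "is_rep n N"
  shows "Hom_vanishes n M N \<longleftrightarrow> Hom0 (extend n M) (extend n N)"
proof
  assume h: "Hom_vanishes n M N"
  show "Hom0 (extend n M) (extend n N)" unfolding Hom0_def
  proof (intro allI impI)
    fix f v assume f: "total_hom (extend n M) (extend n N) f"
    then have r: "restrict f {1..n} = zero_hom n M N"
      using h restrict_mem_Hom[OF f] unfolding Hom_vanishes_def by blast
    have c: "\<And>v. f v \<in> carrier_mat (vdim (extend n N) v) (vdim (extend n M) v)"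
      using f by (simp add: total_hom_def)
    show "f v = 0\<^sub>m (vdim (extend n N) v) (vdim (extend n M) v)"
    proof (cases "v \<in> {1..n}")
      case True
      then show ?thesis using fun_cong[OF r, of v] by (simp add: zero_hom_def vdim_extend)
    next
      case False
      then show ?thesis using c[of v] by (auto simp: vdim_extend)
    qed
  qed
next
  assume h: "Hom0 (extend n M) (extend n N)"
  have "f = zero_hom n M N" if f: "f \<in> Hom n M N" for f
  proof -
    have "extend_hom n f v = 0\<^sub>m (vdim (extend n N) v) (vdim (extend n M) v)" for v
      using h total_hom_extend_hom[OF assms f] by (auto simp: Hom0_def)
    then have "restrict (extend_hom n f) {1..n} = zero_hom n M N"
      by (auto simp: zero_hom_def vdim_extend)
    then show ?thesis using restrict_extend_hom[OF f] by simp
  qed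
  moreover have "zero_hom n M N \<in> Hom n M N"
    unfolding Hom_def
  proof (intro CollectI conjI ballI)
    fix v assume v: "v \<in> {1..<n}"
    then have "arr M v \<in> carrier_mat (vdim M (Suc v)) (vdim M v)"
      "arr N v \<in> carrier_mat (vdim N (Suc v)) (vdim N v)" using assms by (auto simp: is_rep_def)
    then show "zero_hom n M N (Suc v) * arr M v = arr N v * zero_hom n M N v"
      using v left_mult_zero_mat[of "arr M v"] right_mult_zero_mat[of "arr N v"]
      by (simp add: zero_hom_def)
  qed (auto simp: zero_hom_def)
  ultimately show "Hom_vanishes n M N" unfolding Hom_vanishes_def by blast
qed

section \<open>Exact sequences of vector spaces as matrix equations\<close>

lemma zero_mat_mult_vec: "z \<in> carrier_vec k \<Longrightarrow> 0\<^sub>m m k *\<^sub>v z = (0\<^sub>v m :: 'a::semiring_0 vec)"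
  by (intro eq_vecI) auto

text \<open>Surjectivity of \<open>g\<close> lets the identity factor as \<open>g * s\<close>. Then
  \<open>1 - s * g\<close> lands in the kernel of \<open>g\<close>, which is the image of
  \<open>f\<close>, so it factors as \<open>f * r\<close>; cancelling the injective \<open>f\<close>
  gives \<open>r * f = 1\<close>.\<close>

lemma exact_imp_split_at_vertex:
  fixes f g :: "'k::field mat"
  assumes f: "f \<in> carrier_mat m y" and g: "g \<in> carrier_mat x m"
    and inj: "inj_on ((*\<^sub>v) f) (carrier_vec y)"
    and ker: "(*\<^sub>v) f ` carrier_vec y = mat_kernel g"
    and surj: "(*\<^sub>v) g ` carrier_vec m = carrier_vec x"
  shows "\<exists>s\<in>carrier_mat m x. \<exists>r\<in>carrier_mat y m.
    g * s = 1\<^sub>m x \<and> r * f = 1\<^sub>m y \<and> f * r + s * g = 1\<^sub>m m \<and> g * f = 0\<^sub>m x y"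
proof -
  have gf: "g * f = 0\<^sub>m x y"
  proof (rule mat_col_eqI)
    fix j assume j: "j < dim_col (0\<^sub>m x y :: 'k mat)"
    have "f *\<^sub>v unit_vec y j \<in> mat_kernel g" using ker j by auto
    moreover have "f *\<^sub>v unit_vec y j = col f j" using f j by (intro eq_vecI) auto
    ultimately have "g *\<^sub>v col f j = 0\<^sub>v x" using g by (simp add: mat_kernel_def)
    then show "col (g * f) j = col (0\<^sub>m x y) j" using col_mult2[OF g f, of j] j by simp
  qed (use f g in auto)
  have "1\<^sub>m x *\<^sub>v z \<in> (*\<^sub>v) g ` carrier_vec m" if "z \<in> carrier_vec x" for z
    using that surj by simp
  from matrix_factor_if_image_subset[OF one_carrier_mat g this]
  obtain s where s: "s \<in> carrier_mat m x" "1\<^sub>m x = g * s" by blast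
  note d = carrier_matD[OF f] carrier_matD[OF g] carrier_matD[OF s(1)]
  have D: "1\<^sub>m m - s * g \<in> carrier_mat m m" using d by auto
  have gD: "g * (1\<^sub>m m - s * g) = 0\<^sub>m x m"
    using d s(2)[symmetric] by (auto simp: mat_algebra mult_eq_one_right intro!: eq_matI)
  have "(1\<^sub>m m - s * g) *\<^sub>v z \<in> (*\<^sub>v) f ` carrier_vec y" if z: "z \<in> carrier_vec m" for z
  proof -
    have "g *\<^sub>v ((1\<^sub>m m - s * g) *\<^sub>v z) = 0\<^sub>v x"
      unfolding assoc_mult_mat_vec[OF g D z, symmetric] gD by (rule zero_mat_mult_vec[OF z])
    then show ?thesis unfolding ker using D g z
      by (intro mat_kernelI[OF g]) auto
  qed
  from matrix_factor_if_image_subset[OF D f this]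
  obtain r where r: "r \<in> carrier_mat y m" "1\<^sub>m m - s * g = f * r" by blast
  note d = d carrier_matD[OF r(1)]
  have 1: "f * r + s * g = 1\<^sub>m m" unfolding r(2)[symmetric] using d by (intro eq_matI) auto
  have "f * (r * f) = (1\<^sub>m m - s * g) * f" using r(2) d by (simp add: mat_algebra)
  also have "\<dots> = f" using d gf by (auto simp: mat_algebra intro!: eq_matI)
  finally have "f * (r * f) = f * 1\<^sub>m y" using d by simp
  then have "r * f = 1\<^sub>m y"
    by (rule left_cancel_if_inj_on[OF inj f, rotated 2]) (use d in auto)
  with 1 gf s(2)[symmetric] show ?thesis
    by (intro bexI[OF _ s(1)] bexI[OF _ r(1)] conjI)
qed

text \<open>The left inverse \<open>r\<close> gives injectivity, the right inverse \<open>s\<close>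
  surjectivity, and the third equation shows that a vector \<open>z\<close> killed by
  \<open>g\<close> is \<open>f\<close> applied to \<open>r z\<close>.\<close>

lemma split_at_vertex_imp_exact:
  fixes f g :: "'k::field mat"
  assumes f: "f \<in> carrier_mat m y" and g: "g \<in> carrier_mat x m"
    and s: "s \<in> carrier_mat m x" and r: "r \<in> carrier_mat y m"
    and eq: "g * s = 1\<^sub>m x" "r * f = 1\<^sub>m y" "f * r + s * g = 1\<^sub>m m" "g * f = 0\<^sub>m x y"
  shows "inj_on ((*\<^sub>v) f) (carrier_vec y)"
    and "(*\<^sub>v) f ` carrier_vec y = mat_kernel g"
    and "(*\<^sub>v) g ` carrier_vec m = carrier_vec x"
proof -
  have rf: "r *\<^sub>v (f *\<^sub>v z) = z" if "z \<in> carrier_vec y" for z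
    using assoc_mult_mat_vec[OF r f that] eq(2) that by simp
  then show "inj_on ((*\<^sub>v) f) (carrier_vec y)" by (rule inj_on_inverseI)
  have gf0: "g *\<^sub>v (f *\<^sub>v z) = 0\<^sub>v x" if "z \<in> carrier_vec y" for z
    unfolding assoc_mult_mat_vec[OF g f that, symmetric] eq(4) by (rule zero_mat_mult_vec[OF that])
  have *: "z \<in> (*\<^sub>v) f ` carrier_vec y" if z: "z \<in> mat_kernel g" for z
  proof -
    have zc: "z \<in> carrier_vec m" and gz: "g *\<^sub>v z = 0\<^sub>v x" using mat_kernelD[OF g z] by auto
    have "z = (f * r + s * g) *\<^sub>v z" using eq(3) zc by simp
    also have "\<dots> = f *\<^sub>v (r *\<^sub>v z) + s *\<^sub>v (g *\<^sub>v z)"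
      using add_mult_distrib_mat_vec[of "f * r" m m "s * g" z] f g r s zc
        assoc_mult_mat_vec[OF f r zc] assoc_mult_mat_vec[OF s g zc]
      by (metis mult_carrier_mat)
    also have "\<dots> = f *\<^sub>v (r *\<^sub>v z)" using gz f r s zc by auto
    finally have "z = f *\<^sub>v (r *\<^sub>v z)" .
    moreover have "r *\<^sub>v z \<in> carrier_vec y" using r zc by auto
    ultimately show ?thesis by (rule image_eqI)
  qed
  show "(*\<^sub>v) f ` carrier_vec y = mat_kernel g"
  proof (intro equalityI subsetI)
    fix z assume "z \<in> (*\<^sub>v) f ` carrier_vec y"
    then obtain w where "w \<in> carrier_vec y" "z = f *\<^sub>v w" by blast
    then show "z \<in> mat_kernel g" using f gf0
      by (intro mat_kernelI[OF g]) auto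
  qed (rule *)
  have "z \<in> (*\<^sub>v) g ` carrier_vec m" if z: "z \<in> carrier_vec x" for z
  proof (rule image_eqI)
    show "z = g *\<^sub>v (s *\<^sub>v z)" using assoc_mult_mat_vec[OF g s z] eq(1) z by simp
    show "s *\<^sub>v z \<in> carrier_vec m" using s z by auto
  qed
  then show "(*\<^sub>v) g ` carrier_vec m = carrier_vec x" using g by auto
qed

section \<open>Biproducts and extensions\<close>

lemma total_hom_comp:
  assumes "total_hom A B f" "total_hom B C g" "total_rep A" "total_rep B" "total_rep C"
  shows "total_hom A C (\<lambda>v. g v * f v)"
  unfolding total_hom_def
proof (intro conjI allI)
  fix v
  note d = total_hom_dims[OF assms(1)] total_hom_dims[OF assms(2)] total_rep_dims[OF assms(3)]
    total_rep_dims[OF assms(4)] total_rep_dims[OF assms(5)]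
  show "g v * f v \<in> carrier_mat (vdim C v) (vdim A v)" using d by auto
  have "g (Suc v) * f (Suc v) * arr A v = g (Suc v) * (arr B v * f v)"
    using d by (simp add: mult_assoc_dim total_hom_commute[OF assms(1)])
  also have "\<dots> = arr C v * (g v * f v)"
    using d by (intro mult_eq_mult_right total_hom_commute[OF assms(2)]) auto
  finally show "g (Suc v) * f (Suc v) * arr A v = arr C v * (g v * f v)" .
qed

lemma total_hom_add:
  assumes "total_hom A B f" "total_hom A B g" "total_rep A" "total_rep B"
  shows "total_hom A B (\<lambda>v. f v + g v)"
  using total_hom_dims[OF assms(1)] total_hom_dims[OF assms(2)] total_rep_dims[OF assms(3)]
    total_rep_dims[OF assms(4)] total_hom_commute[OF assms(1)] total_hom_commute[OF assms(2)]
  by (auto simp: total_hom_def mat_algebra)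

text \<open>Described by structure maps and not by block matrices, so that one notion serves
  \<open>rep_sum\<close>, split extensions and the complement of a summand.\<close>

definition biproduct where
  "biproduct A B S iA pA iB pB \<longleftrightarrow>
     total_hom A S iA \<and> total_hom S A pA \<and> total_hom B S iB \<and> total_hom S B pB \<and>
     (\<forall>v. pA v * iA v = 1\<^sub>m (vdim A v) \<and> pB v * iB v = 1\<^sub>m (vdim B v) \<and>
       pA v * iB v = 0\<^sub>m (vdim A v) (vdim B v) \<and> pB v * iA v = 0\<^sub>m (vdim B v) (vdim A v) \<and>
       iA v * pA v + iB v * pB v = 1\<^sub>m (vdim S v))"

section \<open>Coordinate maps of a direct sum of two spaces\<close>

definition block_inl :: "nat \<Rightarrow> nat \<Rightarrow> 'k::field mat" where
  "block_inl a b = mat (a + b) a (\<lambda>(i,j). if i = j then 1 else 0)"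

definition block_inr :: "nat \<Rightarrow> nat \<Rightarrow> 'k::field mat" where
  "block_inr a b = mat (a + b) b (\<lambda>(i,j). if i = a + j then 1 else 0)"

definition block_prl :: "nat \<Rightarrow> nat \<Rightarrow> 'k::field mat" where
  "block_prl a b = mat a (a + b) (\<lambda>(i,j). if i = j then 1 else 0)"

definition block_prr :: "nat \<Rightarrow> nat \<Rightarrow> 'k::field mat" where
  "block_prr a b = mat b (a + b) (\<lambda>(i,j). if j = a + i then 1 else 0)"

lemma block_dims [simp]:
  "dim_row (block_inl a b) = a + b" "dim_col (block_inl a b) = a"
  "dim_row (block_inr a b) = a + b" "dim_col (block_inr a b) = b"
  "dim_row (block_prl a b) = a" "dim_col (block_prl a b) = a + b"
  "dim_row (block_prr a b) = b" "dim_col (block_prr a b) = a + b"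
  by (simp_all add: block_inl_def block_inr_def block_prl_def block_prr_def)

lemma sum_indicator_mult:
  fixes f :: "nat \<Rightarrow> 'k::field"
  assumes "\<And>k. k < m \<Longrightarrow> P k \<longleftrightarrow> k = j"
  shows "(\<Sum>k = 0..<m. (if P k then 1 else 0) * f k) = (if j < m then f j else 0)"
    "(\<Sum>k = 0..<m. f k * (if P k then 1 else 0)) = (if j < m then f j else 0)"
proof -
  have "(\<Sum>k = 0..<m. (if P k then 1 else 0) * f k) = (\<Sum>k = 0..<m. if k = j then f k else 0)"
    using assms by (intro sum.cong) auto
  then show "(\<Sum>k = 0..<m. (if P k then 1 else 0) * f k) = (if j < m then f j else 0)"
    by (simp add: sum.delta)
  then show "(\<Sum>k = 0..<m. f k * (if P k then 1 else 0)) = (if j < m then f j else 0)"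
    by (simp add: mult.commute)
qed

lemma sum_indicator_mult':
  fixes f :: "nat \<Rightarrow> 'k::field"
  shows "(\<Sum>k = 0..<m. (if j = k then 1 else 0) * f k) = (if j < m then f j else 0)"
  by (rule sum_indicator_mult(1)) auto

lemma block_inl_mult:
  "dim_row X = a \<Longrightarrow> block_inl a b * X = mat (a + b) (dim_col X) (\<lambda>(i,j). if i < a then X $$ (i,j) else 0)"
  by (intro eq_matI) (auto simp: block_inl_def scalar_prod_def sum_indicator_mult sum_indicator_mult')

lemma block_inr_mult:
  "dim_row X = b \<Longrightarrow> block_inr a b * X = mat (a + b) (dim_col X) (\<lambda>(i,j). if a \<le> i then X $$ (i - a,j) else 0)"
proof (intro eq_matI)
  fix i j
  assume X: "dim_row X = b" and "i < dim_row (mat (a + b) (dim_col X) (\<lambda>(i,j). if a \<le> i then X $$ (i - a,j) else 0))"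
    "j < dim_col (mat (a + b) (dim_col X) (\<lambda>(i,j). if a \<le> i then X $$ (i - a,j) else 0))"
  then have ij: "i < a + b" "j < dim_col X" by auto
  have "(block_inr a b * X) $$ (i,j) = (\<Sum>k = 0..<b. (if i = a + k then 1 else 0) * X $$ (k,j))"
    using X ij by (simp add: block_inr_def scalar_prod_def)
  also have "\<dots> = (if a \<le> i then X $$ (i - a, j) else 0)"
  proof (cases "a \<le> i")
    case True
    then show ?thesis using ij by (subst sum_indicator_mult(1)[of _ _ "i - a"]) auto
  qed auto
  finally show "(block_inr a b * X) $$ (i,j) = mat (a + b) (dim_col X) (\<lambda>(i,j). if a \<le> i then X $$ (i - a,j) else 0) $$ (i,j)"
    using ij by simp
qed auto

lemma block_prl_mult:
  "dim_row X = a + b \<Longrightarrow> block_prl a b * X = mat a (dim_col X) (\<lambda>(i,j). X $$ (i,j))"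
  by (intro eq_matI) (auto simp: block_prl_def scalar_prod_def sum_indicator_mult sum_indicator_mult')

lemma block_prr_mult:
  "dim_row X = a + b \<Longrightarrow> block_prr a b * X = mat b (dim_col X) (\<lambda>(i,j). X $$ (a + i,j))"
  by (intro eq_matI) (auto simp: block_prr_def scalar_prod_def sum_indicator_mult)

lemma block_identities:
  "block_prl a b * block_inl a b = 1\<^sub>m a" "block_prr a b * block_inr a b = 1\<^sub>m b"
  "block_prl a b * block_inr a b = 0\<^sub>m a b" "block_prr a b * block_inl a b = 0\<^sub>m b a"
  "block_inl a b * block_prl a b + block_inr a b * block_prr a b = 1\<^sub>m (a + b)"
  by (auto intro!: eq_matI simp: block_prl_mult block_prr_mult block_inl_mult block_inr_mult)
    (auto simp: block_inl_def block_inr_def block_prl_def block_prr_def)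

lemma block_exact:
  fixes a b :: nat
  defines "f \<equiv> block_inl a b :: 'k::field mat" and "g \<equiv> block_prr a b :: 'k mat"
  shows "inj_on ((*\<^sub>v) f) (carrier_vec a)"
    "(*\<^sub>v) f ` carrier_vec a = mat_kernel g"
    "(*\<^sub>v) g ` carrier_vec (a + b) = carrier_vec b"
proof -
  have "f \<in> carrier_mat (a + b) a" "g \<in> carrier_mat b (a + b)"
    "block_inr a b \<in> carrier_mat (a + b) b" "block_prl a b \<in> carrier_mat a (a + b)"
    by (auto simp: f_def g_def intro!: carrier_matI)
  note ex = split_at_vertex_imp_exact[OF this, unfolded f_def g_def block_identities, OF refl refl refl refl]
  show "inj_on ((*\<^sub>v) f) (carrier_vec a)"
    "(*\<^sub>v) f ` carrier_vec a = mat_kernel g"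
    "(*\<^sub>v) g ` carrier_vec (a + b) = carrier_vec b"
    unfolding f_def g_def by (fact ex)+
qed

text \<open>Replaces block matrices by their composites with the coordinate maps. After this,
  commutation with the arrows of \<open>rep_sum\<close> or of \<open>cocycle_extension\<close> is
  plain matrix algebra.\<close>

lemma four_block_mat_decompose:
  assumes "A \<in> carrier_mat a c" "B \<in> carrier_mat a d" "C \<in> carrier_mat b c" "D \<in> carrier_mat b d"
  shows "block_prl a b * four_block_mat A B C D = A * block_prl c d + B * block_prr c d"
    "block_prr a b * four_block_mat A B C D = C * block_prl c d + D * block_prr c d"
    "four_block_mat A B C D * block_inl c d = block_inl a b * A + block_inr a b * C"
    "four_block_mat A B C D * block_inr c d = block_inl a b * B + block_inr a b * D"
proof -
  let ?M = "four_block_mat A B C D"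
  note d = carrier_matD[OF assms(1)] carrier_matD[OF assms(2)] carrier_matD[OF assms(3)]
    carrier_matD[OF assms(4)]
  have col: "X * block_prl c d = mat (dim_row X) (c + d) (\<lambda>(i,j). if j < c then X $$ (i,j) else 0)"
    if "dim_col X = c" for X :: "'a mat"
    using that by (intro eq_matI) (auto simp: block_prl_def scalar_prod_def sum_indicator_mult sum_indicator_mult')
  have col2: "X * block_prr c d = mat (dim_row X) (c + d) (\<lambda>(i,j). if c \<le> j then X $$ (i,j - c) else 0)"
    if X: "dim_col X = d" for X :: "'a mat"
  proof (intro eq_matI)
    fix i j
    assume "i < dim_row (mat (dim_row X) (c + d) (\<lambda>(i,j). if c \<le> j then X $$ (i,j - c) else 0))"
      "j < dim_col (mat (dim_row X) (c + d) (\<lambda>(i,j). if c \<le> j then X $$ (i,j - c) else 0))"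
    then have ij: "i < dim_row X" "j < c + d" by auto
    have "(X * block_prr c d) $$ (i,j) = (\<Sum>k = 0..<d. X $$ (i,k) * (if j = c + k then 1 else 0))"
      using X ij by (simp add: block_prr_def scalar_prod_def)
    also have "\<dots> = (if c \<le> j then X $$ (i, j - c) else 0)"
    proof (cases "c \<le> j")
      case True
      then show ?thesis using ij by (subst sum_indicator_mult(2)[of _ _ "j - c"]) auto
    qed auto
    finally show "(X * block_prr c d) $$ (i,j) =
        mat (dim_row X) (c + d) (\<lambda>(i,j). if c \<le> j then X $$ (i,j - c) else 0) $$ (i,j)"
      using ij by simp
  qed auto
  have row: "X * block_inl c d = mat (dim_row X) c (\<lambda>(i,j). X $$ (i,j))"
    if "dim_col X = c + d" for X :: "'a mat"
    using that by (intro eq_matI) (auto simp: block_inl_def scalar_prod_def sum_indicator_mult sum_indicator_mult')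
  have row2: "X * block_inr c d = mat (dim_row X) d (\<lambda>(i,j). X $$ (i,c + j))"
    if "dim_col X = c + d" for X :: "'a mat"
    using that by (intro eq_matI) (auto simp: block_inr_def scalar_prod_def sum_indicator_mult)
  show "block_prl a b * ?M = A * block_prl c d + B * block_prr c d"
    using d by (intro eq_matI) (auto simp: block_prl_mult col col2)
  show "block_prr a b * ?M = C * block_prl c d + D * block_prr c d"
    using d by (intro eq_matI) (auto simp: block_prr_mult col col2)
  show "?M * block_inl c d = block_inl a b * A + block_inr a b * C"
    using d by (intro eq_matI) (auto simp: row block_inl_mult block_inr_mult)
  show "?M * block_inr c d = block_inl a b * B + block_inr a b * D"
    using d by (intro eq_matI) (auto simp: row2 block_inl_mult block_inr_mult)
qed

lemma biproduct_rep_sum: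
  assumes "total_rep A" "total_rep B"
  shows "biproduct A B (rep_sum A B)
    (\<lambda>v. block_inl (vdim A v) (vdim B v)) (\<lambda>v. block_prl (vdim A v) (vdim B v))
    (\<lambda>v. block_inr (vdim A v) (vdim B v)) (\<lambda>v. block_prr (vdim A v) (vdim B v))"
proof -
  have c: "arr A v \<in> carrier_mat (vdim A (Suc v)) (vdim A v)" "arr B v \<in> carrier_mat (vdim B (Suc v)) (vdim B v)" for v
    using assms by (auto simp: total_rep_def)
  note d = total_rep_dims[OF assms(1)] total_rep_dims[OF assms(2)]
  show ?thesis
    unfolding biproduct_def total_hom_def rep_sum_def
    by (auto simp: block_identities four_block_mat_decompose[OF c(1) zero_carrier_mat zero_carrier_mat c(2)]
      mat_algebra d intro!: carrier_matI)
qed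

lemma total_rep_rep_sum: "total_rep A \<Longrightarrow> total_rep B \<Longrightarrow> total_rep (rep_sum A B)"
  by (auto simp: total_rep_def rep_sum_def)

text \<open>The zero block makes \<open>Y\<close> a subrepresentation with quotient
  \<open>X\<close>. Every family \<open>c\<close> of matrices of the right sizes is allowed because
  the quiver has no relations, and \<open>c = 0\<close> gives the split extension.\<close>

definition cocycle_extension :: "'k::field rep \<Rightarrow> 'k rep \<Rightarrow> (nat \<Rightarrow> 'k mat) \<Rightarrow> 'k rep" where
  "cocycle_extension X Y c = Rep (\<lambda>v. vdim Y v + vdim X v)
     (\<lambda>v. four_block_mat (arr Y v) (c v) (0\<^sub>m (vdim X (Suc v)) (vdim Y v)) (arr X v))"

lemma nat_rep_cocycle_extension:
  assumes "nat_rep n X" "nat_rep n Y"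
  shows "nat_rep n (cocycle_extension X Y c)"
  using assms by (auto simp: nat_rep_def total_rep_def cocycle_extension_def)

lemma cocycle_extension_mem_extensions:
  assumes X: "is_rep n X" and Y: "is_rep n Y"
    and c: "\<And>v. c v \<in> carrier_mat (vdim (extend n Y) (Suc v)) (vdim (extend n X) v)"
  shows "(cocycle_extension (extend n X) (extend n Y) c,
      restrict (\<lambda>v. block_inl (vdim (extend n Y) v) (vdim (extend n X) v)) {1..n},
      restrict (\<lambda>v. block_prr (vdim (extend n Y) v) (vdim (extend n X) v)) {1..n}) \<in> extensions n X Y"
proof -
  let ?X = "extend n X" and ?Y = "extend n Y"
  let ?M = "cocycle_extension ?X ?Y c"
  have M: "nat_rep n ?M" by (intro nat_rep_cocycle_extension nat_rep_extend X Y)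
  have tX: "total_rep ?X" and tY: "total_rep ?Y"
    by (rule nat_rep_total, rule nat_rep_extend, fact)+
  have ca: "arr ?X v \<in> carrier_mat (vdim ?X (Suc v)) (vdim ?X v)"
    "arr ?Y v \<in> carrier_mat (vdim ?Y (Suc v)) (vdim ?Y v)" for v
    using tX tY by (auto simp: total_rep_def)
  note d = total_rep_dims[OF tX] total_rep_dims[OF tY] carrier_matD[OF c]
  note fb = four_block_mat_decompose[OF ca(2) c zero_carrier_mat ca(1)]
  have f: "total_hom ?Y ?M (\<lambda>v. block_inl (vdim ?Y v) (vdim ?X v))"
    unfolding total_hom_def by (auto simp: cocycle_extension_def fb mat_algebra d intro!: carrier_matI)
  have g: "total_hom ?M ?X (\<lambda>v. block_prr (vdim ?Y v) (vdim ?X v))"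
    unfolding total_hom_def by (auto simp: cocycle_extension_def fb mat_algebra d intro!: carrier_matI)
  have eM: "extend n ?M = ?M" by (rule extend_nat_rep[OF M])
  note ex = block_exact[where 'k = 'a and a = "vdim ?Y v" and b = "vdim ?X v" for v]
  have vX: "vdim X v = vdim ?X v" "vdim Y v = vdim ?Y v" if "v \<in> {1..n}" for v
    using that by (auto simp: vdim_extend)
  have vM: "vdim ?M v = vdim ?Y v + vdim ?X v" for v by (simp add: cocycle_extension_def)
  have "restrict (\<lambda>v. block_inl (vdim ?Y v) (vdim ?X v)) {1..n} \<in> Hom n Y ?M"
    by (rule restrict_mem_Hom) (use f eM in simp)
  moreover have "restrict (\<lambda>v. block_prr (vdim ?Y v) (vdim ?X v)) {1..n} \<in> Hom n ?M X"
    by (rule restrict_mem_Hom) (use g eM in simp)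
  ultimately show ?thesis using ex nat_rep_is_rep[OF M]
    by (simp add: extensions_def short_exact_def vM vX)
qed

text \<open>Multiplying the third equation by \<open>r\<close> from the left gives
  \<open>r = r + r * s * g\<close>, so \<open>r * s * g = 0\<close>, and \<open>s\<close> on the
  right cancels \<open>g\<close>.\<close>

lemma section_retraction_zero:
  fixes f g s r :: "'k::field mat"
  assumes d: "dim_row f = m" "dim_col f = y" "dim_row g = x" "dim_col g = m" "dim_row s = m"
      "dim_col s = x" "dim_row r = y" "dim_col r = m"
    and eq: "g * s = 1\<^sub>m x" "r * f = 1\<^sub>m y" "f * r + s * g = 1\<^sub>m m"
  shows "r * s = 0\<^sub>m y x"
proof -
  have "r * (f * r + s * g) = r" using eq(3) d by simp
  then have h: "r + r * (s * g) = r" using d eq(2) by (simp add: mat_algebra mult_eq_one_right)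
  have "(r * (s * g)) $$ (i,j) = 0" if "i < y" "j < m" for i j
    using arg_cong[OF h, of "\<lambda>X. X $$ (i,j)"] that d by (simp del: index_mult_mat(1))
  then have "r * (s * g) = 0\<^sub>m y m" using d by (intro eq_matI) auto
  then have "r * (s * g) * s = 0\<^sub>m y x" using d by simp
  then show ?thesis using d eq(1) by (simp add: mat_algebra)
qed

text \<open>The sequence splits at each vertex, but the sections chosen there need not commute with
  the arrows. Their defect is a cocycle with values in \<open>Y\<close>; by \<open>Ext0\<close> it
  is a coboundary, and subtracting it repairs the section. The retraction is then forced.\<close>

lemma extension_splits:
  assumes X: "is_rep n X" and Y: "is_rep n Y" and ext: "Ext0 (extend n X) (extend n Y)"
    and e: "(M, f, g) \<in> extensions n X Y"
  shows "\<exists>r s. biproduct (extend n Y) (extend n X) (extend n M) (extend_hom n f) r s (extend_hom n g)"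
proof -
  let ?X = "extend n X" and ?Y = "extend n Y" and ?M = "extend n M"
  let ?f = "extend_hom n f" and ?g = "extend_hom n g"
  have M: "is_rep n M" and f: "f \<in> Hom n Y M" and g: "g \<in> Hom n M X"
    and ex: "\<And>v. v \<in> {1..n} \<Longrightarrow> inj_on ((*\<^sub>v) (f v)) (carrier_vec (vdim Y v)) \<and>
        (*\<^sub>v) (f v) ` carrier_vec (vdim Y v) = mat_kernel (g v) \<and>
        (*\<^sub>v) (g v) ` carrier_vec (vdim M v) = carrier_vec (vdim X v)"
    using e by (auto simp: extensions_def short_exact_def)
  have tot: "total_rep ?X" "total_rep ?Y" "total_rep ?M"
    using X Y M by (auto intro: nat_rep_total nat_rep_extend)
  have tf: "total_hom ?Y ?M ?f" and tg: "total_hom ?M ?X ?g"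
    using total_hom_extend_hom X Y M f g by blast+
  have "\<exists>s r. s \<in> carrier_mat (vdim ?M v) (vdim ?X v) \<and> r \<in> carrier_mat (vdim ?Y v) (vdim ?M v) \<and>
      ?g v * s = 1\<^sub>m (vdim ?X v) \<and> r * ?f v = 1\<^sub>m (vdim ?Y v) \<and>
      ?f v * r + s * ?g v = 1\<^sub>m (vdim ?M v) \<and> ?g v * ?f v = 0\<^sub>m (vdim ?X v) (vdim ?Y v)" for v
  proof (cases "v \<in> {1..n}")
    case True
    have "f v \<in> carrier_mat (vdim M v) (vdim Y v)" "g v \<in> carrier_mat (vdim X v) (vdim M v)"
      using f g True by (auto simp: Hom_def PiE_iff)
    from exact_imp_split_at_vertex[OF this] ex[OF True] show ?thesis
      using True unfolding vdim_extend extend_hom_def by (auto; blast)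
  next
    case False
    then show ?thesis unfolding vdim_extend extend_hom_def
      by (auto intro!: exI[of _ "0\<^sub>m 0 0"])
  qed
  then obtain s r where s0: "\<And>v. s v \<in> carrier_mat (vdim ?M v) (vdim ?X v)"
    and r0: "\<And>v. r v \<in> carrier_mat (vdim ?Y v) (vdim ?M v)"
    and gs: "\<And>v. ?g v * s v = 1\<^sub>m (vdim ?X v)" and rf: "\<And>v. r v * ?f v = 1\<^sub>m (vdim ?Y v)"
    and frsg: "\<And>v. ?f v * r v + s v * ?g v = 1\<^sub>m (vdim ?M v)"
    and gf: "\<And>v. ?g v * ?f v = 0\<^sub>m (vdim ?X v) (vdim ?Y v)"
    by metis
  note d = total_rep_dims[OF tot(1)] total_rep_dims[OF tot(2)] total_rep_dims[OF tot(3)]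
    carrier_matD[OF s0] carrier_matD[OF r0] total_hom_dims[OF tf] total_hom_dims[OF tg]
  \<comment> \<open>The \<open>Y\<close>-component of \<open>arr ?M v * s v\<close>; its
    \<open>X\<close>-component is already the right one, so by \<open>Ms\<close> this is the whole
    failure of \<open>s\<close> to be a morphism.\<close>
  define c where "c v = r (Suc v) * (arr ?M v * s v)" for v
  have c: "c v \<in> carrier_mat (vdim ?Y (Suc v)) (vdim ?X v)" for v using d by (auto simp: c_def)
  from ext c obtain \<phi> where \<phi>: "\<And>v. \<phi> v \<in> carrier_mat (vdim ?Y v) (vdim ?X v)"
    "\<And>v. \<phi> (Suc v) * arr ?X v = arr ?Y v * \<phi> v + c v"
    unfolding Ext0_def by metis
  note d = d carrier_matD[OF \<phi>(1)] carrier_matD[OF c]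
  have Ms: "arr ?M v * s v = s (Suc v) * arr ?X v + ?f (Suc v) * c v" for v
  proof -
    have "arr ?M v * s v = (?f (Suc v) * r (Suc v) + s (Suc v) * ?g (Suc v)) * (arr ?M v * s v)"
      using frsg[of "Suc v"] d by simp
    also have "\<dots> = ?f (Suc v) * c v + s (Suc v) * (?g (Suc v) * (arr ?M v * s v))"
      using d by (simp add: mat_algebra c_def)
    also have "?g (Suc v) * (arr ?M v * s v) = arr ?X v * (?g v * s v)"
      using d by (intro mult_eq_mult_right total_hom_commute[OF tg]) auto
    also have "\<dots> = arr ?X v" using gs d by simp
    finally show ?thesis using d comm_add_mat[of "s (Suc v) * arr ?X v" "vdim ?M (Suc v)" "vdim ?X v"
      "?f (Suc v) * c v"] by auto
  qed
  \<comment> \<open>Adding \<open>?f v * \<phi> v\<close> keeps \<open>S\<close> a section of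
    \<open>?g\<close>, and the equation for \<open>\<phi>\<close> makes the two error terms
    \<open>c v\<close> and \<open>arr ?Y v * \<phi> v\<close> combine to
    \<open>\<phi> (Suc v) * arr ?X v\<close>.\<close>
  define S where "S v = s v + ?f v * \<phi> v" for v
  \<comment> \<open>This is \<open>r * (1 - S * g)\<close>: the second factor maps into the kernel
    of \<open>?g\<close>, that is, into the image of \<open>?f\<close>, where \<open>r\<close>
    inverts \<open>?f\<close>.\<close>
  define R where "R v = r v - r v * (S v * ?g v)" for v
  have dS: "dim_row (S v) = vdim ?M v" "dim_col (S v) = vdim ?X v"
    "dim_row (R v) = vdim ?Y v" "dim_col (R v) = vdim ?M v" for v using d by (auto simp: S_def R_def)
  have gS: "?g v * S v = 1\<^sub>m (vdim ?X v)" for v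
    using d gs gf by (simp add: S_def mat_algebra mult_eq_zero_right)
  have "total_hom ?X ?M S" unfolding total_hom_def
  proof (intro conjI allI)
    fix v
    show "S v \<in> carrier_mat (vdim ?M v) (vdim ?X v)" using dS by auto
    have "arr ?M v * S v = s (Suc v) * arr ?X v + ?f (Suc v) * c v + arr ?M v * (?f v * \<phi> v)"
      using d by (simp add: S_def mat_algebra Ms)
    also have "arr ?M v * (?f v * \<phi> v) = ?f (Suc v) * (arr ?Y v * \<phi> v)"
      using d by (intro mult_eq_mult_right total_hom_commute[OF tf, symmetric]) auto
    also have "s (Suc v) * arr ?X v + ?f (Suc v) * c v + ?f (Suc v) * (arr ?Y v * \<phi> v) =
        s (Suc v) * arr ?X v + ?f (Suc v) * (arr ?Y v * \<phi> v + c v)"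
      using d by (intro eq_matI) (auto simp: mat_algebra simp del: index_mult_mat(1))
    also have "\<dots> = S (Suc v) * arr ?X v"
      using d by (simp add: S_def mat_algebra \<phi>(2)[symmetric])
    finally show "S (Suc v) * arr ?X v = arr ?M v * S v" ..
  qed
  note tS = this
  have fR: "?f v * R v + S v * ?g v = 1\<^sub>m (vdim ?M v)" for v
  proof -
    have h: "?f v * r v + s v * ?g v = 1\<^sub>m (vdim ?M v)" by (rule frsg)
    have "r v * s v = 0\<^sub>m (vdim ?Y v) (vdim ?X v)"
      by (rule section_retraction_zero[OF _ _ _ _ _ _ _ _ gs rf frsg]) (use d in auto)
    then have "r v * S v = \<phi> v" using d rf by (simp add: S_def mat_algebra mult_eq_one_right)
    then have "r v * (S v * ?g v) = \<phi> v * ?g v" using d dS mult_assoc_dim[of "r v" "S v" "?g v"] by simp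
    then have "?f v * R v + S v * ?g v = ?f v * r v - ?f v * (\<phi> v * ?g v) + (s v * ?g v + ?f v * (\<phi> v * ?g v))"
      using d by (simp add: R_def S_def mat_algebra)
    also have "\<dots> = ?f v * r v + s v * ?g v"
      using d by (intro eq_matI) (auto simp del: index_mult_mat(1))
    finally show ?thesis using h by simp
  qed
  have Rf: "R v * ?f v = 1\<^sub>m (vdim ?Y v)" for v
  proof -
    have "R v * ?f v = r v * ?f v - r v * (S v * (?g v * ?f v))"
      using d dS by (simp add: R_def mat_algebra)
    also have "\<dots> = 1\<^sub>m (vdim ?Y v)" using d dS gf rf by (auto simp: mat_algebra intro!: eq_matI)
    finally show ?thesis .
  qed
  have RS: "R v * S v = 0\<^sub>m (vdim ?Y v) (vdim ?X v)" for v
    by (rule section_retraction_zero[OF _ _ _ _ _ _ _ _ gS Rf fR]) (use d dS in auto)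
  have "total_hom ?M ?Y R" unfolding total_hom_def
  proof (intro conjI allI)
    fix v
    show "R v \<in> carrier_mat (vdim ?Y v) (vdim ?M v)" using dS by auto
    have "R (Suc v) * arr ?M v = R (Suc v) * (arr ?M v * (?f v * R v + S v * ?g v))"
      using d fR by simp
    also have "\<dots> = R (Suc v) * (arr ?M v * (?f v * R v)) + R (Suc v) * (arr ?M v * (S v * ?g v))"
      using d dS by (simp add: mat_algebra)
    also have "arr ?M v * (?f v * R v) = ?f (Suc v) * (arr ?Y v * R v)"
      using d dS by (intro mult_eq_mult_right total_hom_commute[OF tf, symmetric]) auto
    also have "arr ?M v * (S v * ?g v) = S (Suc v) * (arr ?X v * ?g v)"
      using d dS by (intro mult_eq_mult_right total_hom_commute[OF tS, symmetric]) auto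
    also have "R (Suc v) * (?f (Suc v) * (arr ?Y v * R v)) = arr ?Y v * R v"
      using d dS mult_eq_one_right[OF Rf, of "Suc v" "arr ?Y v * R v"] by simp
    also have "R (Suc v) * (S (Suc v) * (arr ?X v * ?g v)) = 0\<^sub>m (vdim ?Y (Suc v)) (vdim ?M v)"
      using d dS mult_eq_zero_right[OF RS, of "Suc v" "arr ?X v * ?g v"] by simp
    finally show "R (Suc v) * arr ?M v = arr ?Y v * R v" using d dS by (simp add: mat_algebra)
  qed
  then show ?thesis using tf tg tS gS Rf RS fR gf unfolding biproduct_def by blast
qed

section \<open>Vanishing of the Yoneda Ext\<close>

lemma yoneda_equivI:
  assumes "(M, f, g) \<in> extensions n X Y" "(M', f', g') \<in> extensions n X Y" "h \<in> Hom n M M'"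
    "comp_hom n h f = f'" "comp_hom n g' h = g"
  shows "((M, f, g), (M', f', g')) \<in> yoneda_equiv n X Y"
  using assms by (auto simp: yoneda_equiv_def)

text \<open>The images of \<open>e\<close> and of \<open>e'\<close> under the relation are both the
  single element of the quotient. Since \<open>yoneda_equiv\<close> is not assumed to be an
  equivalence relation here, reflexivity at \<open>e\<close> is a premise; it puts \<open>e\<close>
  into the image of \<open>e'\<close>.\<close>

lemma Ext_vanishes_imp_related:
  assumes "Ext_vanishes n X Y" "e \<in> extensions n X Y" "e' \<in> extensions n X Y"
    "(e, e) \<in> yoneda_equiv n X Y"
  shows "(e', e) \<in> yoneda_equiv n X Y"
proof -
  obtain C where "Ext1 n X Y = {C}"
    using assms(1) by (auto simp: Ext_vanishes_def is_singleton_def)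
  then have "yoneda_equiv n X Y `` {e} = yoneda_equiv n X Y `` {e'}"
    using quotientI[OF assms(2), of "yoneda_equiv n X Y"] quotientI[OF assms(3), of "yoneda_equiv n X Y"]
    by (simp add: Ext1_def)
  then show ?thesis using assms(4) by (metis Image_singleton_iff)
qed

text \<open>From left to right, a Yoneda equivalence from the split extension to the extension with
  cocycle \<open>c\<close> yields a solution of the coboundary equation. Conversely, any two
  extensions split, so that all extensions are related and there is one class.\<close>

lemma Ext_vanishes_iff:
  assumes X: "is_rep n X" and Y: "is_rep n Y"
  shows "Ext_vanishes n X Y \<longleftrightarrow> Ext0 (extend n X) (extend n Y)"
proof
  let ?X = "extend n X" and ?Y = "extend n Y"
  let ?f = "\<lambda>v. block_inl (vdim ?Y v) (vdim ?X v)"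
  let ?g = "\<lambda>v. block_prr (vdim ?Y v) (vdim ?X v)"
  let ?s = "\<lambda>v. block_inr (vdim ?Y v) (vdim ?X v)"
  let ?r = "\<lambda>v. block_prl (vdim ?Y v) (vdim ?X v)"
  let ?e = "\<lambda>c. (cocycle_extension ?X ?Y c, restrict ?f {1..n}, restrict ?g {1..n})"
  have tX: "total_rep ?X" and tY: "total_rep ?Y"
    by (rule nat_rep_total, rule nat_rep_extend, fact)+
  {
    assume h: "Ext_vanishes n X Y"
    show "Ext0 ?X ?Y" unfolding Ext0_def
    proof (intro allI impI)
      fix c :: "nat \<Rightarrow> 'a mat"
      assume c: "\<forall>v. c v \<in> carrier_mat (vdim ?Y (Suc v)) (vdim ?X v)"
      \<comment> \<open>The zero cocycle, that is, the split extension, where \<open>?s\<close> is a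
        morphism; composing with the equivalence \<open>H\<close> transports this section to
        \<open>?M\<close>.\<close>
      define z where "z v = (0\<^sub>m (vdim ?Y (Suc v)) (vdim ?X v) :: 'a mat)" for v
      have z: "\<And>v. z v \<in> carrier_mat (vdim ?Y (Suc v)) (vdim ?X v)" by (simp add: z_def)
      let ?M = "cocycle_extension ?X ?Y c" and ?Z = "cocycle_extension ?X ?Y z"
      have M: "nat_rep n ?M" and Z: "nat_rep n ?Z"
        by (intro nat_rep_cocycle_extension nat_rep_extend X Y)+
      have ec: "?e c \<in> extensions n X Y" and ez: "?e z \<in> extensions n X Y"
        by (rule cocycle_extension_mem_extensions[OF X Y], use c z in simp)+
      have "restrict (\<lambda>v. 1\<^sub>m (vdim ?M v)) {1..n} \<in> Hom n ?M ?M"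
      proof (rule restrict_mem_Hom)
        show "total_hom (extend n ?M) (extend n ?M) (\<lambda>v. 1\<^sub>m (vdim ?M v))"
          using total_rep_dims[OF nat_rep_total[OF M]]
          by (simp add: extend_nat_rep[OF M] total_hom_def)
      qed
      moreover have "comp_hom n (restrict (\<lambda>v. 1\<^sub>m (vdim ?M v)) {1..n}) (restrict ?f {1..n}) = restrict ?f {1..n}"
        "comp_hom n (restrict ?g {1..n}) (restrict (\<lambda>v. 1\<^sub>m (vdim ?M v)) {1..n}) = restrict ?g {1..n}"
        by (auto simp: comp_hom_def cocycle_extension_def)
      ultimately have "(?e c, ?e c) \<in> yoneda_equiv n X Y"
        by (intro yoneda_equivI ec)
      from Ext_vanishes_imp_related[OF h ec ez this]
      have "(?e z, ?e c) \<in> yoneda_equiv n X Y" .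
      then obtain h where h: "h \<in> Hom n ?Z ?M"
        and gh: "comp_hom n (restrict ?g {1..n}) h = restrict ?g {1..n}"
        by (auto simp: yoneda_equiv_def)
      define H where "H = extend_hom n h"
      have H: "total_hom ?Z ?M H"
        using total_hom_extend_hom[OF nat_rep_is_rep[OF Z] nat_rep_is_rep[OF M] h]
        by (simp add: H_def extend_nat_rep[OF M] extend_nat_rep[OF Z])
      have vd: "vdim ?M v = vdim ?Y v + vdim ?X v" "vdim ?Z v = vdim ?Y v + vdim ?X v" for v
        by (simp_all add: cocycle_extension_def)
      have a: "arr ?X v \<in> carrier_mat (vdim ?X (Suc v)) (vdim ?X v)"
        "arr ?Y v \<in> carrier_mat (vdim ?Y (Suc v)) (vdim ?Y v)" for v
        using tX tY by (auto simp: total_rep_def)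
      have cc: "\<And>v. c v \<in> carrier_mat (vdim ?Y (Suc v)) (vdim ?X v)" using c by blast
      note fb = four_block_mat_decompose[OF a(2) cc zero_carrier_mat a(1)]
      note fz = four_block_mat_decompose[OF a(2) z zero_carrier_mat a(1)]
      note d = total_rep_dims[OF tX] total_rep_dims[OF tY] carrier_matD[OF cc]
        total_hom_dims[OF H] vd total_rep_dims[OF nat_rep_total[OF M]]
        total_rep_dims[OF nat_rep_total[OF Z]]
      have gH: "?g v * H v = ?g v" for v
      proof (cases "v \<in> {1..n}")
        case True
        then show ?thesis using fun_cong[OF gh, of v] by (simp add: comp_hom_def H_def extend_hom_def)
      next
        case False
        then show ?thesis using d by (intro mat_eq_if_no_entries) (auto simp: vdim_extend)
      qed
      \<comment> \<open>The \<open>Y\<close>-component of the section \<open>H v * ?s v\<close> of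
        \<open>?M\<close>. Its \<open>X\<close>-component is the identity by \<open>gH\<close>, so
        that commutation with the arrows of \<open>?M\<close> is the coboundary equation for
        \<open>c\<close>.\<close>
      define \<phi> where "\<phi> v = ?r v * (H v * ?s v)" for v
      have "\<phi> (Suc v) * arr ?X v = arr ?Y v * \<phi> v + c v" for v
      proof -
        have "?s (Suc v) * arr ?X v = arr ?Z v * ?s v"
          using fz(4)[of v] d by (simp add: cocycle_extension_def z_def mat_algebra)
        then have "\<phi> (Suc v) * arr ?X v = ?r (Suc v) * (H (Suc v) * (arr ?Z v * ?s v))"
          using d by (simp add: \<phi>_def mult_assoc_dim)
        also have "H (Suc v) * (arr ?Z v * ?s v) = arr ?M v * (H v * ?s v)"
          using d by (intro mult_eq_mult_right total_hom_commute[OF H]) auto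
        also have "?r (Suc v) * (arr ?M v * (H v * ?s v)) = (?r (Suc v) * arr ?M v) * (H v * ?s v)"
          using d by (simp add: mult_assoc_dim)
        also have "?r (Suc v) * arr ?M v = arr ?Y v * ?r v + c v * ?g v"
          using fb(1)[of v] by (simp add: cocycle_extension_def)
        also have "(arr ?Y v * ?r v + c v * ?g v) * (H v * ?s v) = arr ?Y v * \<phi> v + c v * (?g v * H v * ?s v)"
          using d by (simp add: mat_algebra \<phi>_def)
        also have "?g v * H v * ?s v = 1\<^sub>m (vdim ?X v)" unfolding gH by (rule block_identities)
        finally show ?thesis using d by simp
      qed
      moreover have "\<phi> v \<in> carrier_mat (vdim ?Y v) (vdim ?X v)" for v using d by (auto simp: \<phi>_def)
      ultimately show "\<exists>f. (\<forall>v. f v \<in> carrier_mat (vdim ?Y v) (vdim ?X v)) \<and>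
        (\<forall>v. f (Suc v) * arr ?X v = arr ?Y v * f v + c v)" by blast
    qed
  next
    assume h: "Ext0 ?X ?Y"
    have all: "(e, e') \<in> yoneda_equiv n X Y" if e: "e \<in> extensions n X Y" "e' \<in> extensions n X Y" for e e'
    proof -
      obtain M f g where [simp]: "e = (M, f, g)" by (cases e)
      obtain M' f' g' where [simp]: "e' = (M', f', g')" by (cases e')
      have M: "is_rep n M" "is_rep n M'" using e by (auto simp: extensions_def)
      have fg: "f \<in> Hom n Y M" "g \<in> Hom n M X" "f' \<in> Hom n Y M'" "g' \<in> Hom n M' X"
        using e by (auto simp: extensions_def short_exact_def)
      have tM: "total_rep (extend n M)" "total_rep (extend n M')"
        using M by (auto intro: nat_rep_total nat_rep_extend)
      from extension_splits[OF X Y h, of M f g] e obtain r s where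
        b: "biproduct ?Y ?X (extend n M) (extend_hom n f) r s (extend_hom n g)" by auto
      from extension_splits[OF X Y h, of M' f' g'] e obtain r' s' where
        b': "biproduct ?Y ?X (extend n M') (extend_hom n f') r' s' (extend_hom n g')" by auto
      \<comment> \<open>Sends the \<open>Y\<close>-part and the \<open>X\<close>-part of one split
        extension identically to those of the other.\<close>
      let ?H = "\<lambda>v. extend_hom n f' v * r v + s' v * extend_hom n g v"
      have th: "total_hom (extend n M) ?Y r" "total_hom ?Y (extend n M') (extend_hom n f')"
        "total_hom (extend n M) ?X (extend_hom n g)" "total_hom ?X (extend n M') s'"
        "total_hom ?Y (extend n M) (extend_hom n f)" "total_hom (extend n M') ?X (extend_hom n g')"
        using b b' by (auto simp: biproduct_def)
      have H: "total_hom (extend n M) (extend n M') ?H"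
        by (intro total_hom_add total_hom_comp[OF th(1,2)] total_hom_comp[OF th(3,4)] tM tX tY)
      note d = total_hom_dims[OF th(1)] total_hom_dims[OF th(2)] total_hom_dims[OF th(3)]
        total_hom_dims[OF th(4)] total_hom_dims[OF th(5)] total_hom_dims[OF th(6)]
      have 1: "?H v * extend_hom n f v = extend_hom n f' v" for v
        using b d unfolding biproduct_def by (simp add: mat_algebra)
      have 2: "extend_hom n g' v * ?H v = extend_hom n g v" for v
        using b' d unfolding biproduct_def by (simp add: mat_algebra mult_eq_zero_right mult_eq_one_right)
      have "comp_hom n (restrict ?H {1..n}) f = f'"
      proof
        fix v show "comp_hom n (restrict ?H {1..n}) f v = f' v"
          using 1[of v] fg(3) by (auto simp: comp_hom_def extend_hom_def Hom_def PiE_iff extensional_def)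
      qed
      moreover have "comp_hom n g' (restrict ?H {1..n}) = g"
      proof
        fix v show "comp_hom n g' (restrict ?H {1..n}) v = g v"
          using 2[of v] fg(2) by (auto simp: comp_hom_def extend_hom_def Hom_def PiE_iff extensional_def)
      qed
      ultimately show ?thesis using yoneda_equivI[OF _ _ restrict_mem_Hom[OF H]] e by simp
    qed
    have cl: "yoneda_equiv n X Y `` {e} = extensions n X Y" if "e \<in> extensions n X Y" for e
      using all[OF that] by (auto simp: yoneda_equiv_def)
    have e0: "?e (\<lambda>v. 0\<^sub>m (vdim ?Y (Suc v)) (vdim ?X v)) \<in> extensions n X Y"
      by (intro cocycle_extension_mem_extensions X Y) auto
    have "Ext1 n X Y = {extensions n X Y}"
    proof
      show "Ext1 n X Y \<subseteq> {extensions n X Y}"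
        using cl by (auto simp: Ext1_def elim!: quotientE)
      show "{extensions n X Y} \<subseteq> Ext1 n X Y"
        using quotientI[OF e0, of "yoneda_equiv n X Y"] cl[OF e0] by (simp add: Ext1_def)
    qed
    then show "Ext_vanishes n X Y" by (simp add: Ext_vanishes_def)
  }
qed

section \<open>Perpendicular categories and path maps\<close>

lemma Hom0_retract:
  assumes i: "total_hom A S i" and p: "total_hom S A p" and pi: "\<And>v. p v * i v = 1\<^sub>m (vdim A v)"
    and tot: "total_rep A" "total_rep S" "total_rep Y" and h: "Hom0 S Y"
  shows "Hom0 A Y"
  unfolding Hom0_def
proof (intro allI impI)
  fix f v assume f: "total_hom A Y f"
  note d = total_hom_dims[OF i] total_hom_dims[OF p] total_hom_dims[OF f]
  have "f v * p v = 0\<^sub>m (vdim Y v) (vdim S v)"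
    using h total_hom_comp[OF p f tot(2,1,3)] by (auto simp: Hom0_def)
  then have "f v * p v * i v = 0\<^sub>m (vdim Y v) (vdim A v)" using d by simp
  then show "f v = 0\<^sub>m (vdim Y v) (vdim A v)" using d pi by (simp add: mult_assoc_dim)
qed

text \<open>The cocycle is pulled back along \<open>p\<close>, solved on \<open>S\<close>, and the
  solution restricted along \<open>i\<close>; \<open>p v * i v = 1\<close> recovers the given
  cocycle.\<close>

lemma Ext0_retract:
  assumes i: "total_hom A S i" and p: "total_hom S A p" and pi: "\<And>v. p v * i v = 1\<^sub>m (vdim A v)"
    and tot: "total_rep A" "total_rep S" "total_rep Y" and h: "Ext0 S Y"
  shows "Ext0 A Y"
  unfolding Ext0_def
proof (intro allI impI)
  fix c :: "nat \<Rightarrow> 'a mat" assume c: "\<forall>v. c v \<in> carrier_mat (vdim Y (Suc v)) (vdim A v)"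
  have cd: "dim_row (c v) = vdim Y (Suc v)" "dim_col (c v) = vdim A v" for v using c by auto
  note d = cd total_hom_dims[OF i] total_hom_dims[OF p]
    total_rep_dims[OF tot(1)] total_rep_dims[OF tot(2)] total_rep_dims[OF tot(3)]
  have "\<forall>v. c v * p v \<in> carrier_mat (vdim Y (Suc v)) (vdim S v)" using d by (auto intro!: carrier_matI)
  then obtain f where f: "\<And>v. f v \<in> carrier_mat (vdim Y v) (vdim S v)"
    "\<And>v. f (Suc v) * arr S v = arr Y v * f v + c v * p v"
    using h[unfolded Ext0_def, rule_format, of "\<lambda>v. c v * p v"] by blast
  note d = d carrier_matD[OF f(1)]
  have "f (Suc v) * i (Suc v) * arr A v = arr Y v * (f v * i v) + c v" for v
  proof -
    have "f (Suc v) * i (Suc v) * arr A v = f (Suc v) * arr S v * i v"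
      using d by (simp add: mult_assoc_dim total_hom_commute[OF i])
    also have "\<dots> = arr Y v * (f v * i v) + c v" unfolding f(2) using d pi by (simp add: mat_algebra)
    finally show ?thesis .
  qed
  moreover have "f v * i v \<in> carrier_mat (vdim Y v) (vdim A v)" for v using d by (intro carrier_matI) auto
  ultimately show "\<exists>f. (\<forall>v. f v \<in> carrier_mat (vdim Y v) (vdim A v)) \<and>
      (\<forall>v. f (Suc v) * arr A v = arr Y v * f v + c v)"
    by (intro exI[of _ "\<lambda>v. f v * i v"]) simp
qed

lemma perp0_retract:
  assumes "total_hom A S i" "total_hom S A p" "\<And>v. p v * i v = 1\<^sub>m (vdim A v)"
    "total_rep A" "total_rep S" "total_rep Y" "perp0 S Y"
  shows "perp0 A Y"
  using Hom0_retract[OF assms(1-6)] Ext0_retract[OF assms(1-6)] assms(7) by (simp add: perp0_def)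

lemma perp0_biproduct:
  assumes b: "biproduct A B S iA pA iB pB" and tot: "total_rep A" "total_rep B" "total_rep S" "total_rep Y"
  shows "perp0 S Y \<longleftrightarrow> perp0 A Y \<and> perp0 B Y"
proof
  assume "perp0 S Y"
  then show "perp0 A Y \<and> perp0 B Y"
    using b perp0_retract[of A S iA pA Y] perp0_retract[of B S iB pB Y] tot
    by (auto simp: biproduct_def)
next
  assume h: "perp0 A Y \<and> perp0 B Y"
  have th: "total_hom A S iA" "total_hom S A pA" "total_hom B S iB" "total_hom S B pB"
    and one: "\<And>v. iA v * pA v + iB v * pB v = 1\<^sub>m (vdim S v)"
    using b by (auto simp: biproduct_def)
  note d = total_hom_dims[OF th(1)] total_hom_dims[OF th(2)] total_hom_dims[OF th(3)] total_hom_dims[OF th(4)]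
    total_rep_dims[OF tot(1)] total_rep_dims[OF tot(2)] total_rep_dims[OF tot(3)] total_rep_dims[OF tot(4)]
  have "Hom0 S Y" unfolding Hom0_def
  proof (intro allI impI)
    fix f v assume f: "total_hom S Y f"
    have "f v * iA v = 0\<^sub>m (vdim Y v) (vdim A v)" "f v * iB v = 0\<^sub>m (vdim Y v) (vdim B v)"
      using h total_hom_comp[OF th(1) f] total_hom_comp[OF th(3) f] tot
      by (auto simp: perp0_def Hom0_def)
    then have "f v * iA v * pA v + f v * iB v * pB v = 0\<^sub>m (vdim Y v) (vdim S v)" using d by simp
    then have "f v * (iA v * pA v + iB v * pB v) = 0\<^sub>m (vdim Y v) (vdim S v)"
      using d total_hom_dims[OF f] by (simp add: mat_algebra)
    then show "f v = 0\<^sub>m (vdim Y v) (vdim S v)"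
      using total_hom_dims[OF f] one by simp
  qed
  moreover have "Ext0 S Y" unfolding Ext0_def
  proof (intro allI impI)
    fix c :: "nat \<Rightarrow> 'a mat" assume c: "\<forall>v. c v \<in> carrier_mat (vdim Y (Suc v)) (vdim S v)"
    have cd: "dim_row (c v) = vdim Y (Suc v)" "dim_col (c v) = vdim S v" for v using c by auto
    note d = d cd
    have "\<forall>v. c v * iA v \<in> carrier_mat (vdim Y (Suc v)) (vdim A v)"
      "\<forall>v. c v * iB v \<in> carrier_mat (vdim Y (Suc v)) (vdim B v)" using d by (auto intro!: carrier_matI)
    then obtain f g where f: "\<And>v. f v \<in> carrier_mat (vdim Y v) (vdim A v)"
      "\<And>v. f (Suc v) * arr A v = arr Y v * f v + c v * iA v"
      and g: "\<And>v. g v \<in> carrier_mat (vdim Y v) (vdim B v)"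
      "\<And>v. g (Suc v) * arr B v = arr Y v * g v + c v * iB v"
      using h[unfolded Ext0_def perp0_def, THEN conjunct1, THEN conjunct2, rule_format, of "\<lambda>v. c v * iA v"]
        h[unfolded Ext0_def perp0_def, THEN conjunct2, THEN conjunct2, rule_format, of "\<lambda>v. c v * iB v"]
      by blast
    note d = d carrier_matD[OF f(1)] carrier_matD[OF g(1)]
    let ?f = "\<lambda>v. f v * pA v + g v * pB v"
    have "?f (Suc v) * arr S v = arr Y v * ?f v + c v" for v
    proof -
      have "?f (Suc v) * arr S v = f (Suc v) * arr A v * pA v + g (Suc v) * arr B v * pB v"
        using d by (simp add: mat_algebra total_hom_commute[OF th(2)] total_hom_commute[OF th(4)])
      also have "\<dots> = (arr Y v * (f v * pA v) + c v * (iA v * pA v)) + (arr Y v * (g v * pB v) + c v * (iB v * pB v))"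
        unfolding f(2) g(2) using d by (simp add: mat_algebra)
      also have "\<dots> = arr Y v * ?f v + (c v * (iA v * pA v) + c v * (iB v * pB v))"
        using d by (intro eq_matI) (auto simp: mat_algebra simp del: index_mult_mat(1))
      also have "c v * (iA v * pA v) + c v * (iB v * pB v) = c v * (iA v * pA v + iB v * pB v)"
        using d by (simp add: mat_algebra)
      also have "\<dots> = c v" unfolding one using d by simp
      finally show ?thesis .
    qed
    moreover have "?f v \<in> carrier_mat (vdim Y v) (vdim S v)" for v using d by (intro carrier_matI) auto
    ultimately show "\<exists>f. (\<forall>v. f v \<in> carrier_mat (vdim Y v) (vdim S v)) \<and>
        (\<forall>v. f (Suc v) * arr S v = arr Y v * f v + c v)" by (intro exI[of _ ?f]) simp
  qed
  ultimately show "perp0 S Y" by (simp add: perp0_def)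
qed

lemma is_rep_rep_sum: "is_rep n A \<Longrightarrow> is_rep n B \<Longrightarrow> is_rep n (rep_sum A B)"
  by (auto simp: is_rep_def rep_sum_def)

lemma nat_rep_rep_sum: "nat_rep n A \<Longrightarrow> nat_rep n B \<Longrightarrow> nat_rep n (rep_sum A B)"
  by (auto simp: nat_rep_def total_rep_rep_sum) (auto simp: rep_sum_def)

lemma extend_rep_sum:
  assumes "is_rep n A" "is_rep n B"
  shows "extend n (rep_sum A B) = rep_sum (extend n A) (extend n B)"
  using assms
  by (intro nat_rep_eqI[of n] nat_rep_extend is_rep_rep_sum nat_rep_rep_sum)
    (auto simp: rep_sum_def vdim_extend arr_extend)

lemma is_rep_rep_sum_list: "(\<And>M. M \<in> set Ms \<Longrightarrow> is_rep n M) \<Longrightarrow> is_rep n (rep_sum_list Ms)"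
  by (induction Ms) (auto simp: rep_sum_list_def is_rep_rep_sum, simp add: is_rep_def zero_rep_def)

lemma perp0_zero: "(\<And>v. vdim M v = 0) \<Longrightarrow> total_rep M \<Longrightarrow> total_rep Y \<Longrightarrow> perp0 M Y"
proof -
  assume d: "\<And>v. vdim M v = 0" and t: "total_rep M" "total_rep Y"
  have "Hom0 M Y" unfolding Hom0_def
  proof (intro allI impI)
    fix f v assume "total_hom M Y f"
    from total_hom_dims[OF this, of v] show "f v = 0\<^sub>m (vdim Y v) (vdim M v)"
      by (intro mat_eq_if_no_entries) (auto simp: d)
  qed
  moreover have "Ext0 M Y" unfolding Ext0_def
  proof (intro allI impI)
    fix c :: "nat \<Rightarrow> 'a mat" assume c: "\<forall>v. c v \<in> carrier_mat (vdim Y (Suc v)) (vdim M v)"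
    have "0\<^sub>m (vdim Y (Suc v)) 0 * arr M v = arr Y v * 0\<^sub>m (vdim Y v) 0 + c v" for v
      using total_rep_dims[OF t(1), of v] total_rep_dims[OF t(2), of v] carrier_matD[OF c[rule_format, of v]]
      by (intro mat_eq_if_no_entries) (auto simp: d)
    then show "\<exists>f. (\<forall>v. f v \<in> carrier_mat (vdim Y v) (vdim M v)) \<and>
        (\<forall>v. f (Suc v) * arr M v = arr Y v * f v + c v)"
      by (intro exI[of _ "\<lambda>v. 0\<^sub>m (vdim Y v) 0"]) (simp add: d)
  qed
  ultimately show ?thesis by (simp add: perp0_def)
qed

lemma perp0_rep_sum_list:
  assumes "\<And>M. M \<in> set Ms \<Longrightarrow> is_rep n M" and "total_rep Y"
  shows "perp0 (extend n (rep_sum_list Ms)) Y \<longleftrightarrow> (\<forall>M\<in>set Ms. perp0 (extend n M) Y)"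
  using assms(1)
proof (induction Ms)
  case Nil
  have "perp0 (extend n zero_rep) Y"
    by (rule perp0_zero) (auto simp: vdim_extend zero_rep_def is_rep_def assms(2)
        intro!: nat_rep_total nat_rep_extend)
  then show ?case by (simp add: rep_sum_list_def)
next
  case (Cons M Ms)
  have r: "is_rep n M" "is_rep n (rep_sum_list Ms)" using Cons.prems by (auto intro: is_rep_rep_sum_list)
  then have t: "total_rep (extend n M)" "total_rep (extend n (rep_sum_list Ms))"
    by (auto intro: nat_rep_total nat_rep_extend)
  have "extend n (rep_sum_list (M # Ms)) = rep_sum (extend n M) (extend n (rep_sum_list Ms))"
    using extend_rep_sum[OF r] by (simp add: rep_sum_list_def)
  then show ?case
    using perp0_biproduct[OF biproduct_rep_sum[OF t] t total_rep_rep_sum[OF t] assms(2)] Cons by simp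
qed

section \<open>Path maps and bijective matrices\<close>

fun path :: "'k::field rep \<Rightarrow> nat \<Rightarrow> nat \<Rightarrow> 'k mat" where
  "path M u 0 = 1\<^sub>m (vdim M u)"
| "path M u (Suc k) = arr M (u + k) * path M u k"

lemma path_dims:
  assumes "total_rep M"
  shows "dim_row (path M u k) = vdim M (u + k)" "dim_col (path M u k) = vdim M u"
  using total_rep_dims[OF assms] by (induction k) auto

lemma path_hom:
  assumes f: "total_hom M N f" and M: "total_rep M" and N: "total_rep N"
  shows "f (u + k) * path M u k = path N u k * f u"
proof (induction k)
  case (Suc k)
  note d = path_dims[OF M] path_dims[OF N] total_hom_dims[OF f] total_rep_dims[OF M] total_rep_dims[OF N]
  have "f (u + Suc k) * path M u (Suc k) = arr N (u + k) * (f (u + k) * path M u k)"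
    using d mult_eq_mult_right[OF total_hom_commute[OF f, of "u + k"], of "path M u k"] by simp
  also have "\<dots> = path N u (Suc k) * f u" unfolding Suc.IH using d by (simp add: mult_assoc_dim)
  finally show ?case .
qed (use total_hom_dims[OF f] in simp)

lemma path_add:
  assumes M: "total_rep M"
  shows "path M u (k + l) = path M (u + k) l * path M u k"
proof (induction l)
  case (Suc l)
  then show ?case using path_dims[OF M] total_rep_dims[OF M] by (simp add: mult_assoc_dim add.assoc)
qed (use path_dims[OF M] in simp)

definition bij_mat :: "'k::field mat \<Rightarrow> bool" where
  "bij_mat A \<longleftrightarrow> (\<exists>B\<in>carrier_mat (dim_col A) (dim_row A).
     A * B = 1\<^sub>m (dim_row A) \<and> B * A = 1\<^sub>m (dim_col A))"

text \<open>One-column matrices stand for elements, because the component at \<open>a\<close> of a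
  morphism from the interval module \<open>[a, b]\<close> is such a matrix. Kernel and cokernel
  conditions in this form match \<open>Hom0_interval\<close> and
  \<open>Ext0_interval\<close>.\<close>

lemma bij_mat_iff:
  fixes A :: "'k::field mat"
  assumes A: "A \<in> carrier_mat m k"
  shows "bij_mat A \<longleftrightarrow> (\<forall>y\<in>carrier_mat k 1. A * y = 0\<^sub>m m 1 \<longrightarrow> y = 0\<^sub>m k 1) \<and>
    (\<forall>z\<in>carrier_mat m 1. \<exists>y\<in>carrier_mat k 1. A * y = z)" (is "_ \<longleftrightarrow> ?inj \<and> ?surj")
proof
  note dA = carrier_matD[OF A]
  assume "bij_mat A"
  then obtain B where B: "B \<in> carrier_mat k m" "A * B = 1\<^sub>m m" "B * A = 1\<^sub>m k"
    using A by (auto simp: bij_mat_def)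
  note d = dA carrier_matD[OF B(1)]
  show "?inj \<and> ?surj"
  proof (intro conjI ballI impI)
    fix y :: "'k mat" assume y: "y \<in> carrier_mat k 1" "A * y = 0\<^sub>m m 1"
    have "y = B * (A * y)" using d y(1) B(3) by (simp add: mult_eq_one_right)
    then show "y = 0\<^sub>m k 1" unfolding y(2) using d by (simp add: right_mult_zero_dim)
  next
    fix z :: "'k mat" assume z: "z \<in> carrier_mat m 1"
    show "\<exists>y\<in>carrier_mat k 1. A * y = z"
      using z B(1,2) d by (intro bexI[of _ "B * z"]) (auto simp: mult_eq_one_right)
  qed
next
  note dA = carrier_matD[OF A]
  assume h: "?inj \<and> ?surj"
  have cols: "col (A * X) j = A *\<^sub>v col X j" if "X \<in> carrier_mat k l" "j < l" for X j l
    using col_mult2[OF A that] .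
  have one_col: "y = mat_of_cols l [col y 0]" if "y \<in> carrier_mat l 1" for y :: "'k mat" and l
    using that by (intro eq_matI) (auto simp: mat_of_cols_def)
  have "1\<^sub>m m *\<^sub>v z \<in> (*\<^sub>v) A ` carrier_vec k" if z: "z \<in> carrier_vec m" for z
  proof -
    have "mat_of_cols m [z] \<in> carrier_mat m 1" using mat_of_cols_carrier(1)[of m "[z]"] by simp
    with h obtain y where y: "y \<in> carrier_mat k 1" "A * y = mat_of_cols m [z]" by blast
    have "A *\<^sub>v col y 0 = z" using cols[OF y(1), of 0] y(2) z by simp
    then show ?thesis using y(1) z by (auto intro!: image_eqI[of _ _ "col y 0"])
  qed
  from matrix_factor_if_image_subset[OF one_carrier_mat A this]
  obtain B where B: "B \<in> carrier_mat k m" "A * B = 1\<^sub>m m" by metis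
  have "inj_on ((*\<^sub>v) A) (carrier_vec k)"
  proof (rule inj_onI)
    fix x y assume xy: "x \<in> carrier_vec k" "y \<in> carrier_vec k" "A *\<^sub>v x = A *\<^sub>v y"
    let ?y = "mat_of_cols k [x - y]"
    have y1: "?y \<in> carrier_mat k 1" using mat_of_cols_carrier(1)[of k "[x - y]"] by simp
    have cy: "col ?y 0 = x - y" using xy by simp
    have "A *\<^sub>v (x - y) = 0\<^sub>v m" using xy mult_minus_distrib_mat_vec[OF A xy(1,2)] A by auto
    then have "A * ?y = 0\<^sub>m m 1" using cols[OF y1, of 0] cy A
      by (intro mat_col_eqI) auto
    then have "?y = 0\<^sub>m k 1" using h y1 by blast
    then have "x - y = 0\<^sub>v k" using cy by simp
    then have "(x - y) $ i = 0" if "i < k" for i using that by simp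
    then show "x = y" using xy(1,2) by (intro eq_vecI) auto
  qed
  from left_cancel_if_inj_on[OF this A, of "B * A" k "1\<^sub>m k"]
  have "B * A = 1\<^sub>m k" using B dA mult_eq_one_right[OF B(2), of A] by auto
  then show "bij_mat A" using B dA by (auto simp: bij_mat_def)
qed

text \<open>An identity matrix of size one cannot factor through the zero space. Dimensions up to
  one suffice for interval modules.\<close>

lemma bij_mat_dims:
  assumes "bij_mat A" "dim_row A \<le> 1" "dim_col A \<le> 1"
  shows "dim_row A = dim_col A"
proof (rule ccontr)
  obtain B where B: "B \<in> carrier_mat (dim_col A) (dim_row A)" "A * B = 1\<^sub>m (dim_row A)"
    "B * A = 1\<^sub>m (dim_col A)" using assms(1) by (auto simp: bij_mat_def)
  assume "dim_row A \<noteq> dim_col A"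
  then have "dim_row A = 1 \<and> dim_col A = 0 \<or> dim_row A = 0 \<and> dim_col A = 1" using assms by auto
  then show False
  proof
    assume h: "dim_row A = 1 \<and> dim_col A = 0"
    then have "(A * B) $$ (0,0) = 0" using B(1) by (auto simp: scalar_prod_def)
    then show False using B(2) h by simp
  next
    assume h: "dim_row A = 0 \<and> dim_col A = 1"
    then have "(B * A) $$ (0,0) = 0" using B(1) by (auto simp: scalar_prod_def)
    then show False using B(3) h by simp
  qed
qed

lemma bij_mat_one: "bij_mat (1\<^sub>m k)"
  by (auto simp: bij_mat_def)

lemma bij_mat_empty: "dim_row A = 0 \<Longrightarrow> dim_col A = 0 \<Longrightarrow> bij_mat A"
  by (auto simp: bij_mat_def intro!: bexI[of _ "0\<^sub>m 0 0"] mat_eq_if_no_entries)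

section \<open>Interval modules\<close>

definition interval :: "nat \<Rightarrow> nat \<Rightarrow> 'k::field rep" where
  "interval a b = (let d = \<lambda>v. if a \<le> v \<and> v \<le> b then 1 else 0 in
     Rep d (\<lambda>v. if a \<le> v \<and> v < b then 1\<^sub>m 1 else 0\<^sub>m (d (Suc v)) (d v)))"

lemma vdim_interval: "vdim (interval a b) v = (if a \<le> v \<and> v \<le> b then 1 else 0)"
  by (simp add: interval_def Let_def)

lemma arr_interval: "a \<le> v \<Longrightarrow> v < b \<Longrightarrow> arr (interval a b) v = 1\<^sub>m 1"
  by (simp add: interval_def Let_def)

lemma total_rep_interval: "total_rep (interval a b)"
  by (auto simp: total_rep_def interval_def Let_def)

lemma nat_rep_interval: "1 \<le> a \<Longrightarrow> b \<le> n \<Longrightarrow> nat_rep n (interval a b)"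
  by (auto simp: nat_rep_def total_rep_interval vdim_interval)

lemma path_interval: "a \<le> u \<Longrightarrow> u + k \<le> b \<Longrightarrow> path (interval a b) u k = 1\<^sub>m 1"
  by (induction k) (auto simp: vdim_interval arr_interval)

text \<open>Conditions arise only at the arrows inside \<open>[a, b]\<close> and at the exit from
  \<open>b\<close> to \<open>b + 1\<close>, where the interval module has become zero; at all other
  arrows the source is zero.\<close>

lemma hom_intervalI:
  fixes Y :: "'a::field rep"
  assumes Y: "total_rep Y" and f: "\<And>v. f v \<in> carrier_mat (vdim Y v) (vdim (interval a b :: 'a rep) v)"
    and step: "\<And>v. a \<le> v \<Longrightarrow> v < b \<Longrightarrow> f (Suc v) = arr Y v * f v"
    and last: "a \<le> b \<Longrightarrow> arr Y b * f b = 0\<^sub>m (vdim Y (Suc b)) 1"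
  shows "total_hom (interval a b) Y f"
  unfolding total_hom_def
proof (intro conjI allI f)
  fix v
  let ?I = "interval a b :: 'a rep"
  note d = carrier_matD[OF f] total_rep_dims[OF Y] total_rep_dims[OF total_rep_interval[where 'a = 'a and a = a and b = b]]
  consider "a \<le> v" "v < b" | "v = b" "a \<le> b" | "v < a \<or> b < v" by linarith
  then show "f (Suc v) * arr ?I v = arr Y v * f v"
  proof cases
    case 1
    then show ?thesis using d step by (simp add: arr_interval vdim_interval)
  next
    case 2
    have "arr ?I b = 0\<^sub>m 0 1" using 2 by (simp add: interval_def)
    then show ?thesis using 2 last d by (simp add: vdim_interval right_mult_zero_dim)
  next
    case 3
    then have "vdim ?I v = 0" by (auto simp: vdim_interval)
    then show ?thesis using d by (intro mat_eq_if_no_entries) auto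
  qed
qed

section \<open>Morphisms and extensions out of an interval module\<close>

lemma hom_interval_determined:
  fixes Y :: "'k::field rep"
  assumes Y: "total_rep Y" and f: "total_hom (interval a b) Y f" and g: "total_hom (interval a b) Y g"
    and eq: "f a = g a"
  shows "f v = g v"
proof (cases "a \<le> v \<and> v \<le> b")
  case True
  note t = total_rep_interval
  have "f v * path (interval a b) a (v - a) = g v * path (interval a b) a (v - a)"
    using path_hom[OF f t Y, of a "v - a"] path_hom[OF g t Y, of a "v - a"] eq True by simp
  then show ?thesis using True total_hom_dims[OF f, of v] total_hom_dims[OF g, of v]
    by (simp add: path_interval vdim_interval)
next
  case False
  then show ?thesis using total_hom_dims[OF f, of v] total_hom_dims[OF g, of v]
    by (intro mat_eq_if_no_entries) (auto simp: vdim_interval)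
qed

lemma hom_interval_killed:
  fixes Y :: "'k::field rep"
  assumes Y: "total_rep Y" and f: "total_hom (interval a b) Y f" and ab: "a \<le> b"
  shows "path Y a (Suc b - a) * f a = 0\<^sub>m (vdim Y (Suc b)) 1"
proof -
  let ?I = "interval a b :: 'k rep"
  have "f (Suc b) * path ?I a (Suc b - a) = 0\<^sub>m (vdim Y (Suc b)) 1"
    using total_hom_dims[OF f, of "Suc b"] ab path_dims[OF total_rep_interval[where 'a = 'k and a = a and b = b], of a "Suc b - a"]
    by (intro eq_matI) (auto simp: vdim_interval scalar_prod_def)
  then show ?thesis using path_hom[OF f total_rep_interval Y, of a "Suc b - a"] ab by simp
qed

text \<open>Pushing \<open>y\<close> along the arrows defines the components. With the two preceding
  lemmas, evaluation at \<open>a\<close> identifies the morphisms with the kernel of the path map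
  from \<open>a\<close> to \<open>b + 1\<close>, a path of length \<open>Suc b - a\<close>.\<close>

lemma hom_interval_exists:
  fixes Y :: "'k::field rep"
  assumes Y: "total_rep Y" and y: "y \<in> carrier_mat (vdim Y a) 1" and ab: "a \<le> b"
    and py: "path Y a (Suc b - a) * y = 0\<^sub>m (vdim Y (Suc b)) 1"
  shows "\<exists>f. total_hom (interval a b) Y f \<and> f a = y"
proof -
  note d = path_dims[OF Y] total_rep_dims[OF Y]
  let ?f = "\<lambda>v. if a \<le> v \<and> v \<le> b then path Y a (v - a) * y else 0\<^sub>m (vdim Y v) 0"
  have "total_hom (interval a b) Y ?f"
  proof (rule hom_intervalI[OF Y])
    fix v
    show "?f v \<in> carrier_mat (vdim Y v) (vdim (interval a b :: 'k rep) v)"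
      using y d by (auto simp: vdim_interval intro!: carrier_matI)
    assume "a \<le> v" "v < b"
    then show "?f (Suc v) = arr Y v * ?f v" using y d by (simp add: Suc_diff_le mult_assoc_dim)
  next
    show "arr Y b * ?f b = 0\<^sub>m (vdim Y (Suc b)) 1"
      using ab y py d by (simp add: Suc_diff_le mult_assoc_dim)
  qed
  moreover have "?f a = y" using y ab by simp
  ultimately show ?thesis by blast
qed

lemma Hom0_interval:
  fixes Y :: "'k::field rep"
  assumes ab: "a \<le> b" and Y: "total_rep Y"
  shows "Hom0 (interval a b) Y \<longleftrightarrow>
    (\<forall>y\<in>carrier_mat (vdim Y a) 1. path Y a (Suc b - a) * y = 0\<^sub>m (vdim Y (Suc b)) 1 \<longrightarrow> y = 0\<^sub>m (vdim Y a) 1)"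
    (is "_ \<longleftrightarrow> ?inj")
proof
  let ?I = "interval a b :: 'k rep"
  {
    assume h: "Hom0 ?I Y"
    show ?inj
    proof (intro ballI impI)
      fix y :: "'k mat" assume y: "y \<in> carrier_mat (vdim Y a) 1"
        "path Y a (Suc b - a) * y = 0\<^sub>m (vdim Y (Suc b)) 1"
      from hom_interval_exists[OF Y y(1) ab y(2)]
      obtain f where f: "total_hom ?I Y f" "f a = y" by blast
      have "f a = 0\<^sub>m (vdim Y a) (vdim ?I a)" using h f(1) unfolding Hom0_def by blast
      then show "y = 0\<^sub>m (vdim Y a) 1" using ab f(2) by (simp add: vdim_interval)
    qed
  next
    assume h: ?inj
    show "Hom0 ?I Y" unfolding Hom0_def
    proof (intro allI impI)
      fix f v assume f: "total_hom ?I Y f"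
      have I1: "vdim ?I a = 1" using ab by (simp add: vdim_interval)
      have "f a \<in> carrier_mat (vdim Y a) 1" using total_hom_dims[OF f, of a] I1 by (intro carrier_matI) auto
      with h hom_interval_killed[OF Y f ab] have fa: "f a = 0\<^sub>m (vdim Y a) (vdim ?I a)"
        unfolding I1 by blast
      have zero: "total_hom ?I Y (\<lambda>v. 0\<^sub>m (vdim Y v) (vdim ?I v))"
        using total_rep_dims[OF Y] total_rep_dims[OF total_rep_interval[where 'a = 'k and a = a and b = b]]
        by (simp add: total_hom_def right_mult_zero_dim)
      show "f v = 0\<^sub>m (vdim Y v) (vdim ?I v)"
        by (rule hom_interval_determined[OF Y f zero fa])
    qed
  }
qed

text \<open>The coboundary equation can be solved step by step from any start value at
  \<open>a\<close>. The only obstruction sits at \<open>b + 1\<close>, where the solution has to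
  vanish, so Ext is the cokernel of the path map from \<open>a\<close> to
  \<open>b + 1\<close>.\<close>

lemma Ext0_interval:
  assumes ab: "a \<le> b" and Y: "total_rep Y"
  shows "Ext0 (interval a b) Y \<longleftrightarrow>
    (\<forall>z\<in>carrier_mat (vdim Y (Suc b)) 1. \<exists>y\<in>carrier_mat (vdim Y a) 1. path Y a (Suc b - a) * y = z)"
    (is "_ \<longleftrightarrow> ?surj")
proof
  let ?I = "interval a b :: 'a rep"
  note d = path_dims[OF Y] total_rep_dims[OF Y] total_rep_dims[OF total_rep_interval[where 'a = 'a and a = a and b = b]]
  have Ib: "arr ?I b = 0\<^sub>m 0 1" using ab by (simp add: interval_def)
  {
    assume h: "Ext0 ?I Y"
    show ?surj
    proof
      fix z :: "'a mat" assume z: "z \<in> carrier_mat (vdim Y (Suc b)) 1"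
      \<comment> \<open>A cocycle concentrated at the exit arrow. The left side of the equation
        vanishes there, and the sign turns it into \<open>arr Y b * f b = z\<close>.\<close>
      define c where "c v = (if v = b then - z else 0\<^sub>m (vdim Y (Suc v)) (vdim ?I v))" for v
      have "\<forall>v. c v \<in> carrier_mat (vdim Y (Suc v)) (vdim ?I v)"
        using z ab by (auto simp: c_def vdim_interval)
      from h[unfolded Ext0_def, rule_format, of c, OF this[rule_format]]
      obtain f where f: "\<And>v. f v \<in> carrier_mat (vdim Y v) (vdim ?I v)"
        "\<And>v. f (Suc v) * arr ?I v = arr Y v * f v + c v" by blast
      note df = carrier_matD[OF f(1)]
      have fk: "f (a + k) = path Y a k * f a" if "a + k \<le> b" for k
        using that
      proof (induction k)
        case (Suc k)
        have "f (Suc (a + k)) = arr Y (a + k) * f (a + k)"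
          using f(2)[of "a + k"] Suc.prems df d
          by (simp add: arr_interval vdim_interval c_def add_zero_dim)
        then show ?case using Suc df d by (simp add: mult_assoc_dim)
      qed (use df in simp)
      have "arr Y b * f b + (- z) = 0\<^sub>m (vdim Y (Suc b)) 1"
        using f(2)[of b] Ib df d by (simp add: c_def vdim_interval right_mult_zero_dim)
      then have "arr Y b * f b = z"
        using z df[of b] d(3)[of b] ab add_eq_imp_eq_minus_mat[of "arr Y b * f b" "- z"]
        by (auto simp: vdim_interval intro!: eq_matI simp del: index_mult_mat(1))
      moreover have "f b = path Y a (b - a) * f a" using fk[of "b - a"] ab by simp
      ultimately have "path Y a (Suc b - a) * f a = z"
        using d df ab by (simp add: Suc_diff_le mult_assoc_dim)
      moreover have "f a \<in> carrier_mat (vdim Y a) 1" using f(1)[of a] ab by (simp add: vdim_interval)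
      ultimately show "\<exists>y\<in>carrier_mat (vdim Y a) 1. path Y a (Suc b - a) * y = z" by blast
    qed
  next
    assume h: ?surj
    show "Ext0 ?I Y" unfolding Ext0_def
    proof (intro allI impI)
      fix c :: "nat \<Rightarrow> 'a mat" assume c: "\<forall>v. c v \<in> carrier_mat (vdim Y (Suc v)) (vdim ?I v)"
      have dc: "dim_row (c v) = vdim Y (Suc v)" "dim_col (c v) = vdim ?I v" for v
        using c[rule_format, of v] by auto
      \<comment> \<open>The particular solution with start value zero. A start value
        \<open>y\<close> adds \<open>path * y\<close>, and \<open>y\<close> is chosen below so that
        the sum vanishes at \<open>b + 1\<close>.\<close>
      define \<psi> where "\<psi> = rec_nat (0\<^sub>m (vdim Y a) 1) (\<lambda>k x. arr Y (a + k) * x + c (a + k))"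
      have \<psi>_simps: "\<psi> 0 = 0\<^sub>m (vdim Y a) 1" "\<psi> (Suc k) = arr Y (a + k) * \<psi> k + c (a + k)" for k
        by (simp_all add: \<psi>_def)
      have d\<psi>: "dim_row (\<psi> k) = vdim Y (a + k) \<and> dim_col (\<psi> k) = 1" if "a + k \<le> Suc b" for k
        using that
      proof (induction k)
        case (Suc k)
        then show ?case using dc by (simp add: \<psi>_simps vdim_interval)
      qed (simp add: \<psi>_simps)
      have pos: "a + (Suc b - a) = Suc b" using ab by simp
      have "- \<psi> (Suc b - a) \<in> carrier_mat (vdim Y (Suc b)) 1"
        using d\<psi>[of "Suc b - a"] pos by (auto intro!: carrier_matI)
      then obtain y where y: "y \<in> carrier_mat (vdim Y a) 1" "path Y a (Suc b - a) * y = - \<psi> (Suc b - a)"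
        using h by blast
      define f where "f v = (if a \<le> v \<and> v \<le> b then path Y a (v - a) * y + \<psi> (v - a) else 0\<^sub>m (vdim Y v) 0)" for v
      have df: "dim_row (f v) = vdim Y v" "dim_col (f v) = vdim ?I v" for v
        using d\<psi>[of "v - a"] d y by (auto simp: f_def vdim_interval)
      have "f (Suc v) * arr ?I v = arr Y v * f v + c v" for v
      proof -
        consider "a \<le> v" "v \<le> b" | "v < a \<or> b < v" by linarith
        then show ?thesis
        proof cases
          case 1
          have "arr Y v * f v + c v = arr Y v * (path Y a (v - a) * y) + (arr Y v * \<psi> (v - a) + c v)"
            using 1 y d d\<psi>[of "v - a"] dc
            by (intro eq_matI) (auto simp: f_def mat_algebra vdim_interval simp del: index_mult_mat(1))
          also have "\<dots> = path Y a (Suc v - a) * y + \<psi> (Suc v - a)"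
            using 1 y d d\<psi>[of "v - a"] by (simp add: Suc_diff_le \<psi>_simps mult_assoc_dim)
          finally have e: "arr Y v * f v + c v = path Y a (Suc v - a) * y + \<psi> (Suc v - a)" .
          show ?thesis
          proof (cases "v = b")
            case True
            have "path Y a (Suc b - a) * y + \<psi> (Suc b - a) = 0\<^sub>m (vdim Y (Suc b)) 1"
              unfolding y(2) using d\<psi>[of "Suc b - a"] pos by (intro eq_matI) auto
            then show ?thesis using True e Ib df[of "Suc b"] by (simp add: vdim_interval right_mult_zero_dim)
          next
            case False
            then show ?thesis using e 1 df[of "Suc v"]
              by (simp add: arr_interval vdim_interval, simp add: f_def)
          qed
        next
          case 2
          then have "vdim ?I v = 0" by (auto simp: vdim_interval)
          then show ?thesis using d dc df by (intro mat_eq_if_no_entries) auto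
        qed
      qed
      then show "\<exists>f. (\<forall>v. f v \<in> carrier_mat (vdim Y v) (vdim ?I v)) \<and>
          (\<forall>v. f (Suc v) * arr ?I v = arr Y v * f v + c v)"
        using df by (intro exI[of _ f]) auto
    qed
  }
qed

lemma perp0_interval:
  assumes ab: "a \<le> b" and Y: "total_rep Y"
  shows "perp0 (interval a b) Y \<longleftrightarrow> bij_mat (path Y a (Suc b - a))"
proof -
  have "path Y a (Suc b - a) \<in> carrier_mat (vdim Y (Suc b)) (vdim Y a)"
    using path_dims[OF Y, of a "Suc b - a"] ab by (intro carrier_matI) auto
  from bij_mat_iff[OF this] show ?thesis
    unfolding perp0_def Hom0_interval[OF assms] Ext0_interval[OF assms] by blast
qed

definition iso_via where
  "iso_via A B f g \<longleftrightarrow> total_hom A B f \<and> total_hom B A g \<and>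
     (\<forall>v. g v * f v = 1\<^sub>m (vdim A v) \<and> f v * g v = 1\<^sub>m (vdim B v))"

lemma iso_via_sym: "iso_via A B f g \<Longrightarrow> iso_via B A g f"
  by (auto simp: iso_via_def)

lemma perp0_iso_via:
  assumes "iso_via A B f g" "total_rep A" "total_rep B" "total_rep Y"
  shows "perp0 A Y \<longleftrightarrow> perp0 B Y"
proof -
  have h: "total_hom A B f" "total_hom B A g" "\<And>v. g v * f v = 1\<^sub>m (vdim A v)"
    "\<And>v. f v * g v = 1\<^sub>m (vdim B v)"
    using assms(1) by (auto simp: iso_via_def)
  show ?thesis
    using perp0_retract[OF h(1,2,3) assms(2,3,4)] perp0_retract[OF h(2,1,4) assms(3,2,4)] by blast
qed

lemma nat_rep_support: "nat_rep n M \<Longrightarrow> vdim M v \<noteq> 0 \<Longrightarrow> 1 \<le> v \<and> v \<le> n"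
  by (rule ccontr) (simp add: nat_rep_def)

section \<open>Classification of the indecomposables\<close>

text \<open>
  Let \<open>a\<close> be the first vertex of the support. A nonzero \<open>x\<close> at \<open>a\<close> generates a copy of an
  interval module \<open>[a, b]\<close>, and a functional at \<open>b\<close> that does not kill the image of \<open>x\<close> pulls
  back to a retraction, so that \<open>[a, b]\<close> is a direct summand.
\<close>

lemma interval_summand:
  fixes M :: "'k::field rep"
  assumes M: "nat_rep n M" and nz: "\<exists>v. vdim M v \<noteq> 0"
  shows "\<exists>a b i p. 1 \<le> a \<and> a \<le> b \<and> b \<le> n \<and> total_hom (interval a b) M i \<and>
    total_hom M (interval a b) p \<and> (\<forall>v. p v * i v = 1\<^sub>m (vdim (interval a b :: 'k rep) v))"
proof -
  have t: "total_rep M" using M by (rule nat_rep_total)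
  define a where "a = (LEAST v. vdim M v \<noteq> 0)"
  have a: "vdim M a \<noteq> 0" unfolding a_def using nz by (rule LeastI_ex)
  have before: "vdim M v = 0" if "v < a" for v using that not_less_Least[of v "\<lambda>v. vdim M v \<noteq> 0"] unfolding a_def by simp
  have an: "1 \<le> a" "a \<le> n" using nat_rep_support[OF M a] by auto
  define x :: "'k mat" where "x = mat (vdim M a) 1 (\<lambda>(i,j). if i = 0 then 1 else 0)"
  have dx: "dim_row x = vdim M a" "dim_col x = 1" by (simp_all add: x_def)
  have "x $$ (0,0) = 1" using a by (simp add: x_def)
  then have xnz: "path M a 0 * x \<noteq> 0\<^sub>m (vdim M a) 1" using a dx by auto
  note d = dx path_dims[OF t] total_rep_dims[OF t]
  define P where "P k \<longleftrightarrow> path M a k * x \<noteq> 0\<^sub>m (vdim M (a + k)) 1" for k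
  have Pn: "k \<le> n" if "P k" for k
  proof (rule ccontr)
    assume "\<not> k \<le> n"
    then have "vdim M (a + k) = 0" using M by (auto simp: nat_rep_def)
    then have "path M a k * x = 0\<^sub>m (vdim M (a + k)) 1" using d by (intro mat_eq_if_no_entries) auto
    then show False using that by (simp add: P_def)
  qed
  define K where "K = (GREATEST k. P k)"
  have PK: "P K" unfolding K_def by (rule GreatestI_nat[of P 0 n]) (use xnz Pn in \<open>auto simp: P_def\<close>)
  have nPK: "\<not> P (Suc K)" using Greatest_le_nat[of P "Suc K" n] Pn unfolding K_def by (metis Suc_n_not_le_n)
  define b where "b = a + K"
  have "vdim M b \<noteq> 0"
  proof
    assume "vdim M b = 0"
    then have "path M a K * x = 0\<^sub>m (vdim M (a + K)) 1" using d by (intro mat_eq_if_no_entries) (auto simp: b_def)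
    then show False using PK by (simp add: P_def)
  qed
  then have ab: "a \<le> b" "b \<le> n" using nat_rep_support[OF M] by (auto simp: b_def)
  have "\<exists>t<vdim M b. (path M a K * x) $$ (t,0) \<noteq> 0"
  proof (rule ccontr)
    assume "\<not> ?thesis"
    then have "(path M a K * x) $$ (t,0) = 0" if "t < vdim M (a + K)" for t
      using that by (simp add: b_def)
    then have "path M a K * x = 0\<^sub>m (vdim M (a + K)) 1"
      using d by (intro eq_matI) (auto simp del: index_mult_mat(1))
    then show False using PK by (simp add: P_def)
  qed
  then obtain t0 where t0: "t0 < vdim M b" "(path M a K * x) $$ (t0,0) \<noteq> 0" by blast
  define \<phi> :: "'k mat" where
    "\<phi> = mat 1 (vdim M b) (\<lambda>(i,j). if j = t0 then 1 / (path M a K * x) $$ (t0,0) else 0)"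
  have d\<phi>: "dim_row \<phi> = 1" "dim_col \<phi> = vdim M b" by (simp_all add: \<phi>_def)
  have \<phi>x: "\<phi> * (path M a K * x) = 1\<^sub>m 1"
  proof (rule eq_matI)
    fix i j assume ij: "i < dim_row (1\<^sub>m 1 :: 'k mat)" "j < dim_col (1\<^sub>m 1 :: 'k mat)"
    have "(\<phi> * (path M a K * x)) $$ (0,0) = (\<Sum>k = 0..<vdim M b. \<phi> $$ (0,k) * (path M a K * x) $$ (k,0))"
      using d d\<phi> by (simp add: scalar_prod_def b_def)
    also have "\<dots> = (\<Sum>k = 0..<vdim M b. if k = t0 then 1 else 0)"
      using t0 by (intro sum.cong) (auto simp: \<phi>_def simp del: index_mult_mat(1))
    also have "\<dots> = 1" using t0 by (simp add: sum.delta)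
    finally show "(\<phi> * (path M a K * x)) $$ (i,j) = 1\<^sub>m 1 $$ (i,j)" using ij by simp
  qed (use d d\<phi> in auto)
  let ?I = "interval a b :: 'k rep"
  have dI: "dim_row (arr ?I v) = vdim ?I (Suc v)" "dim_col (arr ?I v) = vdim ?I v" for v
    by (rule total_rep_dims[OF total_rep_interval])+
  define i where "i v = (if a \<le> v \<and> v \<le> b then path M a (v - a) * x else 0\<^sub>m (vdim M v) 0)" for v
  define p where "p v = (if a \<le> v \<and> v \<le> b then \<phi> * path M v (b - v) else 0\<^sub>m 0 (vdim M v))" for v
  have i: "total_hom ?I M i"
  proof (rule hom_intervalI[OF t])
    fix v
    show "i v \<in> carrier_mat (vdim M v) (vdim ?I v)"
      using d by (auto simp: i_def vdim_interval intro!: carrier_matI)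
    assume "a \<le> v" "v < b"
    then show "i (Suc v) = arr M v * i v" using d by (simp add: i_def Suc_diff_le mult_assoc_dim)
  next
    have "arr M b * i b = path M a (Suc K) * x" using d ab by (simp add: i_def b_def mult_assoc_dim)
    then show "arr M b * i b = 0\<^sub>m (vdim M (Suc b)) 1" using nPK by (simp add: P_def b_def)
  qed
  have dp: "dim_row (p v) = vdim ?I v" "dim_col (p v) = vdim M v" for v
    using d d\<phi> by (auto simp: p_def vdim_interval)
  have "total_hom M ?I p" unfolding total_hom_def
  proof (intro conjI allI)
    fix v
    show "p v \<in> carrier_mat (vdim ?I v) (vdim M v)" using dp by auto
    consider "a \<le> v" "v < b" | "b \<le> v" | "v < a" by linarith
    then show "p (Suc v) * arr M v = arr ?I v * p v"
    proof cases
      case 1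
      then have "b - v = 1 + (b - Suc v)" "v + 1 = Suc v" "v + (b - v) = b" by auto
      then have "path M v (b - v) = path M (Suc v) (b - Suc v) * arr M v"
        using path_add[OF t, of v 1 "b - Suc v"] d by simp
      then show ?thesis using 1 d d\<phi> dp[of v] by (simp add: arr_interval vdim_interval p_def mult_assoc_dim)
    next
      case 2
      then show ?thesis using dp[of v] dp[of "Suc v"] dI[of v] d
        by (intro mat_eq_if_no_entries) (auto simp: vdim_interval)
    next
      \<comment> \<open>Minimality of \<open>a\<close> enters here: \<open>M\<close> vanishes left
        of \<open>a\<close>, so no arrow of \<open>M\<close> can enter the interval from a nonzero
        space and spoil the retraction.\<close>
      case 3
      then show ?thesis using dp[of v] dp[of "Suc v"] dI[of v] d before
        by (intro mat_eq_if_no_entries) (auto simp: vdim_interval)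
    qed
  qed
  moreover have "p v * i v = 1\<^sub>m (vdim ?I v)" for v
  proof (cases "a \<le> v \<and> v \<le> b")
    case True
    then have e: "K = (v - a) + (b - v)" "a + (v - a) = v" "v + (b - v) = b" by (auto simp: b_def)
    have "path M a K = path M v (b - v) * path M a (v - a)"
      using path_add[OF t, of a "v - a" "b - v"] e by simp
    then show ?thesis using True \<phi>x d d\<phi> e by (simp add: p_def i_def vdim_interval mult_assoc_dim)
  next
    case False
    then show ?thesis using dp[of v] total_hom_dims[OF i, of v]
      by (intro mat_eq_if_no_entries) (auto simp: vdim_interval)
  qed
  ultimately show ?thesis using i ab an by blast
qed


lemma one_mat_through_zero:
  fixes P S :: "'k::field mat"
  assumes "P * S = 1\<^sub>m q" "P \<in> carrier_mat q 0" "S \<in> carrier_mat 0 q"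
  shows "q = 0"
proof (rule ccontr)
  assume "q \<noteq> 0"
  then have "(P * S) $$ (0,0) = 0" using assms(2,3) by (auto simp: scalar_prod_def)
  then show False using assms(1) \<open>q \<noteq> 0\<close> by simp
qed

text \<open>The complement is the cokernel \<open>P\<close> of \<open>i\<close>, taken vertex by
  vertex. Its section is adjusted to land in the kernel of \<open>p\<close>; this makes it commute
  with the arrows.\<close>

lemma summand_has_complement:
  fixes M I :: "'k::field rep"
  assumes M: "nat_rep n M" and I: "nat_rep n I" and i: "total_hom I M i" and p: "total_hom M I p"
    and pi: "\<And>v. p v * i v = 1\<^sub>m (vdim I v)"
  shows "\<exists>N j q. nat_rep n N \<and> biproduct I N M i p j q"
proof -
  have tM: "total_rep M" and tI: "total_rep I" using M I by (auto simp: nat_rep_def)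
  have "\<forall>v. \<exists>q P S B. P \<in> carrier_mat q (vdim M v) \<and> S \<in> carrier_mat (vdim M v) q \<and>
    B \<in> carrier_mat (vdim I v) (vdim M v) \<and> P * S = 1\<^sub>m q \<and> P * i v = 0\<^sub>m q (vdim I v) \<and>
    S * P + i v * B = 1\<^sub>m (vdim M v)"
    using matrix_cokernel i unfolding total_hom_def by blast
  then obtain q P S B where P: "\<And>v. P v \<in> carrier_mat (q v) (vdim M v)"
    and S: "\<And>v. S v \<in> carrier_mat (vdim M v) (q v)" and B: "\<And>v. B v \<in> carrier_mat (vdim I v) (vdim M v)"
    and PS: "\<And>v. P v * S v = 1\<^sub>m (q v)" and Pi: "\<And>v. P v * i v = 0\<^sub>m (q v) (vdim I v)"
    and SPiB: "\<And>v. S v * P v + i v * B v = 1\<^sub>m (vdim M v)"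
    by metis
  \<comment> \<open>The part of \<open>S\<close> inside the summand is removed, so that
    \<open>p v * j v = 0\<close> while \<open>P v * j v = 1\<close> remains true.\<close>
  define j where "j v = S v - i v * (p v * S v)" for v
  note d = carrier_matD[OF P] carrier_matD[OF S] carrier_matD[OF B] total_hom_dims[OF i] total_hom_dims[OF p]
    total_rep_dims[OF tM] total_rep_dims[OF tI]
  have dj: "dim_row (j v) = vdim M v" "dim_col (j v) = q v" for v using d by (auto simp: j_def)
  note d = d dj
  \<comment> \<open>The arrows of \<open>M\<close> read through the section \<open>j\<close> and the
    projection \<open>P\<close>, that is, the arrows induced on the cokernel.\<close>
  define N where "N = Rep q (\<lambda>v. P (Suc v) * (arr M v * j v))"
  have vN: "vdim N v = q v" for v by (simp add: N_def)
  have "q v = 0" if "v \<notin> {1..n}" for v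
    using one_mat_through_zero[OF PS[of v]] P[of v] S[of v] M that by (auto simp: nat_rep_def)
  then have "nat_rep n N" using d by (auto simp: nat_rep_def total_rep_def N_def intro!: carrier_matI)
  have Pj: "P v * j v = 1\<^sub>m (q v)" for v
    using d PS Pi by (auto simp: j_def mat_algebra mult_eq_zero_right intro!: eq_matI)
  have pj: "p v * j v = 0\<^sub>m (vdim I v) (q v)" for v
    using d pi by (auto simp: j_def mat_algebra mult_eq_one_right intro!: eq_matI)
  have ipjP: "i v * p v + j v * P v = 1\<^sub>m (vdim M v)" for v
  proof -
    have "S v * P v = 1\<^sub>m (vdim M v) - i v * B v"
      using SPiB[of v] d by (intro add_eq_imp_eq_minus_mat) auto
    then have "i v * (p v * (S v * P v)) = i v * p v - i v * B v"
      using d pi by (simp add: mat_algebra mult_eq_one_right)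
    then have "i v * p v + j v * P v = i v * p v + (S v * P v - (i v * p v - i v * B v))"
      using d by (simp add: j_def mat_algebra)
    also have "\<dots> = S v * P v + i v * B v" using d by (intro eq_matI) (auto simp del: index_mult_mat(1))
    finally show ?thesis using SPiB by simp
  qed
  have "total_hom M N P" unfolding total_hom_def
  proof (intro conjI allI)
    fix v
    show "P v \<in> carrier_mat (vdim N v) (vdim M v)" using P by (simp add: vN)
    have "P (Suc v) * arr M v = P (Suc v) * (arr M v * (i v * p v + j v * P v))" using d ipjP by simp
    also have "\<dots> = P (Suc v) * (arr M v * (i v * p v)) + arr N v * P v"
      using d by (simp add: mat_algebra N_def)
    also have "arr M v * (i v * p v) = i (Suc v) * (arr I v * p v)"
      using d by (intro mult_eq_mult_right total_hom_commute[OF i, symmetric]) auto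
    also have "P (Suc v) * (i (Suc v) * (arr I v * p v)) = 0\<^sub>m (q (Suc v)) (vdim M v)"
      using d mult_eq_zero_right[OF Pi[of "Suc v"], of "arr I v * p v"] by simp
    also have "0\<^sub>m (q (Suc v)) (vdim M v) + arr N v * P v = arr N v * P v"
      using d by (simp add: add_zero_dim N_def)
    finally show "P (Suc v) * arr M v = arr N v * P v" .
  qed
  moreover have "total_hom N M j" unfolding total_hom_def
  proof (intro conjI allI)
    fix v
    show "j v \<in> carrier_mat (vdim M v) (vdim N v)" using d by (auto simp: vN)
    have "arr M v * j v = (i (Suc v) * p (Suc v) + j (Suc v) * P (Suc v)) * (arr M v * j v)"
      using d ipjP by simp
    also have "\<dots> = i (Suc v) * (p (Suc v) * (arr M v * j v)) + j (Suc v) * arr N v"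
      using d by (simp add: mat_algebra N_def)
    also have "p (Suc v) * (arr M v * j v) = arr I v * (p v * j v)"
      using d by (intro mult_eq_mult_right total_hom_commute[OF p]) auto
    also have "i (Suc v) * (arr I v * (p v * j v)) = 0\<^sub>m (vdim M (Suc v)) (q v)"
      unfolding pj using d by (simp add: right_mult_zero_dim)
    also have "0\<^sub>m (vdim M (Suc v)) (q v) + j (Suc v) * arr N v = j (Suc v) * arr N v"
      using d by (simp add: add_zero_dim N_def)
    finally show "j (Suc v) * arr N v = arr M v * j v" ..
  qed
  ultimately have "biproduct I N M i p j P"
    using i p pi Pj pj Pi ipjP by (simp add: biproduct_def vN)
  with \<open>nat_rep n N\<close> show ?thesis by blast
qed

text \<open>\<open>indecomposable\<close> speaks of \<open>rep_sum\<close>, while a complement comes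
  with structure maps. Matching the structure maps of the two biproducts gives mutually inverse
  morphisms.\<close>

lemma biproduct_imp_isomorphic_rep_sum:
  fixes A B M :: "'k::field rep"
  assumes M: "is_rep n M" and A: "nat_rep n A" and B: "nat_rep n B"
    and b: "biproduct A B (extend n M) iA pA iB pB"
  shows "isomorphic n M (rep_sum A B)"
proof -
  let ?S = "rep_sum A B" and ?M = "extend n M"
  let ?inl = "\<lambda>v. block_inl (vdim A v) (vdim B v)" and ?prl = "\<lambda>v. block_prl (vdim A v) (vdim B v)"
  let ?inr = "\<lambda>v. block_inr (vdim A v) (vdim B v)" and ?prr = "\<lambda>v. block_prr (vdim A v) (vdim B v)"
  have S: "nat_rep n ?S" by (intro nat_rep_rep_sum A B)
  have t: "total_rep A" "total_rep B" "total_rep ?S" "total_rep ?M"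
    using A B S nat_rep_extend[OF M] by (auto simp: nat_rep_def)
  have s: "biproduct A B ?S ?inl ?prl ?inr ?prr" by (rule biproduct_rep_sum[OF t(1,2)])
  have th: "total_hom A ?M iA" "total_hom ?M A pA" "total_hom B ?M iB" "total_hom ?M B pB"
    "total_hom A ?S ?inl" "total_hom ?S A ?prl" "total_hom B ?S ?inr" "total_hom ?S B ?prr"
    using b s by (simp_all add: biproduct_def)
  have e: "pA v * iA v = 1\<^sub>m (vdim A v)" "pB v * iB v = 1\<^sub>m (vdim B v)"
    "pA v * iB v = 0\<^sub>m (vdim A v) (vdim B v)" "pB v * iA v = 0\<^sub>m (vdim B v) (vdim A v)"
    "iA v * pA v + iB v * pB v = 1\<^sub>m (vdim ?M v)" for v
    using b by (simp_all add: biproduct_def)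
  note d = total_hom_dims[OF th(1)] total_hom_dims[OF th(2)] total_hom_dims[OF th(3)] total_hom_dims[OF th(4)]
  define F where "F v = ?inl v * pA v + ?inr v * pB v" for v
  define G where "G v = iA v * ?prl v + iB v * ?prr v" for v
  have F: "total_hom ?M ?S F" unfolding F_def
    by (intro total_hom_add total_hom_comp[OF th(2,5)] total_hom_comp[OF th(4,7)] t)
  have G: "total_hom ?S ?M G" unfolding G_def
    by (intro total_hom_add total_hom_comp[OF th(6,1)] total_hom_comp[OF th(8,3)] t)
  have "G v * F v = iA v * pA v + iB v * pB v" for v
    using d by (simp add: F_def G_def mat_algebra mult_eq_one_right[OF block_identities(1)]
        mult_eq_one_right[OF block_identities(2)] mult_eq_zero_right[OF block_identities(3)]
        mult_eq_zero_right[OF block_identities(4)])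
  then have GF: "G v * F v = 1\<^sub>m (vdim ?M v)" for v using e by simp
  have "F v * G v = ?inl v * ?prl v + ?inr v * ?prr v" for v
    using d by (simp add: F_def G_def mat_algebra mult_eq_one_right[OF e(1)]
        mult_eq_one_right[OF e(2)] mult_eq_zero_right[OF e(3)] mult_eq_zero_right[OF e(4)])
  then have FG: "F v * G v = 1\<^sub>m (vdim ?S v)" for v using block_identities by (simp add: rep_sum_def)
  have eS: "extend n ?S = ?S" by (rule extend_nat_rep[OF S])
  have "restrict F {1..n} \<in> Hom n M ?S" "restrict G {1..n} \<in> Hom n ?S M"
    by (rule restrict_mem_Hom, use F G eS in simp)+
  moreover have "comp_hom n (restrict G {1..n}) (restrict F {1..n}) = id_hom n M"
    using GF by (auto simp: comp_hom_def id_hom_def vdim_extend)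
  moreover have "comp_hom n (restrict F {1..n}) (restrict G {1..n}) = id_hom n ?S"
    using FG by (auto simp: comp_hom_def id_hom_def)
  ultimately show ?thesis unfolding isomorphic_def by blast
qed

lemma indecomposable_iso_interval:
  fixes M :: "'k::field rep"
  assumes "indecomposable n M"
  shows "\<exists>a b f g. 1 \<le> a \<and> a \<le> b \<and> b \<le> n \<and> iso_via (extend n M) (interval a b) f g"
proof -
  have M: "is_rep n M" and nz: "\<not> is_zero_rep n M"
    and ind: "\<And>A B. is_rep n A \<Longrightarrow> is_rep n B \<Longrightarrow> isomorphic n M (rep_sum A B) \<Longrightarrow>
      is_zero_rep n A \<or> is_zero_rep n B"
    using assms by (auto simp: indecomposable_def)
  have "\<exists>v. vdim (extend n M) v \<noteq> 0" using nz by (auto simp: is_zero_rep_def vdim_extend)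
  from interval_summand[OF nat_rep_extend[OF M] this]
  obtain a b i p where ab: "1 \<le> a" "a \<le> b" "b \<le> n" and i: "total_hom (interval a b) (extend n M) i"
    and p: "total_hom (extend n M) (interval a b) p"
    and pi: "\<And>v. p v * i v = 1\<^sub>m (vdim (interval a b :: 'k rep) v)" by blast
  let ?I = "interval a b :: 'k rep"
  have I: "nat_rep n ?I" using ab by (intro nat_rep_interval)
  from summand_has_complement[OF nat_rep_extend[OF M] I i p pi]
  obtain N j q where N: "nat_rep n N" and b: "biproduct ?I N (extend n M) i p j q" by blast
  have "is_zero_rep n ?I \<or> is_zero_rep n N"
    by (intro ind nat_rep_is_rep[OF I] nat_rep_is_rep[OF N]
        biproduct_imp_isomorphic_rep_sum[OF M I N b])
  moreover have "\<not> is_zero_rep n ?I" using ab by (auto simp: is_zero_rep_def vdim_interval)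
  ultimately have "vdim N v = 0" for v using N by (auto simp: is_zero_rep_def nat_rep_def)
  then have "j v * q v = 0\<^sub>m (vdim (extend n M) v) (vdim (extend n M) v)" for v
    using b total_hom_dims[of N "extend n M" j v] total_hom_dims[of "extend n M" N q v]
    by (intro eq_matI) (auto simp: biproduct_def scalar_prod_def)
  moreover have "i v * p v + j v * q v = 1\<^sub>m (vdim (extend n M) v)" for v
    using b by (simp add: biproduct_def)
  ultimately have "i v * p v = 1\<^sub>m (vdim (extend n M) v)" for v
    using total_hom_dims[OF i, of v] total_hom_dims[OF p, of v] by (metis add_zero_dim(1) index_mult_mat(2,3))
  then have "iso_via (extend n M) ?I p i" using i p pi by (simp add: iso_via_def)
  with ab show ?thesis by blast
qed

text \<open>A product through a space of dimension at most one has vanishing 2 by 2 minors, whereas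
  the upper left minor of a larger identity matrix is one.\<close>

lemma vdim_le_one_if_factors:
  fixes A B :: "'k::field mat"
  assumes A: "A \<in> carrier_mat m e" and B: "B \<in> carrier_mat e m" and AB: "A * B = 1\<^sub>m m" and e: "e \<le> 1"
  shows "m \<le> 1"
proof (rule ccontr)
  assume "\<not> m \<le> 1"
  then have m: "0 < m" "1 < m" by auto
  have ent: "(A * B) $$ (r,s) = (\<Sum>k<e. A $$ (r,k) * B $$ (k,s))" if "r < m" "s < m" for r s
    using that A B by (simp add: scalar_prod_def lessThan_atLeast0)
  have e1: "e = 0 \<or> e = 1" using e by auto
  have "(A * B) $$ (0,0) * (A * B) $$ (1,1) = (A * B) $$ (0,1) * (A * B) $$ (1,0)"
    unfolding ent[OF m(1,1)] ent[OF m(2,2)] ent[OF m(1,2)] ent[OF m(2,1)] using e1 by auto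
  then show False using m by (simp add: AB)
qed

lemma vdim_iso_interval:
  fixes M :: "'k::field rep"
  assumes "iso_via M (interval a b) f g"
  shows "vdim M v = (if a \<le> v \<and> v \<le> b then 1 else 0)"
proof -
  let ?I = "interval a b :: 'k rep"
  have f: "total_hom M ?I f" and g: "total_hom ?I M g" and e: "g v * f v = 1\<^sub>m (vdim M v)"
    "f v * g v = 1\<^sub>m (vdim ?I v)"
    using assms by (auto simp: iso_via_def)
  have c: "g v \<in> carrier_mat (vdim M v) (vdim ?I v)" "f v \<in> carrier_mat (vdim ?I v) (vdim M v)"
    using f g by (auto simp: total_hom_def)
  have I1: "vdim ?I v \<le> 1" by (simp add: vdim_interval)
  have "bij_mat (g v)" using c e by (auto simp: bij_mat_def intro!: bexI[of _ "f v"])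
  from bij_mat_dims[OF this] have "vdim M v = vdim ?I v"
    using c vdim_le_one_if_factors[OF c e(1) I1] I1 by auto
  then show ?thesis by (simp add: vdim_interval)
qed

section \<open>Relative projectivity\<close>

lemma bij_mat_mult:
  assumes "bij_mat A" "bij_mat B" "dim_col A = dim_row B"
  shows "bij_mat (A * B)"
proof -
  obtain A' where A': "A' \<in> carrier_mat (dim_col A) (dim_row A)" "A * A' = 1\<^sub>m (dim_row A)" "A' * A = 1\<^sub>m (dim_col A)"
    using assms(1) by (auto simp: bij_mat_def)
  obtain B' where B': "B' \<in> carrier_mat (dim_col B) (dim_row B)" "B * B' = 1\<^sub>m (dim_row B)" "B' * B = 1\<^sub>m (dim_col B)"
    using assms(2) by (auto simp: bij_mat_def)
  note d = carrier_matD[OF A'(1)] carrier_matD[OF B'(1)] assms(3)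
  have "A * B * (B' * A') = 1\<^sub>m (dim_row A)" "B' * A' * (A * B) = 1\<^sub>m (dim_col B)"
    using d A' B' by (simp_all add: mult_assoc_dim mult_eq_one_right[OF B'(2)] mult_eq_one_right[OF A'(3)])
  then show ?thesis unfolding bij_mat_def using d by (intro bexI[of _ "B' * A'"]) (auto intro!: carrier_matI)
qed

lemma bij_mat_inj:
  assumes "bij_mat A" "A \<in> carrier_mat m k" "y \<in> carrier_mat k 1" "A * y = 0\<^sub>m m 1"
  shows "y = 0\<^sub>m k 1"
  using assms bij_mat_iff[OF assms(2)] by blast

lemma bij_mat_surj:
  assumes "bij_mat A" "A \<in> carrier_mat m k" "z \<in> carrier_mat m 1"
  shows "\<exists>y\<in>carrier_mat k 1. A * y = z"
  using assms bij_mat_iff[OF assms(2)] by blast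

definition total_epi :: "nat \<Rightarrow> ('k::field rep \<Rightarrow> bool) \<Rightarrow> 'k rep \<Rightarrow> 'k rep \<Rightarrow> (nat \<Rightarrow> 'k mat) \<Rightarrow> bool" where
  "total_epi n C X Y f \<longleftrightarrow> total_hom X Y f \<and>
     (\<forall>Z g h. nat_rep n Z \<longrightarrow> C Z \<longrightarrow> total_hom Y Z g \<longrightarrow> total_hom Y Z h \<longrightarrow>
       (\<forall>v. g v * f v = h v * f v) \<longrightarrow> g = h)"

definition total_projective :: "nat \<Rightarrow> ('k::field rep \<Rightarrow> bool) \<Rightarrow> 'k rep \<Rightarrow> bool" where
  "total_projective n C P \<longleftrightarrow> (\<forall>X Y f h. nat_rep n X \<longrightarrow> nat_rep n Y \<longrightarrow> C X \<longrightarrow> C Y \<longrightarrow>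
     total_epi n C X Y f \<longrightarrow> total_hom P Y h \<longrightarrow> (\<exists>k. total_hom P X k \<and> (\<forall>v. f v * k v = h v)))"

text \<open>
  The cokernel of a morphism in the perpendicular category again has bijective path maps, so
  epimorphisms of that category are surjective at every vertex.
\<close>

lemma total_epi_right_inverse:
  fixes X Y :: "'k::field rep"
  assumes X: "nat_rep n X" and Y: "nat_rep n Y"
    and bX: "\<And>u k. (u, k) \<in> K \<Longrightarrow> bij_mat (path X u k)"
    and bY: "\<And>u k. (u, k) \<in> K \<Longrightarrow> bij_mat (path Y u k)"
    and epi: "total_epi n (\<lambda>Z. \<forall>(u, k)\<in>K. bij_mat (path Z u k)) X Y f"
  shows "\<exists>R\<in>carrier_mat (vdim X v) (vdim Y v). f v * R = 1\<^sub>m (vdim Y v)"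
proof -
  have f: "total_hom X Y f" and tX: "total_rep X" and tY: "total_rep Y"
    using epi X Y by (auto simp: total_epi_def nat_rep_def)
  have "\<forall>v. \<exists>q P S B. P \<in> carrier_mat q (vdim Y v) \<and> S \<in> carrier_mat (vdim Y v) q \<and>
    B \<in> carrier_mat (vdim X v) (vdim Y v) \<and> P * S = 1\<^sub>m q \<and> P * f v = 0\<^sub>m q (vdim X v) \<and>
    S * P + f v * B = 1\<^sub>m (vdim Y v)"
    using matrix_cokernel f unfolding total_hom_def by blast
  then obtain q P S B where P: "\<And>v. P v \<in> carrier_mat (q v) (vdim Y v)"
    and S: "\<And>v. S v \<in> carrier_mat (vdim Y v) (q v)" and B: "\<And>v. B v \<in> carrier_mat (vdim X v) (vdim Y v)"
    and PS: "\<And>v. P v * S v = 1\<^sub>m (q v)" and Pf: "\<And>v. P v * f v = 0\<^sub>m (q v) (vdim X v)"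
    and SPfB: "\<And>v. S v * P v + f v * B v = 1\<^sub>m (vdim Y v)"
    by metis
  note d = carrier_matD[OF P] carrier_matD[OF S] carrier_matD[OF B] total_hom_dims[OF f]
    total_rep_dims[OF tX] total_rep_dims[OF tY] path_dims[OF tX] path_dims[OF tY]
  define Q where "Q = Rep q (\<lambda>v. P (Suc v) * (arr Y v * S v))"
  have vQ: "vdim Q v = q v" for v by (simp add: Q_def)
  have "q v = 0" if "v \<notin> {1..n}" for v
    using one_mat_through_zero[OF PS[of v]] P[of v] S[of v] Y that by (auto simp: nat_rep_def)
  then have Q: "nat_rep n Q" using d by (auto simp: nat_rep_def total_rep_def Q_def intro!: carrier_matI)
  then have tQ: "total_rep Q" by (simp add: nat_rep_def)
  have hP: "total_hom Y Q P" unfolding total_hom_def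
  proof (intro conjI allI)
    fix v
    show "P v \<in> carrier_mat (vdim Q v) (vdim Y v)" using P by (simp add: vQ)
    have "P (Suc v) * arr Y v = P (Suc v) * (arr Y v * (S v * P v + f v * B v))" using d SPfB by simp
    also have "\<dots> = arr Q v * P v + P (Suc v) * (arr Y v * (f v * B v))"
      using d by (simp add: mat_algebra Q_def)
    also have "arr Y v * (f v * B v) = f (Suc v) * (arr X v * B v)"
      using d by (intro mult_eq_mult_right total_hom_commute[OF f, symmetric]) auto
    also have "P (Suc v) * (f (Suc v) * (arr X v * B v)) = 0\<^sub>m (q (Suc v)) (vdim Y v)"
      using d mult_eq_zero_right[OF Pf[of "Suc v"], of "arr X v * B v"] by simp
    also have "arr Q v * P v + 0\<^sub>m (q (Suc v)) (vdim Y v) = arr Q v * P v"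
      using d by (simp add: add_zero_dim Q_def)
    finally show "P (Suc v) * arr Y v = arr Q v * P v" .
  qed
  have "bij_mat (path Q u k)" if uk: "(u, k) \<in> K" for u k
  proof -
    let ?w = "u + k" and ?A = "path Y u k" and ?X = "path X u k" and ?Q = "path Q u k"
    obtain A' where A': "A' \<in> carrier_mat (vdim Y u) (vdim Y ?w)" "?A * A' = 1\<^sub>m (vdim Y ?w)" "A' * ?A = 1\<^sub>m (vdim Y u)"
      using bY[OF uk] d by (auto simp: bij_mat_def)
    obtain X' where X': "X' \<in> carrier_mat (vdim X u) (vdim X ?w)" "?X * X' = 1\<^sub>m (vdim X ?w)" "X' * ?X = 1\<^sub>m (vdim X u)"
      using bX[OF uk] d by (auto simp: bij_mat_def)
    note dQ = path_dims[OF tQ, unfolded vQ]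
    note d = d dQ carrier_matD[OF A'(1)] carrier_matD[OF X'(1)]
    have PA: "P ?w * ?A = ?Q * P u" by (rule path_hom[OF hP tY tQ])
    have "?Q = ?Q * (P u * S u)" using d PS by simp
    also have "\<dots> = P ?w * (?A * S u)" using d by (intro mult_eq_mult_right PA[symmetric]) auto
    finally have Qe: "?Q = P ?w * (?A * S u)" .
    \<comment> \<open>The inverse \<open>A'\<close> of the path map of \<open>Y\<close>, read on the
      cokernel through \<open>S\<close> and \<open>P\<close>. It is a right inverse for formal
      reasons; for the left inverse \<open>A'\<close> must respect the images of
      \<open>f\<close>.\<close>
    let ?B = "P u * (A' * S ?w)"
    have "?Q * ?B = P ?w * (?A * (A' * S ?w))" using d by (intro mult_eq_mult_right PA[symmetric]) auto
    then have 1: "?Q * ?B = 1\<^sub>m (q ?w)" using d PS A'(2) by (simp add: mult_eq_one_right)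
    \<comment> \<open>Bijectivity of the path map of \<open>X\<close> is used here: it makes
      \<open>A'\<close> carry the image of \<open>f\<close> at the end of the path back into the
      image at its start, so that \<open>A'\<close> descends to the cokernel.\<close>
    have Af: "A' * f ?w = f u * X'"
    proof -
      have "?A * f u = f ?w * ?X" by (rule path_hom[OF f tX tY, symmetric])
      then have "?A * (f u * X') = f ?w * (?X * X')" using d by (intro mult_eq_mult_right) auto
      also have "\<dots> = f ?w" using d X' by simp
      finally have "A' * f ?w = A' * (?A * (f u * X'))" by simp
      then show ?thesis using d A'(3) by (simp add: mult_eq_one_right)
    qed
    have "P u * (A' * (f ?w * (B ?w * (?A * S u)))) = P u * (f u * (X' * (B ?w * (?A * S u))))"
      using d mult_eq_mult_right[OF Af, of "B ?w * (?A * S u)"] by simp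
    also have "\<dots> = 0\<^sub>m (q u) (q u)" using d mult_eq_zero_right[OF Pf[of u], of "X' * (B ?w * (?A * S u))"] by simp
    finally have z: "P u * (A' * (f ?w * (B ?w * (?A * S u)))) = 0\<^sub>m (q u) (q u)" .
    have "1\<^sub>m (q u) = P u * (A' * ((S ?w * P ?w + f ?w * B ?w) * (?A * S u)))"
      using d SPfB A'(3) PS by (simp add: mult_eq_one_right)
    also have "\<dots> = P u * (A' * (S ?w * (P ?w * (?A * S u)))) + P u * (A' * (f ?w * (B ?w * (?A * S u))))"
      using d by (simp add: mat_algebra)
    also have "\<dots> = P u * (A' * (S ?w * ?Q))" unfolding z Qe[symmetric] using d by (simp add: add_zero_dim)
    finally have 2: "?B * ?Q = 1\<^sub>m (q u)" using d by (simp add: mult_assoc_dim)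
    show ?thesis unfolding bij_mat_def using 1 2 d by (intro bexI[of _ ?B]) (auto intro!: carrier_matI)
  qed
  then have CQ: "\<forall>(u, k)\<in>K. bij_mat (path Q u k)" by auto
  have zero: "total_hom Y Q (\<lambda>v. 0\<^sub>m (q v) (vdim Y v))"
    using d total_rep_dims[OF tQ] by (auto simp: total_hom_def vQ right_mult_zero_dim)
  \<comment> \<open>The cokernel map and the zero map agree after \<open>f\<close>, and their target
    \<open>Q\<close> has been shown to satisfy the test condition; so \<open>P\<close> is zero and
    \<open>B\<close> inverts \<open>f\<close> from the right.\<close>
  have "\<And>v. P v * f v = 0\<^sub>m (q v) (vdim Y v) * f v" using Pf d by simp
  with epi Q CQ hP zero have "P = (\<lambda>v. 0\<^sub>m (q v) (vdim Y v))"
    unfolding total_epi_def by blast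
  then have "S v * P v = 0\<^sub>m (vdim Y v) (vdim Y v)" using d by (simp add: right_mult_zero_dim)
  then have "f v * B v = 1\<^sub>m (vdim Y v)" using SPfB[of v] d by (simp add: add_zero_dim)
  then show ?thesis using B by blast
qed

text \<open>Here \<open>[c, d]\<close> is the parent of \<open>[a, b]\<close>, or the fictitious
  \<open>[0, n]\<close> for a root; \<open>bc\<close> and \<open>bb\<close> are the two bijectivity
  statements supplied by the combinatorics.\<close>

lemma total_projective_interval:
  fixes K :: "(nat \<times> nat) set"
  defines "C \<equiv> \<lambda>Z :: 'k::field rep. \<forall>(u, k)\<in>K. bij_mat (path Z u k)"
  assumes ord: "c \<le> a" "a \<le> b" "b \<le> d"
    and bc: "\<And>Z. nat_rep n Z \<Longrightarrow> C Z \<Longrightarrow> bij_mat (path Z c (Suc d - c))"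
    and bb: "\<And>Z. nat_rep n Z \<Longrightarrow> C Z \<Longrightarrow> bij_mat (path Z (Suc b) (d - b))"
  shows "total_projective n C (interval a b)"
  unfolding total_projective_def
proof (intro allI impI)
  fix X Y :: "'k rep" and f h
  let ?I = "interval a b :: 'k rep"
  assume X: "nat_rep n X" and Y: "nat_rep n Y" and CX: "C X" and CY: "C Y"
    and epi: "total_epi n C X Y f" and h: "total_hom ?I Y h"
  have f: "total_hom X Y f" and tX: "total_rep X" and tY: "total_rep Y"
    using epi X Y by (auto simp: total_epi_def nat_rep_def)
  note d = path_dims[OF tX] path_dims[OF tY] total_hom_dims[OF f]
  obtain R where R: "R \<in> carrier_mat (vdim X a) (vdim Y a)" "f a * R = 1\<^sub>m (vdim Y a)"
    using total_epi_right_inverse[OF X Y, of K f a] CX CY epi unfolding C_def by blast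
  have split: "path Z a (Suc d - a) = path Z (Suc b) (d - b) * path Z a (Suc b - a)"
    "path Z c (Suc d - c) = path Z a (Suc d - a) * path Z c (a - c)" if "total_rep Z" for Z :: "'k rep"
    using path_add[OF that, of a "Suc b - a" "d - b"] path_add[OF that, of c "a - c" "Suc d - a"] ord by auto
  define y where "y = h a"
  have y: "y \<in> carrier_mat (vdim Y a) 1"
    using total_hom_dims[OF h, of a] ord by (auto simp: y_def vdim_interval intro!: carrier_matI)
  have py: "path Y a (Suc b - a) * y = 0\<^sub>m (vdim Y (Suc b)) 1"
    unfolding y_def by (rule hom_interval_killed[OF tY h ord(2)])
  define x where "x = R * y"
  have x: "x \<in> carrier_mat (vdim X a) 1" using R y by (auto simp: x_def)
  have fx: "f a * x = y" unfolding x_def using R y d by (simp add: mult_eq_one_right)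
  note ords = ord(1,2,3) le_trans[OF ord(1,2)] le_trans[OF ord(2,3)] le_trans[OF le_trans[OF ord(1,2)] ord(3)]
  have e: "a + (Suc d - a) = Suc d" "c + (Suc d - c) = Suc d" "a + (Suc b - a) = Suc b" "Suc b + (d - b) = Suc d" "c + (a - c) = a"
    using ords by auto
  have dY: "dim_row (path Y a (Suc d - a)) = vdim Y (Suc d)" "dim_row (path Y c (Suc d - c)) = vdim Y (Suc d)"
    "dim_row (path Y a (Suc b - a)) = vdim Y (Suc b)" "dim_row (path Y (Suc b) (d - b)) = vdim Y (Suc d)"
    "dim_row (path Y c (a - c)) = vdim Y a"
    "dim_row (path X a (Suc d - a)) = vdim X (Suc d)" "dim_row (path X c (Suc d - c)) = vdim X (Suc d)"
    "dim_row (path X a (Suc b - a)) = vdim X (Suc b)" "dim_row (path X (Suc b) (d - b)) = vdim X (Suc d)"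
    "dim_row (path X c (a - c)) = vdim X a"
    by (simp_all only: d e)
  note dd = dY d(2,4,5,6) carrier_matD[OF x] carrier_matD[OF y]
  have cX: "path X c (Suc d - c) \<in> carrier_mat (vdim X (Suc d)) (vdim X c)"
    "path X (Suc b) (d - b) \<in> carrier_mat (vdim X (Suc d)) (vdim X (Suc b))"
    "path Y c (Suc d - c) \<in> carrier_mat (vdim Y (Suc d)) (vdim Y c)" using dd by (auto intro!: carrier_matI)
  have "path X a (Suc d - a) * x \<in> carrier_mat (vdim X (Suc d)) 1" using dd by (auto intro!: carrier_matI)
  \<comment> \<open>The lift \<open>x\<close> of \<open>y\<close> need not die at
    \<open>b + 1\<close>. Its image at \<open>d + 1\<close> is matched by an element
    \<open>x'\<close> at \<open>c\<close>, whose image at \<open>a\<close> will be subtracted from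
    \<open>x\<close>.\<close>
  then obtain x' where x': "x' \<in> carrier_mat (vdim X c) 1" "path X c (Suc d - c) * x' = path X a (Suc d - a) * x"
    using bij_mat_surj[OF bc[OF X CX] cX(1)] by blast
  note dd = dd carrier_matD[OF x'(1)]
  have fp: "f a * path X c (a - c) = path Y c (a - c) * f c" "f (Suc d) * path X c (Suc d - c) = path Y c (Suc d - c) * f c"
    "f (Suc d) * path X a (Suc d - a) = path Y a (Suc d - a) * f a"
    using path_hom[OF f tX tY, of c "a - c"] path_hom[OF f tX tY, of c "Suc d - c"]
      path_hom[OF f tX tY, of a "Suc d - a"] unfolding e by auto
  \<comment> \<open>The correction must not disturb \<open>f a * x = y\<close>. As \<open>y\<close>
    dies at \<open>b + 1\<close>, it dies at \<open>d + 1\<close>, and injectivity of the path map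
    of \<open>Y\<close> from \<open>c\<close> gives \<open>f c * x' = 0\<close>.\<close>
  have "path Y c (Suc d - c) * (f c * x') = f (Suc d) * (path X c (Suc d - c) * x')"
    by (rule mult_eq_mult_right[OF fp(2)[symmetric]]) (simp_all only: dd)
  also have "\<dots> = f (Suc d) * (path X a (Suc d - a) * x)" unfolding x'(2) ..
  also have "\<dots> = path Y a (Suc d - a) * (f a * x)" by (rule mult_eq_mult_right[OF fp(3)]) (simp_all only: dd)
  also have "\<dots> = path Y (Suc b) (d - b) * (path Y a (Suc b - a) * y)"
    unfolding fx split(1)[OF tY] by (rule mult_assoc_dim) (simp_all only: dd)
  also have "\<dots> = 0\<^sub>m (vdim Y (Suc d)) 1" unfolding py by (simp only: right_mult_zero_dim dd)
  finally have fx': "f c * x' = 0\<^sub>m (vdim Y c) 1"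
    by (rule bij_mat_inj[OF bc[OF Y CY] cX(3), rotated]) (rule carrier_matI; simp only: index_mult_mat dd)
  define x'' where "x'' = x - path X c (a - c) * x'"
  have x'': "x'' \<in> carrier_mat (vdim X a) 1" using dd by (auto simp: x''_def intro!: carrier_matI)
  have "f a * x'' = y - path Y c (a - c) * (f c * x')"
    unfolding x''_def using mult_eq_mult_right[OF fp(1), of x']
    by (simp only: mult_minus_dim index_mult_mat dd fx)
  also have "\<dots> = y - 0\<^sub>m (vdim Y a) 1" unfolding fx' by (simp only: right_mult_zero_dim dd)
  also have "\<dots> = y" by (intro eq_matI) (simp_all add: carrier_matD[OF y])
  finally have fx'': "f a * x'' = y" .
  \<comment> \<open>The corrected lift dies at \<open>d + 1\<close>; as the path map from
    \<open>b + 1\<close> to \<open>d + 1\<close> is injective on \<open>X\<close>, it already dies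
    at \<open>b + 1\<close> and defines a morphism.\<close>
  have "path X a (Suc d - a) * x'' = path X a (Suc d - a) * x - path X c (Suc d - c) * x'"
    unfolding x''_def split(2)[OF tX] by (simp only: mult_minus_dim mult_assoc_dim index_mult_mat dd)
  also have "\<dots> = 0\<^sub>m (vdim X (Suc d)) 1" unfolding x'(2)
    by (rule minus_r_inv_mat) (rule carrier_matI; simp only: index_mult_mat dd)
  finally have "path X (Suc b) (d - b) * (path X a (Suc b - a) * x'') = 0\<^sub>m (vdim X (Suc d)) 1"
    unfolding split(1)[OF tX] by (simp only: mult_assoc_dim dd carrier_matD[OF x''])
  then have "path X a (Suc b - a) * x'' = 0\<^sub>m (vdim X (Suc b)) 1"
    by (rule bij_mat_inj[OF bb[OF X CX] cX(2), rotated])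
      (rule carrier_matI; simp only: index_mult_mat dd carrier_matD[OF x''])
  from hom_interval_exists[OF tX x'' ord(2) this]
  obtain k where k: "total_hom ?I X k" "k a = x''" by blast
  have tI: "total_rep ?I" by (rule total_rep_interval)
  have "f v * k v = h v" for v
    by (rule hom_interval_determined[OF tY total_hom_comp[OF k(1) f tI tX tY] h])
      (simp add: k(2) fx'' y_def)
  with k(1) show "\<exists>k. total_hom ?I X k \<and> (\<forall>v. f v * k v = h v)" by blast
qed

text \<open>The surjection from \<open>[a, d]\<close> to \<open>[a, b]\<close> is an epimorphism
  against any test objects. A lift of the identity would be a nonzero morphism from
  \<open>[a, b]\<close> to \<open>[a, d]\<close>.\<close>

lemma not_total_projective_quotient:
  fixes C :: "'k::field rep \<Rightarrow> bool"
  assumes ord: "1 \<le> a" "a \<le> b" "b < d" "d \<le> n"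
    and C: "C (interval a b)" "C (interval a d)"
  shows "\<not> total_projective n C (interval a b)"
proof
  assume proj: "total_projective n C (interval a b)"
  let ?I = "interval a b :: 'k rep" and ?J = "interval a d :: 'k rep"
  have nI: "nat_rep n ?I" and nJ: "nat_rep n ?J" using ord by (auto intro!: nat_rep_interval)
  have tI: "total_rep ?I" and tJ: "total_rep ?J" by (rule total_rep_interval)+
  define f :: "nat \<Rightarrow> 'k mat" where "f v = (if a \<le> v \<and> v \<le> b then 1\<^sub>m 1 else 0\<^sub>m (vdim ?I v) (vdim ?J v))" for v
  have fc: "f v \<in> carrier_mat (vdim ?I v) (vdim ?J v)" for v
    using ord by (auto simp: f_def vdim_interval)
  have "total_hom ?J ?I f"
  proof (rule hom_intervalI[OF tI fc])
    fix v assume v: "a \<le> v" "v < d"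
    show "f (Suc v) = arr ?I v * f v"
    proof (cases "v < b")
      case True
      then show ?thesis using v by (simp add: f_def arr_interval)
    next
      case False
      then show ?thesis using carrier_matD[OF fc[of "Suc v"]] carrier_matD[OF fc[of v]] total_rep_dims[OF tI, of v] v
        by (intro mat_eq_if_no_entries) (auto simp: vdim_interval)
    qed
  next
    show "arr ?I d * f d = 0\<^sub>m (vdim ?I (Suc d)) 1"
      using carrier_matD[OF fc[of d]] total_rep_dims[OF tI, of d] ord
      by (intro mat_eq_if_no_entries) (auto simp: vdim_interval)
  qed
  moreover have "g v = h v" if g: "total_hom ?I Z g" and h: "total_hom ?I Z h" and eq: "\<And>v. g v * f v = h v * f v" for Z g h v
    using eq[of v] total_hom_dims[OF g, of v] total_hom_dims[OF h, of v]
    by (cases "a \<le> v \<and> v \<le> b") (auto simp: f_def vdim_interval intro!: mat_eq_if_no_entries[of "g v"])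
  ultimately have "total_epi n C ?J ?I f" unfolding total_epi_def by blast
  moreover have "total_hom ?I ?I (\<lambda>v. 1\<^sub>m (vdim ?I v))"
    using total_rep_dims[OF tI] by (auto simp: total_hom_def)
  ultimately obtain k where k: "total_hom ?I ?J k" "\<And>v. f v * k v = 1\<^sub>m (vdim ?I v)"
    using proj C nI nJ unfolding total_projective_def by blast
  \<comment> \<open>As \<open>b < d\<close>, the path from \<open>a\<close> to \<open>b + 1\<close>
    stays inside \<open>[a, d]\<close>, so nothing at \<open>a\<close> dies there and all morphisms
    vanish.\<close>
  have "path ?J a (Suc b - a) = 1\<^sub>m 1" using ord by (intro path_interval) auto
  then have "perp0 ?I ?J" using perp0_interval[OF ord(2) tJ] bij_mat_one by simp
  then have "k a = 0\<^sub>m (vdim ?J a) (vdim ?I a)" using k(1) unfolding perp0_def Hom0_def by blast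
  then have "k a = 0\<^sub>m 1 1" using ord by (simp add: vdim_interval)
  then have "(1\<^sub>m 1 :: 'k mat) = 0\<^sub>m 1 1" using k(2)[of a] ord by (simp add: f_def vdim_interval)
  then show False by (simp add: one_mat_eq_zero_iff)
qed

lemma total_projective_iso_via:
  assumes iso: "iso_via P P' r s" and t: "total_rep P" "total_rep P'" and proj: "total_projective n C P"
  shows "total_projective n C P'"
  unfolding total_projective_def
proof (intro allI impI)
  fix X Y f h
  assume a: "nat_rep n X" "nat_rep n Y" "C X" "C Y" "total_epi n C X Y f" and h: "total_hom P' Y h"
  have r: "total_hom P P' r" and s: "total_hom P' P s" and rs: "\<And>v. r v * s v = 1\<^sub>m (vdim P' v)"
    using iso by (auto simp: iso_via_def)
  have tXY: "total_rep X" "total_rep Y" and f: "total_hom X Y f" using a by (auto simp: nat_rep_def total_epi_def)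
  have "total_hom P Y (\<lambda>v. h v * r v)" by (rule total_hom_comp[OF r h t tXY(2)])
  with proj a obtain k where k: "total_hom P X k" "\<And>v. f v * k v = h v * r v"
    unfolding total_projective_def by blast
  have "f v * (k v * s v) = h v" for v
  proof -
    note d = total_hom_dims[OF f, of v] total_hom_dims[OF k(1), of v] total_hom_dims[OF s, of v]
      total_hom_dims[OF r, of v] total_hom_dims[OF h, of v]
    have "f v * (k v * s v) = h v * (r v * s v)" using d by (intro mult_eq_mult_right k(2)) auto
    then show ?thesis using d rs by simp
  qed
  then show "\<exists>k. total_hom P' X k \<and> (\<forall>v. f v * k v = h v)"
    using total_hom_comp[OF s k(1) t(2,1) tXY(1)] by blast
qed

section \<open>Exceptional sequences of intervals\<close>

text \<open>
  The condition \<open>exceptional\<close> says that \<open>M\<^bsub>a i, b i\<^esub>\<close> lies in the right perpendicular category of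
  \<open>M\<^bsub>a j, b j\<^esub>\<close>. Viewing \<open>[a k, b k]\<close> as an edge between \<open>a k\<close> and \<open>b k + 1\<close>, the
  intervals form a noncrossing spanning tree on the vertices \<open>1, \<dots>, n + 1\<close>.
\<close>

locale exceptional_intervals =
  fixes n :: nat and a b :: "nat \<Rightarrow> nat"
  assumes bounds: "k \<in> {1..n} \<Longrightarrow> 1 \<le> a k \<and> a k \<le> b k \<and> b k \<le> n"
    and exceptional: "i \<in> {1..n} \<Longrightarrow> j \<in> {1..n} \<Longrightarrow> i < j \<Longrightarrow>
      a j \<in> {a i..b i} \<longleftrightarrow> Suc (b j) \<in> {a i..b i}"
begin

text \<open>The incidence matrix is invertible: its product with the matrix of dimension vectors is unitriangular.\<close>

lemma connected:
  assumes S: "\<And>k. k \<in> {1..n} \<Longrightarrow> a k \<in> S \<longleftrightarrow> Suc (b k) \<in> S" and nS: "Suc n \<notin> S"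
    and v: "v \<in> {1..n}"
  shows "v \<notin> S"
proof -
  \<comment> \<open>Row \<open>j\<close> is the edge from \<open>a\<close> to \<open>b + 1\<close>
    of interval \<open>j + 1\<close>. Column \<open>v\<close> stands for vertex
    \<open>v + 1\<close>, so vertex \<open>b + 1\<close> has index \<open>b\<close>; vertex
    \<open>n + 1\<close> has no column and drops out when \<open>b = n\<close>.\<close>
  define U :: "rat mat" where
    "U = mat n n (\<lambda>(j,v). of_bool (v = a (Suc j) - 1) - of_bool (v = b (Suc j)))"
  define V :: "rat mat" where "V = mat n n (\<lambda>(v,i). of_bool (Suc v \<in> {a (Suc i)..b (Suc i)}))"
  \<comment> \<open>The indicator of \<open>S\<close>. It is annihilated by \<open>U\<close> because
    no edge has just one end in \<open>S\<close>; invertibility of \<open>U\<close> then empties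
    \<open>S\<close> below \<open>n + 1\<close>.\<close>
  define s :: "rat vec" where "s = vec n (\<lambda>v. of_bool (Suc v \<in> S))"
  have sum: "(\<Sum>v = 0..<n. (of_bool (v = a (Suc j) - 1) - of_bool (v = b (Suc j))) * of_bool (P (Suc v)))
      = (of_bool (P (a (Suc j))) - of_bool (P (Suc (b (Suc j)))) :: rat)"
    if j: "j < n" and P: "\<not> P (Suc n)" for j P
  proof -
    have bd: "1 \<le> a (Suc j)" "a (Suc j) \<le> b (Suc j)" "b (Suc j) \<le> n" using bounds[of "Suc j"] j by auto
    have "(\<Sum>v = 0..<n. (of_bool (v = a (Suc j) - 1) - of_bool (v = b (Suc j))) * of_bool (P (Suc v)))
      = (\<Sum>v = 0..<n. if v = a (Suc j) - 1 then of_bool (P (Suc v)) else 0)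
        - (\<Sum>v = 0..<n. if v = b (Suc j) then of_bool (P (Suc v)) else (0::rat))"
      unfolding sum_subtractf[symmetric] by (intro sum.cong) auto
    also have "\<dots> = of_bool (P (a (Suc j))) - of_bool (P (Suc (b (Suc j))))"
      using bd P by (cases "b (Suc j) = n") (auto simp: sum.delta)
    finally show ?thesis .
  qed
  have U: "U \<in> carrier_mat n n" and V: "V \<in> carrier_mat n n" by (auto simp: U_def V_def)
  have UV: "(U * V) $$ (j,i) = of_bool (a (Suc j) \<in> {a (Suc i)..b (Suc i)}) - of_bool (Suc (b (Suc j)) \<in> {a (Suc i)..b (Suc i)})"
    if "i < n" "j < n" for i j
  proof -
    have "Suc n \<notin> {a (Suc i)..b (Suc i)}" using bounds[of "Suc i"] that by auto
    from sum[OF that(2), of "\<lambda>v. v \<in> {a (Suc i)..b (Suc i)}", OF this]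
    show ?thesis using that by (simp add: U_def V_def scalar_prod_def)
  qed
  have "upper_triangular (U * V)"
  proof (rule upper_triangularI)
    fix j i assume "i < j" "j < dim_row (U * V)"
    then have ij: "i < j" "i < n" "j < n" by (auto simp: U_def)
    then have "a (Suc j) \<in> {a (Suc i)..b (Suc i)} \<longleftrightarrow> Suc (b (Suc j)) \<in> {a (Suc i)..b (Suc i)}"
      by (intro exceptional) auto
    then show "(U * V) $$ (j,i) = 0" unfolding UV[OF ij(2,3)] by simp
  qed
  then have "det (U * V) = prod_list (diag_mat (U * V))"
    by (rule det_upper_triangular) (use U V in auto)
  also have "diag_mat (U * V) = map (\<lambda>i. 1) [0..<n]"
    unfolding diag_mat_def
  proof (rule map_cong)
    fix i assume "i \<in> set [0..<n]"
    then have i: "i < n" by simp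
    show "(U * V) $$ (i,i) = 1" unfolding UV[OF i i] using bounds[of "Suc i"] i by auto
  qed (simp add: U_def)
  also have "prod_list (map (\<lambda>i. 1) xs) = (1::rat)" for xs :: "nat list" by (induction xs) auto
  finally have "det U * det V = 1" using det_mult[OF U V] by simp
  then have "det U \<noteq> 0" by auto
  then have inj: "\<And>w. w \<in> carrier_vec n \<Longrightarrow> U *\<^sub>v w = 0\<^sub>v n \<Longrightarrow> w = 0\<^sub>v n"
    using det_0_iff_vec_prod_zero_field[OF U] by blast
  have "U *\<^sub>v s = 0\<^sub>v n"
  proof (rule eq_vecI)
    fix j assume j: "j < dim_vec (0\<^sub>v n :: rat vec)"
    then have "(U *\<^sub>v s) $ j = of_bool (a (Suc j) \<in> S) - of_bool (Suc (b (Suc j)) \<in> S)"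
      using sum[of j "\<lambda>v. v \<in> S", OF _ nS] by (simp add: U_def s_def scalar_prod_def)
    then show "(U *\<^sub>v s) $ j = 0\<^sub>v n $ j" using S[of "Suc j"] j by simp
  qed (simp add: U_def)
  then have "s = 0\<^sub>v n" by (rule inj[rotated]) (simp add: s_def)
  then have "s $ (v - 1) = 0" using v by auto
  then show ?thesis using v by (auto simp: s_def split: if_splits)
qed

text \<open>If the intervals crossed, then of the two edge ends of the interval with the larger
  index, its start and the vertex after its end, exactly one would lie in the other interval,
  against \<open>exceptional\<close>.\<close>

lemma not_crossing:
  assumes "i \<in> {1..n}" "k \<in> {1..n}" "a i < a k" "a k \<le> b i"
  shows "b k \<le> b i"
proof (rule ccontr)
  assume h: "\<not> b k \<le> b i"
  then consider "i < k" | "k < i" using nat_neq_iff by fastforce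
  then show False
  proof cases
    case 1
    from exceptional[OF assms(1,2) this] assms(3,4) h show False by auto
  next
    case 2
    from exceptional[OF assms(2,1) this] assms(3,4) h show False by auto
  qed
qed

lemma nested:
  assumes "j \<in> {1..n}" "k \<in> {1..n}" "a k \<le> b j" "a j \<le> b k"
  shows "a j \<le> a k \<and> b k \<le> b j \<or> a k \<le> a j \<and> b j \<le> b k"
  using not_crossing[of j k] not_crossing[of k j] assms by linarith

lemma distinct_intervals:
  assumes "i \<in> {1..n}" "k \<in> {1..n}" "a i = a k" "b i = b k"
  shows "i = k"
proof (rule ccontr)
  assume "i \<noteq> k"
  then consider "i < k" | "k < i" by linarith
  then show False
  proof cases
    case 1
    then show False using exceptional[OF assms(1,2)] assms bounds[OF assms(1)] by auto
  next
    case 2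
    then show False using exceptional[OF assms(2,1)] assms bounds[OF assms(1)] by auto
  qed
qed

text \<open>Given by endpoints and not by the index of a parent, so that a root can be treated as a
  child of the fictitious \<open>[0, n]\<close>.\<close>

definition child :: "nat \<Rightarrow> nat \<Rightarrow> nat \<Rightarrow> bool" where
  "child c d i \<longleftrightarrow> i \<in> {1..n} \<and> c \<le> a i \<and> b i \<le> d \<and>
     (\<forall>k\<in>{1..n}. k \<noteq> i \<longrightarrow> a k \<le> a i \<longrightarrow> b i \<le> b k \<longrightarrow> a k \<le> c \<and> d \<le> b k)"

text \<open>The left wall of the vertex block examined in \<open>next_child\<close>: an edge passing
  over \<open>g\<close> can only belong to an interval covering all of \<open>[c, d]\<close>, so
  none ends inside the block.\<close>

definition gap :: "nat \<Rightarrow> nat \<Rightarrow> nat \<Rightarrow> bool" where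
  "gap c d g \<longleftrightarrow> c \<le> g \<and> (\<forall>k\<in>{1..n}. a k \<le> g \<longrightarrow> g \<le> b k \<longrightarrow> a k \<le> c \<and> d \<le> b k)"

text \<open>Because \<open>i < j\<close>, the child \<open>i\<close> cannot start at
  \<open>a j\<close>, so there is room at \<open>a i - 1\<close>. Either this position is a gap or
  another child \<open>k\<close> ends exactly there; then \<open>k < i < j\<close>, and the search
  goes on to the left of \<open>k\<close>.\<close>

lemma gap_before_child:
  assumes "j \<in> {1..n}" "child (a j) (b j) i" "i < j"
  shows "\<exists>g. gap (a j) (b j) g \<and> g < a i"
  using assms(2,3)
proof (induction "a i" arbitrary: i rule: less_induct)
  case less
  have i: "i \<in> {1..n}" "a j \<le> a i" "b i \<le> b j"
    and ch: "\<And>k. k \<in> {1..n} \<Longrightarrow> k \<noteq> i \<Longrightarrow> a k \<le> a i \<Longrightarrow> b i \<le> b k \<Longrightarrow> a k \<le> a j \<and> b j \<le> b k"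
    using less.prems(1) by (auto simp: child_def)
  have lt: "a j < a i"
    using exceptional[OF i(1) assms(1) less.prems(2)] i bounds[OF i(1)] by force
  define q where "q = a i - 1"
  have q: "a j \<le> q" "q < a i" "Suc q = a i" using lt by (auto simp: q_def)
  \<comment> \<open>The obstructions to \<open>q\<close> being a gap. By nesting they lie in
    \<open>[a j, b j]\<close>, and they end at \<open>q\<close> since they can neither contain nor
    cross interval \<open>i\<close>. The one with smallest start is a child.\<close>
  define T where "T = {k\<in>{1..n}. a k \<le> q \<and> q \<le> b k \<and> \<not> (a k \<le> a j \<and> b j \<le> b k)}"
  show ?case
  proof (cases "T = {}")
    case True
    then have "gap (a j) (b j) q" using q by (auto simp: gap_def T_def)
    then show ?thesis using q by blast
  next
    case False
    have "finite T" by (simp add: T_def)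
    from arg_min_if_finite[OF this False, of a]
    obtain k where k: "k \<in> T" and kmin: "\<And>l. l \<in> T \<Longrightarrow> a k \<le> a l"
      by (meson not_less)
    have inT: "l \<in> {1..n} \<and> l \<noteq> i \<and> a j \<le> a l \<and> b l \<le> b j \<and> b l = q" if l: "l \<in> T" for l
    proof -
      have l': "l \<in> {1..n}" "a l \<le> q" "q \<le> b l" "\<not> (a l \<le> a j \<and> b j \<le> b l)" using l by (auto simp: T_def)
      have ne: "l \<noteq> i" using l' q by auto
      have "q \<le> b j" using q i bounds[OF i(1)] by linarith
      then have "a j \<le> a l \<and> b l \<le> b j" using nested[OF assms(1) l'(1)] l' q by auto
      moreover have "b l = q"
      proof (rule ccontr)
        assume "b l \<noteq> q"
        then have "a i \<le> b l" using l' q by auto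
        moreover have "\<not> b i \<le> b l" using ch[OF l'(1) ne] l' q by auto
        ultimately show False using not_crossing[OF l'(1) i(1)] l' q by auto
      qed
      ultimately show ?thesis using l' ne by blast
    qed
    note kT = inT[OF k]
    have ak: "a k < a i" using k q by (auto simp: T_def)
    have "k < i"
    proof (rule ccontr)
      assume "\<not> k < i"
      then have "i < k" using kT by auto
      then show False using exceptional[OF i(1), of k] kT q ak bounds[OF i(1)] by auto
    qed
    have "child (a j) (b j) k" unfolding child_def
    proof (intro conjI ballI impI)
      fix l assume l: "l \<in> {1..n}" "l \<noteq> k" "a l \<le> a k" "b k \<le> b l"
      have "l \<notin> T"
      proof
        assume "l \<in> T"
        then have "a l = a k" "b l = b k" using kmin[of l] inT[of l] l kT by auto
        then show False using distinct_intervals[of l k] l kT by blast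
      qed
      then show "a l \<le> a j" "b j \<le> b l" using l k kT by (auto simp: T_def)
    qed (use kT in auto)
    then obtain g where "gap (a j) (b j) g" "g < a k"
      using less.hyps[OF ak] \<open>k < i\<close> less.prems(2) by auto
    then show ?thesis using ak by (intro exI[of _ g]) auto
  qed
qed

text \<open>Connectedness forces some interval inside \<open>[c, d]\<close> to cover the vertex
  after \<open>b i\<close>. It starts there, as it can neither cross nor contain interval
  \<open>i\<close>; the longest such interval is a child, and \<open>exceptional\<close> puts it
  after \<open>i\<close>.\<close>

lemma next_child:
  assumes ch: "child c d i" and gap: "gap c d g" and gi: "g < a i" and id: "b i < d" and dn: "d \<le> n"
    and nest: "\<And>k. k \<in> {1..n} \<Longrightarrow> a k \<le> d \<Longrightarrow> c \<le> b k \<Longrightarrow>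
      c \<le> a k \<and> b k \<le> d \<or> a k \<le> c \<and> d \<le> b k"
  shows "\<exists>k. child c d k \<and> i < k \<and> a k = Suc (b i)"
proof -
  have i: "i \<in> {1..n}" "c \<le> a i"
    and chD: "\<And>k. k \<in> {1..n} \<Longrightarrow> k \<noteq> i \<Longrightarrow> a k \<le> a i \<Longrightarrow> b i \<le> b k \<Longrightarrow> a k \<le> c \<and> d \<le> b k"
    using ch by (auto simp: child_def)
  have g: "c \<le> g" and gapD: "\<And>k. k \<in> {1..n} \<Longrightarrow> a k \<le> g \<Longrightarrow> g \<le> b k \<Longrightarrow> a k \<le> c \<and> d \<le> b k"
    using gap by (auto simp: gap_def)
  define p where "p = Suc (b i)"
  have p: "p \<le> d" "g < p" "b i < p" "a i < p" "p \<in> {1..n}"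
    using id gi bounds[OF i(1)] dn by (auto simp: p_def)
  define T where "T = {k\<in>{1..n}. a k \<le> p \<and> p \<le> b k \<and> c < a k}"
  have "T \<noteq> {}"
  proof
    assume T: "T = {}"
    \<comment> \<open>With \<open>T\<close> empty, no edge leaves this block of vertices: one
      leaving to the right would belong to \<open>T\<close>, and one entering from the left would
      cover the gap and hence reach at least \<open>d\<close>, beyond the block. So
      \<open>connected\<close> applies, although \<open>p\<close> lies in the block.\<close>
    have "p \<notin> {Suc g..p}"
    proof (rule connected)
      fix k assume k: "k \<in> {1..n}"
      show "a k \<in> {Suc g..p} \<longleftrightarrow> Suc (b k) \<in> {Suc g..p}"
      proof (rule ccontr)
        assume "\<not> ?thesis"
        then consider "a k \<in> {Suc g..p}" "Suc (b k) \<notin> {Suc g..p}" | "a k \<notin> {Suc g..p}" "Suc (b k) \<in> {Suc g..p}"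
          by blast
        then show False
        proof cases
          case 1
          then have "k \<in> T" using k bounds[OF k] g by (auto simp: T_def)
          then show False using T by blast
        next
          case 2
          then have "a k \<le> g" "g \<le> b k" "b k < p" using bounds[OF k] by auto
          then show False using gapD[OF k] p by auto
        qed
      qed
    qed (use p dn in auto)
    then show False using p by auto
  qed
  moreover have fin: "finite T" by (simp add: T_def)
  ultimately have "Max (b ` T) \<in> b ` T" by (intro Max_in) auto
  then obtain k where k: "k \<in> T" and "b k = Max (b ` T)" by auto
  then have kmax: "b l \<le> b k" if "l \<in> T" for l using that fin by simp
  have inT: "l \<in> {1..n} \<and> l \<noteq> i \<and> c \<le> a l \<and> b l \<le> d \<and> a l = p" if l: "l \<in> T" for l
  proof -
    have l': "l \<in> {1..n}" "a l \<le> p" "p \<le> b l" "c < a l" using l by (auto simp: T_def)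
    have ne: "l \<noteq> i" using l' p by auto
    have "c \<le> a l \<and> b l \<le> d" using nest[OF l'(1)] l' p g by auto
    moreover have "a l = p"
    proof (rule ccontr)
      assume "a l \<noteq> p"
      then have "a l \<le> b i" using l' by (auto simp: p_def)
      moreover have "a i < a l" using chD[OF l'(1) ne] l' p by (metis leI le_trans less_imp_le not_less)
      ultimately show False using not_crossing[OF i(1) l'(1)] l' p by auto
    qed
    ultimately show ?thesis using l' ne by blast
  qed
  note kT = inT[OF k]
  have "i < k"
  proof (rule ccontr)
    assume "\<not> i < k"
    then have "k < i" using kT by auto
    then show False using exceptional[of k i] kT i p k by (auto simp: T_def p_def)
  qed
  moreover have "child c d k" unfolding child_def
  proof (intro conjI ballI impI)
    fix l assume l: "l \<in> {1..n}" "l \<noteq> k" "a l \<le> a k" "b k \<le> b l"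
    have pk: "p \<le> b k" using k by (simp add: T_def)
    have "l \<notin> T"
    proof
      assume "l \<in> T"
      then have "a l = a k" "b l = b k" using kmax[of l] inT[of l] l kT by auto
      then show False using distinct_intervals[of l k] l kT by blast
    qed
    then have "a l \<le> c" using l kT pk by (auto simp: T_def)
    then show "a l \<le> c" "d \<le> b l" using gapD[OF l(1)] g p pk l by auto
  qed (use kT in auto)
  ultimately show ?thesis using kT by (auto simp: p_def)
qed

text \<open>Shows that \<open>[a i, b j]\<close> satisfies the conditions of all later intervals.
  The conditions of \<open>i\<close> and \<open>j\<close> leave only an interval that starts left of
  \<open>a i\<close>, contains interval \<open>i\<close> and ends before \<open>b j\<close>; being
  above a child of \<open>j\<close>, it would have to cover \<open>[a j, b j]\<close>.\<close>

lemma quotient_compatible: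
  assumes j: "j \<in> {1..n}" and ch: "child (a j) (b j) i" and ji: "j < i"
  shows "b i < b j"
    and "\<And>k. k \<in> {1..n} \<Longrightarrow> i < k \<Longrightarrow> a k \<in> {a i..b j} \<longleftrightarrow> Suc (b k) \<in> {a i..b j}"
proof -
  have i: "i \<in> {1..n}" "a j \<le> a i" "b i \<le> b j"
    and chD: "\<And>k. k \<in> {1..n} \<Longrightarrow> k \<noteq> i \<Longrightarrow> a k \<le> a i \<Longrightarrow> b i \<le> b k \<Longrightarrow> a k \<le> a j \<and> b j \<le> b k"
    using ch by (auto simp: child_def)
  show "b i < b j" using exceptional[OF j i(1) ji] i bounds[OF i(1)] by auto
  fix k assume k: "k \<in> {1..n}" "i < k"
  have 1: "a k \<in> {a j..b j} \<longleftrightarrow> Suc (b k) \<in> {a j..b j}" using exceptional[OF j k(1)] ji k by simp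
  have 2: "a k \<in> {a i..b i} \<longleftrightarrow> Suc (b k) \<in> {a i..b i}" by (rule exceptional[OF i(1) k])
  show "a k \<in> {a i..b j} \<longleftrightarrow> Suc (b k) \<in> {a i..b j}"
  proof
    assume "a k \<in> {a i..b j}"
    then show "Suc (b k) \<in> {a i..b j}" using 1 i bounds[OF k(1)] by auto
  next
    assume h: "Suc (b k) \<in> {a i..b j}"
    show "a k \<in> {a i..b j}"
    proof (rule ccontr)
      assume "a k \<notin> {a i..b j}"
      then have ak: "a k < a i" using h bounds[OF k(1)] by auto
      then have "b i \<le> b k" using 2 h by auto
      then show False using chD[OF k(1)] k ak h by auto
    qed
  qed
qed

end

section \<open>Duality\<close>

lemma comp_hom_eq_iff:
  "comp_hom n g f = comp_hom n g' f' \<longleftrightarrow> (\<forall>v\<in>{1..n}. g v * f v = g' v * f' v)"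
proof
  assume h: "comp_hom n g f = comp_hom n g' f'"
  show "\<forall>v\<in>{1..n}. g v * f v = g' v * f' v"
  proof
    fix v assume "v \<in> {1..n}"
    then show "g v * f v = g' v * f' v" using fun_cong[OF h, of v] by (simp add: comp_hom_def)
  qed
qed (auto simp: comp_hom_def)

lemma comp_hom_eq_Hom_iff:
  "h \<in> Hom n M N \<Longrightarrow> comp_hom n g f = h \<longleftrightarrow> (\<forall>v\<in>{1..n}. g v * f v = h v)"
proof -
  assume h: "h \<in> Hom n M N"
  then have "h = restrict h {1..n}" by (auto simp: Hom_def PiE_iff extensional_def)
  then have "comp_hom n g f = h \<longleftrightarrow> comp_hom n g f = restrict h {1..n}" by simp
  also have "\<dots> \<longleftrightarrow> (\<forall>v\<in>{1..n}. g v * f v = h v)"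
    unfolding comp_hom_def by (metis (mono_tags, lifting) restrict_apply' restrict_ext)
  finally show ?thesis .
qed

lemma restrict_mem_Hom_nat_rep:
  assumes "nat_rep n M" "nat_rep n N" "total_hom M N f"
  shows "restrict f {1..n} \<in> Hom n M N"
  using restrict_mem_Hom[of n M N f] assms by (simp add: extend_nat_rep)

lemma extend_hom_restrict_nat_rep:
  assumes "nat_rep n M" "nat_rep n N" "total_hom M N f"
  shows "extend_hom n (restrict f {1..n}) = f"
  using extend_hom_restrict[of f n N M] assms by (simp add: extend_nat_rep total_hom_def)

lemma projective_in_iff:
  fixes C :: "'k::field rep \<Rightarrow> bool"
  assumes P: "is_rep n P"
  shows "projective_in n {Y. is_rep n Y \<and> C (extend n Y)} P \<longleftrightarrow>
    C (extend n P) \<and> total_projective n C (extend n P)"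
proof -
  let ?\<C> = "{Y. is_rep n Y \<and> C (extend n Y)}"
  have epi: "epi_in n ?\<C> X Y f \<longleftrightarrow> total_epi n C (extend n X) (extend n Y) (extend_hom n f)"
    if X: "is_rep n X" and Y: "is_rep n Y" and f: "f \<in> Hom n X Y" for X Y f
  proof
    assume e: "epi_in n ?\<C> X Y f"
    show "total_epi n C (extend n X) (extend n Y) (extend_hom n f)" unfolding total_epi_def
    proof (intro conjI allI impI total_hom_extend_hom X Y f)
      fix Z g h assume Z: "nat_rep n Z" "C Z" and g: "total_hom (extend n Y) Z g"
        and h: "total_hom (extend n Y) Z h" and eq: "\<forall>v. g v * extend_hom n f v = h v * extend_hom n f v"
      have "comp_hom n (restrict g {1..n}) f = comp_hom n (restrict h {1..n}) f"
        unfolding comp_hom_eq_iff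
      proof
        fix v assume "v \<in> {1..n}"
        then show "restrict g {1..n} v * f v = restrict h {1..n} v * f v"
          using eq[rule_format, of v] by (simp add: extend_hom_def)
      qed
      moreover have "restrict g {1..n} \<in> Hom n Y Z" "restrict h {1..n} \<in> Hom n Y Z"
        by (rule restrict_mem_Hom, simp add: extend_nat_rep[OF Z(1)] g h)+
      moreover have "Z \<in> ?\<C>" using Z by (simp add: extend_nat_rep nat_rep_is_rep)
      ultimately have "restrict g {1..n} = restrict h {1..n}" using e unfolding epi_in_def by blast
      then show "g = h"
        using extend_hom_restrict_nat_rep[OF nat_rep_extend[OF Y] Z(1) g]
          extend_hom_restrict_nat_rep[OF nat_rep_extend[OF Y] Z(1) h] by simp
    qed
  next
    assume e: "total_epi n C (extend n X) (extend n Y) (extend_hom n f)"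
    show "epi_in n ?\<C> X Y f" unfolding epi_in_def
    proof (intro conjI ballI impI f)
      fix Z g h assume Z: "Z \<in> ?\<C>" and g: "g \<in> Hom n Y Z" and h: "h \<in> Hom n Y Z"
        and eq: "comp_hom n g f = comp_hom n h f"
      have "extend_hom n g v * extend_hom n f v = extend_hom n h v * extend_hom n f v" for v
        using eq unfolding comp_hom_eq_iff by (simp add: extend_hom_def)
      moreover have "total_hom (extend n Y) (extend n Z) (extend_hom n g)"
        "total_hom (extend n Y) (extend n Z) (extend_hom n h)"
        using Z g h Y by (auto intro: total_hom_extend_hom)
      moreover have "nat_rep n (extend n Z)" "C (extend n Z)" using Z nat_rep_extend by auto
      ultimately have "extend_hom n g = extend_hom n h" using e unfolding total_epi_def by blast
      then show "g = h" using restrict_extend_hom[OF g] restrict_extend_hom[OF h] by simp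
    qed
  qed
  show ?thesis
  proof
    assume p: "projective_in n ?\<C> P"
    have "total_projective n C (extend n P)" unfolding total_projective_def
    proof (intro allI impI)
      fix X Y f h
      assume X: "nat_rep n X" and Y: "nat_rep n Y" and CX: "C X" and CY: "C Y"
        and e: "total_epi n C X Y f" and h: "total_hom (extend n P) Y h"
      have f: "total_hom X Y f" using e by (simp add: total_epi_def)
      let ?f = "restrict f {1..n}"
      have f': "?f \<in> Hom n X Y" by (rule restrict_mem_Hom_nat_rep[OF X Y f])
      have "epi_in n ?\<C> X Y ?f"
        unfolding epi[OF nat_rep_is_rep[OF X] nat_rep_is_rep[OF Y] f']
        by (simp only: extend_nat_rep[OF X] extend_nat_rep[OF Y] extend_hom_restrict_nat_rep[OF X Y f] e)
      moreover have "restrict h {1..n} \<in> Hom n P Y"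
        by (rule restrict_mem_Hom) (simp add: extend_nat_rep[OF Y] h)
      moreover have "X \<in> ?\<C>" "Y \<in> ?\<C>" using X Y CX CY by (simp_all add: extend_nat_rep nat_rep_is_rep)
      ultimately obtain k where k: "k \<in> Hom n P X" "comp_hom n ?f k = restrict h {1..n}"
        using p unfolding projective_in_def by blast
      have tk: "total_hom (extend n P) X (extend_hom n k)"
        using total_hom_extend_hom[OF P nat_rep_is_rep[OF X] k(1)] by (simp add: extend_nat_rep[OF X])
      have "f v * extend_hom n k v = h v" for v
      proof (cases "v \<in> {1..n}")
        case True
        then show ?thesis using fun_cong[OF k(2), of v] by (simp add: comp_hom_def extend_hom_def)
      next
        case False
        then have "vdim Y v = 0" using Y unfolding nat_rep_def by simp
        then show ?thesis using total_hom_dims[OF f, of v] total_hom_dims[OF h, of v] total_hom_dims[OF tk, of v]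
          by (intro mat_eq_if_no_entries) auto
      qed
      with tk show "\<exists>k. total_hom (extend n P) X k \<and> (\<forall>v. f v * k v = h v)" by blast
    qed
    with p show "C (extend n P) \<and> total_projective n C (extend n P)" by (simp add: projective_in_def)
  next
    assume p: "C (extend n P) \<and> total_projective n C (extend n P)"
    show "projective_in n ?\<C> P" unfolding projective_in_def
    proof (intro conjI ballI allI impI)
      show "P \<in> ?\<C>" using p P by simp
      fix X Y f h
      assume X: "X \<in> ?\<C>" and Y: "Y \<in> ?\<C>" and e: "epi_in n ?\<C> X Y f" and h: "h \<in> Hom n P Y"
      have f: "f \<in> Hom n X Y" using e by (simp add: epi_in_def)
      have X': "is_rep n X" "C (extend n X)" and Y': "is_rep n Y" "C (extend n Y)" using X Y by auto
      have e': "total_epi n C (extend n X) (extend n Y) (extend_hom n f)"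
        using e epi[OF X'(1) Y'(1) f] by blast
      have "total_hom (extend n P) (extend n Y) (extend_hom n h)"
        by (rule total_hom_extend_hom[OF P Y'(1) h])
      with p e' X' Y' nat_rep_extend obtain k where k: "total_hom (extend n P) (extend n X) k"
        "\<And>v. extend_hom n f v * k v = extend_hom n h v"
        unfolding total_projective_def by blast
      have "comp_hom n f (restrict k {1..n}) = h"
        unfolding comp_hom_eq_Hom_iff[OF h]
      proof
        fix v assume "v \<in> {1..n}"
        then show "f v * restrict k {1..n} v = h v" using k(2)[of v] by (simp add: extend_hom_def)
      qed
      with restrict_mem_Hom[OF k(1)] show "\<exists>k\<in>Hom n P X. comp_hom n f k = h" by blast
    qed
  qed
qed

text \<open>Transposition reverses the arrows, and numbering the vertices backwards restores the
  orientation. Truncated subtraction would send every \<open>v > n\<close> to arrow 0, hence the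
  explicit empty matrix there.\<close>

definition dual :: "nat \<Rightarrow> 'k::field rep \<Rightarrow> 'k rep" where
  "dual n M = Rep (\<lambda>v. vdim M (Suc n - v))
     (\<lambda>v. if v \<le> n then transpose_mat (arr M (n - v)) else 0\<^sub>m 0 0)"

definition dual_hom :: "nat \<Rightarrow> (nat \<Rightarrow> 'k::field mat) \<Rightarrow> nat \<Rightarrow> 'k mat" where
  "dual_hom n f v = transpose_mat (f (Suc n - v))"

lemma vdim_dual: "vdim (dual n M) v = vdim M (Suc n - v)"
  by (simp add: dual_def)

lemma nat_rep_vdim_zero: "nat_rep n M \<Longrightarrow> v = 0 \<or> n < v \<Longrightarrow> vdim M v = 0"
  using nat_rep_support[of n M v] by (cases "vdim M v = 0") auto

lemma nat_rep_dual:
  assumes M: "nat_rep n M"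
  shows "nat_rep n (dual n M)"
proof -
  note z = nat_rep_vdim_zero[OF M]
  have t: "total_rep M" using M by (rule nat_rep_total)
  have "arr (dual n M) v \<in> carrier_mat (vdim (dual n M) (Suc v)) (vdim (dual n M) v)" for v
    using total_rep_dims[OF t] by (auto simp: dual_def z Suc_diff_le intro!: carrier_matI)
  then show ?thesis unfolding nat_rep_def total_rep_def by (auto simp: vdim_dual z)
qed

lemma dual_dual:
  assumes M: "nat_rep n M"
  shows "dual n (dual n M) = M"
proof (rule nat_rep_eqI[OF nat_rep_dual[OF nat_rep_dual[OF M]] M])
  fix v assume "v \<in> {1..n}"
  then show "vdim (dual n (dual n M)) v = vdim M v" by (simp add: vdim_dual)
next
  fix v assume "v \<in> {1..<n}"
  then show "arr (dual n (dual n M)) v = arr M v" by (simp add: dual_def)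
qed

lemma total_hom_dual:
  assumes M: "nat_rep n M" and N: "nat_rep n N" and f: "total_hom M N f"
  shows "total_hom (dual n N) (dual n M) (dual_hom n f)"
proof (rule total_homI[OF nat_rep_dual[OF N] nat_rep_dual[OF M]])
  fix v
  show "dual_hom n f v \<in> carrier_mat (vdim (dual n M) v) (vdim (dual n N) v)"
    using total_hom_dims[OF f] by (auto simp: dual_hom_def vdim_dual)
next
  fix v assume v: "v \<in> {1..<n}"
  have c: "arr M (n - v) \<in> carrier_mat (vdim M (Suc (n - v))) (vdim M (n - v))"
    "arr N (n - v) \<in> carrier_mat (vdim N (Suc (n - v))) (vdim N (n - v))"
    "f (n - v) \<in> carrier_mat (vdim N (n - v)) (vdim M (n - v))"
    "f (Suc (n - v)) \<in> carrier_mat (vdim N (Suc (n - v))) (vdim M (Suc (n - v)))"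
    using M N f unfolding nat_rep_def total_rep_def total_hom_def by blast+
  have "transpose_mat (f (Suc (n - v)) * arr M (n - v)) = transpose_mat (arr N (n - v) * f (n - v))"
    using total_hom_commute[OF f] by simp
  then have "transpose_mat (arr M (n - v)) * transpose_mat (f (Suc (n - v))) =
      transpose_mat (f (n - v)) * transpose_mat (arr N (n - v))"
    by (simp add: transpose_mult[OF c(4,1)] transpose_mult[OF c(2,3)])
  then show "dual_hom n f (Suc v) * arr (dual n N) v = arr (dual n M) v * dual_hom n f v"
    using v by (simp add: dual_hom_def dual_def Suc_diff_le)
qed

lemma dual_hom_dual_hom:
  assumes M: "nat_rep n M" and N: "nat_rep n N" and f: "total_hom M N f"
  shows "dual_hom n (dual_hom n f) = f"
proof
  fix v
  show "dual_hom n (dual_hom n f) v = f v"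
  proof (cases "v \<le> n")
    case False
    then have "vdim M v = 0" "vdim M (Suc n) = 0" "vdim N v = 0" "vdim N (Suc n) = 0"
      using nat_rep_vdim_zero[OF M] nat_rep_vdim_zero[OF N] by auto
    then show ?thesis using False total_hom_dims[OF f, of v] total_hom_dims[OF f, of "Suc n"]
      by (intro mat_eq_if_no_entries) (auto simp: dual_hom_def)
  qed (simp add: dual_hom_def)
qed

lemma dual_hom_mult:
  assumes "total_hom L M f" "total_hom M N g"
  shows "dual_hom n (\<lambda>v. g v * f v) v = dual_hom n f v * dual_hom n g v"
  using assms unfolding dual_hom_def total_hom_def
  by (intro transpose_mult[of _ "vdim N (Suc n - v)" "vdim M (Suc n - v)" _ "vdim L (Suc n - v)"]) auto

lemma Hom0_dual:
  assumes M: "nat_rep n M" and N: "nat_rep n N" and h: "Hom0 M N"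
  shows "Hom0 (dual n N) (dual n M)"
  unfolding Hom0_def
proof (intro allI impI)
  fix f v assume f: "total_hom (dual n N) (dual n M) f"
  have "total_hom M N (dual_hom n f)"
    using total_hom_dual[OF nat_rep_dual[OF N] nat_rep_dual[OF M] f] by (simp add: dual_dual M N)
  then have "dual_hom n f w = 0\<^sub>m (vdim N w) (vdim M w)" for w using h by (simp add: Hom0_def)
  then have "dual_hom n (dual_hom n f) v = 0\<^sub>m (vdim M (Suc n - v)) (vdim N (Suc n - v))"
    unfolding dual_hom_def[of n "dual_hom n f"] by simp
  then show "f v = 0\<^sub>m (vdim (dual n M) v) (vdim (dual n N) v)"
    by (simp add: dual_hom_dual_hom[OF nat_rep_dual[OF N] nat_rep_dual[OF M] f] vdim_dual)
qed

lemma Ext0_dual: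
  fixes M N :: "'k::field rep"
  assumes M: "nat_rep n M" and N: "nat_rep n N" and h: "Ext0 M N"
  shows "Ext0 (dual n N) (dual n M)"
  unfolding Ext0_def
proof (intro allI impI)
  let ?M = "dual n M" and ?N = "dual n N"
  fix c :: "nat \<Rightarrow> 'k mat"
  assume c: "\<forall>v. c v \<in> carrier_mat (vdim ?M (Suc v)) (vdim ?N v)"
  have dc: "dim_row (c v) = vdim M (n - v)" "dim_col (c v) = vdim N (Suc n - v)" for v
    using c[rule_format, of v] by (auto simp: vdim_dual)
  \<comment> \<open>Transposing exchanges the two sides of the coboundary equation, so the cocycle
    changes sign; arrow \<open>w\<close> corresponds to arrow \<open>n - w\<close> of the
    dual.\<close>
  define c' where "c' w = (if w \<le> n then - transpose_mat (c (n - w)) else 0\<^sub>m (vdim N (Suc w)) (vdim M w))" for w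
  have "c' w \<in> carrier_mat (vdim N (Suc w)) (vdim M w)" for w
    by (auto simp: c'_def dc Suc_diff_le intro!: carrier_matI)
  with h[unfolded Ext0_def, rule_format, of c'] obtain f where
    fc: "\<And>v. f v \<in> carrier_mat (vdim N v) (vdim M v)" and
    f: "\<And>v. f (Suc v) * arr M v = arr N v * f v + c' v" by blast
  note t = nat_rep_total[OF M] nat_rep_total[OF N]
    nat_rep_total[OF nat_rep_dual[OF M]] nat_rep_total[OF nat_rep_dual[OF N]]
  note d = total_rep_dims[OF t(1)] total_rep_dims[OF t(2)] carrier_matD[OF fc]
  have g: "dual_hom n f v \<in> carrier_mat (vdim ?M v) (vdim ?N v)" for v
    using fc by (auto simp: dual_hom_def vdim_dual)
  have "dual_hom n f (Suc v) * arr ?N v = arr ?M v * dual_hom n f v + c v" for v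
  proof (cases "v \<le> n")
    case True
    let ?w = "n - v"
    have cM: "arr M ?w \<in> carrier_mat (vdim M (Suc ?w)) (vdim M ?w)"
      and cN: "arr N ?w \<in> carrier_mat (vdim N (Suc ?w)) (vdim N ?w)"
      using t(1,2) unfolding total_rep_def by blast+
    have dcv: "dim_row (c v) = vdim M ?w" "dim_col (c v) = vdim N (Suc ?w)"
      using dc[of v] True by (simp_all add: Suc_diff_le)
    have neg: "transpose_mat (X + - transpose_mat C) = transpose_mat X - C"
      if "dim_row X = dim_col C" "dim_col X = dim_row C" for X C :: "'k mat"
      using that by (intro eq_matI) auto
    have "transpose_mat (arr M ?w) * transpose_mat (f (Suc ?w)) = transpose_mat (arr N ?w * f ?w + c' ?w)"
      unfolding transpose_mult[OF fc cM, symmetric] f ..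
    also have "c' ?w = - transpose_mat (c v)" using True by (simp add: c'_def)
    also have "transpose_mat (arr N ?w * f ?w + - transpose_mat (c v)) = transpose_mat (arr N ?w * f ?w) - c v"
      by (rule neg) (simp_all add: d dcv)
    also have "\<dots> = transpose_mat (f ?w) * transpose_mat (arr N ?w) - c v"
      unfolding transpose_mult[OF cN fc] ..
    finally have "transpose_mat (arr M ?w) * transpose_mat (f (Suc ?w)) =
        transpose_mat (f ?w) * transpose_mat (arr N ?w) - c v" .
    then have "transpose_mat (arr M ?w) * transpose_mat (f (Suc ?w)) + c v = transpose_mat (f ?w) * transpose_mat (arr N ?w)"
      using d dcv by (auto intro!: eq_matI simp del: index_mult_mat(1))
    then show ?thesis using True by (simp add: dual_hom_def dual_def Suc_diff_le)
  next
    case False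
    then have "vdim ?M (Suc v) = 0" "vdim ?N v = 0" using nat_rep_vdim_zero[OF M, of 0] nat_rep_vdim_zero[OF N, of 0] by (simp_all add: vdim_dual)
    then show ?thesis
      using carrier_matD[OF g[of "Suc v"]] carrier_matD[OF g[of v]] total_rep_dims[OF t(3), of v]
        total_rep_dims[OF t(4), of v] carrier_matD[OF c[rule_format, of v]]
      by (intro mat_eq_if_no_entries) auto
  qed
  then show "\<exists>f. (\<forall>v. f v \<in> carrier_mat (vdim ?M v) (vdim ?N v)) \<and>
      (\<forall>v. f (Suc v) * arr ?N v = arr ?M v * f v + c v)"
    using g by (intro exI[of _ "dual_hom n f"]) simp
qed

lemma perp0_dual:
  assumes "nat_rep n M" "nat_rep n N"
  shows "perp0 (dual n N) (dual n M) \<longleftrightarrow> perp0 M N"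
proof -
  have "perp0 (dual n B) (dual n A)" if "nat_rep n A" "nat_rep n B" "perp0 A B" for A B :: "'a rep"
    using that Hom0_dual Ext0_dual by (auto simp: perp0_def)
  from this[OF assms] this[OF nat_rep_dual[OF assms(2)] nat_rep_dual[OF assms(1)]] show ?thesis
    by (auto simp: dual_dual assms)
qed

lemma dual_one:
  assumes "nat_rep n M" "\<And>v. f v = 1\<^sub>m (vdim M v)"
  shows "dual_hom n f v = 1\<^sub>m (vdim (dual n M) v)"
  using assms(2) by (simp add: dual_hom_def vdim_dual)

lemma iso_via_dual:
  assumes A: "nat_rep n A" and B: "nat_rep n B" and i: "iso_via A B f g"
  shows "iso_via (dual n A) (dual n B) (dual_hom n g) (dual_hom n f)"
proof -
  have f: "total_hom A B f" and g: "total_hom B A g"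
    and e: "\<And>v. g v * f v = 1\<^sub>m (vdim A v)" "\<And>v. f v * g v = 1\<^sub>m (vdim B v)"
    using i by (auto simp: iso_via_def)
  show ?thesis unfolding iso_via_def
    using total_hom_dual[OF A B f] total_hom_dual[OF B A g]
      dual_hom_mult[OF f g] dual_hom_mult[OF g f] dual_one[OF A e(1)] dual_one[OF B e(2)]
    by simp
qed

lemma dual_interval:
  assumes "1 \<le> a" "a \<le> b" "b \<le> n"
  shows "dual n (interval a b) = interval (Suc n - b) (Suc n - a)"
proof (rule nat_rep_eqI[of n])
  show "nat_rep n (dual n (interval a b))" "nat_rep n (interval (Suc n - b) (Suc n - a))"
    using assms by (auto intro!: nat_rep_dual nat_rep_interval)
  fix v assume "v \<in> {1..n}"
  then show "vdim (dual n (interval a b)) v = vdim (interval (Suc n - b) (Suc n - a)) v"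
    using assms by (auto simp: vdim_dual vdim_interval)
next
  fix v assume "v \<in> {1..<n}"
  then show "arr (dual n (interval a b)) v = arr (interval (Suc n - b) (Suc n - a)) v"
    using assms by (auto simp: dual_def interval_def Let_def)
qed

lemma biproduct_dual:
  assumes A: "nat_rep n A" and B: "nat_rep n B" and S: "nat_rep n S"
    and b: "biproduct A B S iA pA iB pB"
  shows "biproduct (dual n A) (dual n B) (dual n S)
    (dual_hom n pA) (dual_hom n iA) (dual_hom n pB) (dual_hom n iB)"
proof -
  have th: "total_hom A S iA" "total_hom S A pA" "total_hom B S iB" "total_hom S B pB"
    and e: "\<And>v. pA v * iA v = 1\<^sub>m (vdim A v)" "\<And>v. pB v * iB v = 1\<^sub>m (vdim B v)"
      "\<And>v. pA v * iB v = 0\<^sub>m (vdim A v) (vdim B v)" "\<And>v. pB v * iA v = 0\<^sub>m (vdim B v) (vdim A v)"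
      "\<And>v. iA v * pA v + iB v * pB v = 1\<^sub>m (vdim S v)"
    using b by (auto simp: biproduct_def)
  have "dual_hom n pA v * dual_hom n iA v + dual_hom n pB v * dual_hom n iB v = 1\<^sub>m (vdim (dual n S) v)" for v
  proof -
    have "dual_hom n pA v * dual_hom n iA v + dual_hom n pB v * dual_hom n iB v
        = transpose_mat (iA (Suc n - v) * pA (Suc n - v) + iB (Suc n - v) * pB (Suc n - v))"
      unfolding dual_hom_mult[OF th(2,1), symmetric] dual_hom_mult[OF th(4,3), symmetric]
      unfolding dual_hom_def using total_hom_dims[OF th(1)] total_hom_dims[OF th(2)]
        total_hom_dims[OF th(3)] total_hom_dims[OF th(4)]
      by (intro transpose_add[symmetric, of _ "vdim S (Suc n - v)" "vdim S (Suc n - v)"]) (auto intro!: carrier_matI)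
    then show ?thesis unfolding e(5) by (simp add: vdim_dual)
  qed
  then show ?thesis
    unfolding biproduct_def
    using total_hom_dual[OF A S th(1)] total_hom_dual[OF S A th(2)] total_hom_dual[OF B S th(3)]
      total_hom_dual[OF S B th(4)]
    by (simp add: dual_hom_mult[OF th(1,2), symmetric] dual_hom_mult[OF th(3,4), symmetric]
        dual_hom_mult[OF th(1,4), symmetric] dual_hom_mult[OF th(3,2), symmetric]
        dual_one[OF A] dual_one[OF B] e)
      (simp add: dual_hom_def vdim_dual e)
qed

lemma perp0_biproduct_right:
  assumes X: "nat_rep n X" and A: "nat_rep n A" and B: "nat_rep n B" and S: "nat_rep n S"
    and b: "biproduct A B S iA pA iB pB"
  shows "perp0 X S \<longleftrightarrow> perp0 X A \<and> perp0 X B"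
  using perp0_biproduct[OF biproduct_dual[OF A B S b]
      A[THEN nat_rep_dual, THEN nat_rep_total] B[THEN nat_rep_dual, THEN nat_rep_total]
      S[THEN nat_rep_dual, THEN nat_rep_total] X[THEN nat_rep_dual, THEN nat_rep_total]]
  by (simp add: perp0_dual X A B S)

lemma perp0_rep_sum_list_right:
  assumes "\<And>M. M \<in> set Ms \<Longrightarrow> is_rep n M" and X: "nat_rep n X"
  shows "perp0 X (extend n (rep_sum_list Ms)) \<longleftrightarrow> (\<forall>M\<in>set Ms. perp0 X (extend n M))"
  using assms(1)
proof (induction Ms)
  case Nil
  have z: "nat_rep n (extend n zero_rep)"
    by (rule nat_rep_extend) (auto simp: zero_rep_def is_rep_def)
  have "perp0 (dual n (extend n zero_rep)) (dual n X)"
    by (intro perp0_zero nat_rep_total[OF nat_rep_dual] z X)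
      (auto simp: vdim_dual vdim_extend zero_rep_def)
  then show ?case by (simp add: rep_sum_list_def perp0_dual z X)
next
  case (Cons M Ms)
  have r: "is_rep n M" "is_rep n (rep_sum_list Ms)" using Cons.prems by (auto intro: is_rep_rep_sum_list)
  note n = nat_rep_extend[OF r(1)] nat_rep_extend[OF r(2)]
  have "extend n (rep_sum_list (M # Ms)) = rep_sum (extend n M) (extend n (rep_sum_list Ms))"
    using extend_rep_sum[OF r] by (simp add: rep_sum_list_def)
  then show ?case
    using perp0_biproduct_right[OF X n nat_rep_rep_sum[OF n]
        biproduct_rep_sum[OF n[THEN nat_rep_total]]] Cons by simp
qed

text \<open>Duality is full (\<open>undual\<close>), faithful (\<open>d_inj\<close>) and
  contravariant (\<open>mult\<close>), so monomorphisms become epimorphisms and extension problems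
  become lifting problems. The results on projectivity then apply without a second proof.\<close>

lemma injective_in_iff:
  fixes C :: "'k::field rep \<Rightarrow> bool"
  assumes I: "is_rep n I"
  shows "injective_in n {X. is_rep n X \<and> C (extend n X)} I \<longleftrightarrow>
    C (extend n I) \<and> total_projective n (\<lambda>M. C (dual n M)) (dual n (extend n I))"
proof -
  let ?\<C> = "{X. is_rep n X \<and> C (extend n X)}" and ?C = "\<lambda>M. C (dual n M)"
  let ?D = "\<lambda>X. dual n (extend n X)" and ?d = "\<lambda>f. dual_hom n (extend_hom n f)"
  have D: "nat_rep n (?D X)" "dual n (?D X) = extend n X" if "is_rep n X" for X :: "'k rep"
    using that by (simp_all add: nat_rep_extend nat_rep_dual dual_dual)
  have Dd: "total_hom (?D Y) (?D X) (?d f)" if "is_rep n X" "is_rep n Y" "f \<in> Hom n X Y" for X Y :: "'k rep" and f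
    using that by (intro total_hom_dual nat_rep_extend total_hom_extend_hom)
  have undual: "\<exists>g'. g' \<in> Hom n X Y \<and> ?d g' = g"
    if X: "is_rep n X" and Y: "is_rep n Y" and g: "total_hom (?D Y) (?D X) g" for X Y :: "'k rep" and g
  proof -
    have h: "total_hom (extend n X) (extend n Y) (dual_hom n g)"
      using total_hom_dual[OF D(1)[OF Y] D(1)[OF X] g] D X Y by simp
    have "?d (restrict (dual_hom n g) {1..n}) = g"
      unfolding extend_hom_restrict_nat_rep[OF nat_rep_extend[OF X] nat_rep_extend[OF Y] h]
      by (rule dual_hom_dual_hom[OF D(1)[OF Y] D(1)[OF X] g])
    with restrict_mem_Hom[OF h] show ?thesis
      by (intro exI[of _ "restrict (dual_hom n g) {1..n}"] conjI)
  qed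
  have d_inj: "g = h" if "is_rep n X" "is_rep n Y" "g \<in> Hom n X Y" "h \<in> Hom n X Y" "?d g = ?d h"
    for X Y :: "'k rep" and g h
  proof -
    have "dual_hom n (?d g) = dual_hom n (?d h)" using that(5) by (rule arg_cong)
    then have "extend_hom n g = extend_hom n h"
      unfolding dual_hom_dual_hom[OF nat_rep_extend[OF that(1)] nat_rep_extend[OF that(2)]
          total_hom_extend_hom[OF that(1,2,3)]]
        dual_hom_dual_hom[OF nat_rep_extend[OF that(1)] nat_rep_extend[OF that(2)]
          total_hom_extend_hom[OF that(1,2,4)]] .
    then show ?thesis using restrict_extend_hom[OF that(3)] restrict_extend_hom[OF that(4)] by simp
  qed
  have mult: "?d f v * ?d g v = transpose_mat (extend_hom n g (Suc n - v) * extend_hom n f (Suc n - v))"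
    if "is_rep n X" "is_rep n Y" "is_rep n Z" "f \<in> Hom n X Y" "g \<in> Hom n Y Z"
    for X Y Z :: "'k rep" and f g v
    using dual_hom_mult[OF total_hom_extend_hom[OF that(1,2,4)] total_hom_extend_hom[OF that(2,3,5)], of n v]
    unfolding dual_hom_def[of n "\<lambda>v. extend_hom n g v * extend_hom n f v"] by simp
  have all_iff: "(\<forall>v. transpose_mat (extend_hom n g (Suc n - v) * extend_hom n f (Suc n - v)) = transpose_mat (F (Suc n - v)))
      \<longleftrightarrow> (\<forall>v\<in>{1..n}. g v * f v = F v)"
    if F: "\<And>v. v \<notin> {1..n} \<Longrightarrow> F v = 0\<^sub>m 0 0" for f g F
  proof
    assume h: "\<forall>v. transpose_mat (extend_hom n g (Suc n - v) * extend_hom n f (Suc n - v)) = transpose_mat (F (Suc n - v))"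
    show "\<forall>v\<in>{1..n}. g v * f v = F v"
    proof
      fix v assume v: "v \<in> {1..n}"
      then have "Suc n - (Suc n - v) = v" by auto
      then have "transpose_mat (g v * f v) = transpose_mat (F v)"
        using h[rule_format, of "Suc n - v"] v by (simp add: extend_hom_def)
      then show "g v * f v = F v" by (metis transpose_transpose)
    qed
  next
    assume h: "\<forall>v\<in>{1..n}. g v * f v = F v"
    show "\<forall>v. transpose_mat (extend_hom n g (Suc n - v) * extend_hom n f (Suc n - v)) = transpose_mat (F (Suc n - v))"
    proof
      fix v show "transpose_mat (extend_hom n g (Suc n - v) * extend_hom n f (Suc n - v)) = transpose_mat (F (Suc n - v))"
        using h F[of "Suc n - v"] by (cases "Suc n - v \<in> {1..n}") (simp_all add: extend_hom_def del: atLeastAtMost_iff)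
    qed
  qed
  have compA: "comp_hom n f g = comp_hom n f h \<longleftrightarrow> (\<forall>v. ?d g v * ?d f v = ?d h v * ?d f v)"
    if "is_rep n X" "is_rep n Y" "is_rep n Z" "f \<in> Hom n X Y" "g \<in> Hom n Z X" "h \<in> Hom n Z X"
    for X Y Z :: "'k rep" and f g h
    unfolding comp_hom_eq_iff mult[OF that(3,1,2,5,4)] mult[OF that(3,1,2,6,4)]
    by (subst all_iff) (auto simp: extend_hom_def)
  have compB: "comp_hom n g f = h \<longleftrightarrow> (\<forall>v. ?d f v * ?d g v = ?d h v)"
    if "is_rep n X" "is_rep n Y" "is_rep n Z" "f \<in> Hom n X Y" "g \<in> Hom n Y Z" "h \<in> Hom n X Z"
    for X Y Z :: "'k rep" and f g h
    unfolding comp_hom_eq_Hom_iff[OF that(6)] mult[OF that(1,2,3,4,5)] dual_hom_def[of n "extend_hom n h"]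
    by (subst all_iff) (auto simp: extend_hom_def)
  have mono: "mono_in n ?\<C> X Y f \<longleftrightarrow> total_epi n ?C (?D Y) (?D X) (?d f)"
    if X: "is_rep n X" and Y: "is_rep n Y" and f: "f \<in> Hom n X Y" for X Y f
  proof
    assume m: "mono_in n ?\<C> X Y f"
    show "total_epi n ?C (?D Y) (?D X) (?d f)" unfolding total_epi_def
    proof (intro conjI allI impI Dd X Y f)
      fix Z g h assume Z: "nat_rep n Z" "C (dual n Z)" and g: "total_hom (?D X) Z g"
        and h: "total_hom (?D X) Z h" and eq: "\<forall>v. g v * ?d f v = h v * ?d f v"
      have Z': "is_rep n (dual n Z)" "extend n (dual n Z) = dual n Z" "?D (dual n Z) = Z"
        using Z by (simp_all add: nat_rep_dual extend_nat_rep dual_dual nat_rep_is_rep)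
      from undual[OF Z'(1) X, unfolded Z'(3), OF g] obtain g' where g': "g' \<in> Hom n (dual n Z) X" "?d g' = g" by blast
      from undual[OF Z'(1) X, unfolded Z'(3), OF h] obtain h' where h': "h' \<in> Hom n (dual n Z) X" "?d h' = h" by blast
      have "comp_hom n f g' = comp_hom n f h'"
        using compA[OF X Y Z'(1) f g'(1) h'(1)] eq g'(2) h'(2) by simp
      moreover have "dual n Z \<in> ?\<C>" using Z Z' by simp
      ultimately have "g' = h'" using m g' h' unfolding mono_in_def by blast
      then show "g = h" using g' h' by simp
    qed
  next
    assume e: "total_epi n ?C (?D Y) (?D X) (?d f)"
    show "mono_in n ?\<C> X Y f" unfolding mono_in_def
    proof (intro conjI ballI impI f)
      fix Z g h assume Z: "Z \<in> ?\<C>" and g: "g \<in> Hom n Z X" and h: "h \<in> Hom n Z X"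
        and eq: "comp_hom n f g = comp_hom n f h"
      have Z': "is_rep n Z" "C (extend n Z)" using Z by auto
      have "\<forall>v. ?d g v * ?d f v = ?d h v * ?d f v" using compA[OF X Y Z'(1) f g h] eq by simp
      moreover have "nat_rep n (?D Z)" "?C (?D Z)" using D[OF Z'(1)] Z' by simp_all
      ultimately have "?d g = ?d h"
        using e Dd[OF Z'(1) X g] Dd[OF Z'(1) X h] unfolding total_epi_def by blast
      then show "g = h" by (rule d_inj[OF Z'(1) X g h])
    qed
  qed
  show ?thesis
  proof
    assume p: "injective_in n ?\<C> I"
    have "total_projective n ?C (?D I)" unfolding total_projective_def
    proof (intro allI impI)
      fix X Y f h
      assume X: "nat_rep n X" and Y: "nat_rep n Y" and CX: "C (dual n X)" and CY: "C (dual n Y)"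
        and e: "total_epi n ?C X Y f" and h: "total_hom (?D I) Y h"
      have X': "is_rep n (dual n X)" "extend n (dual n X) = dual n X" "?D (dual n X) = X"
        using X by (simp_all add: nat_rep_dual extend_nat_rep dual_dual nat_rep_is_rep)
      have Y': "is_rep n (dual n Y)" "extend n (dual n Y) = dual n Y" "?D (dual n Y) = Y"
        using Y by (simp_all add: nat_rep_dual extend_nat_rep dual_dual nat_rep_is_rep)
      have f: "total_hom X Y f" using e by (simp add: total_epi_def)
      from undual[OF Y'(1) X'(1), unfolded X'(3) Y'(3), OF f]
      obtain f' where f': "f' \<in> Hom n (dual n Y) (dual n X)" "?d f' = f" by blast
      from undual[OF Y'(1) I, unfolded Y'(3), OF h]
      obtain h' where h': "h' \<in> Hom n (dual n Y) I" "?d h' = h" by blast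
      have "mono_in n ?\<C> (dual n Y) (dual n X) f'"
        using mono[OF Y'(1) X'(1) f'(1)] e by (simp only: X'(3) Y'(3) f'(2))
      moreover have "dual n X \<in> ?\<C>" "dual n Y \<in> ?\<C>" using X' Y' CX CY by simp_all
      ultimately obtain k where k: "k \<in> Hom n (dual n X) I" "comp_hom n k f' = h'"
        using p h'(1) unfolding injective_in_def by blast
      have "\<forall>v. f v * ?d k v = h v"
        using compB[OF Y'(1) X'(1) I f'(1) k(1) h'(1)] k(2) f'(2) h'(2) by simp
      moreover have "total_hom (?D I) X (?d k)" using Dd[OF X'(1) I k(1)] by (simp only: X'(3))
      ultimately show "\<exists>k. total_hom (?D I) X k \<and> (\<forall>v. f v * k v = h v)" by blast
    qed
    with p show "C (extend n I) \<and> total_projective n ?C (?D I)" by (simp add: injective_in_def)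
  next
    assume p: "C (extend n I) \<and> total_projective n ?C (?D I)"
    show "injective_in n ?\<C> I" unfolding injective_in_def
    proof (intro conjI ballI allI impI)
      show "I \<in> ?\<C>" using p I by simp
      fix X Y f h
      assume X: "X \<in> ?\<C>" and Y: "Y \<in> ?\<C>" and m: "mono_in n ?\<C> X Y f" and h: "h \<in> Hom n X I"
      have f: "f \<in> Hom n X Y" using m by (simp add: mono_in_def)
      have X': "is_rep n X" "C (extend n X)" and Y': "is_rep n Y" "C (extend n Y)" using X Y by auto
      have "total_epi n ?C (?D Y) (?D X) (?d f)" using m mono[OF X'(1) Y'(1) f] by blast
      moreover have "?C (?D X)" "?C (?D Y)" using D(2)[OF X'(1)] D(2)[OF Y'(1)] X' Y' by simp_all
      ultimately obtain k where k: "total_hom (?D I) (?D Y) k" "\<And>v. ?d f v * k v = ?d h v"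
        using p D(1)[OF X'(1)] D(1)[OF Y'(1)] Dd[OF X'(1) I h] unfolding total_projective_def by blast
      from undual[OF Y'(1) I k(1)] obtain k' where k': "k' \<in> Hom n Y I" "?d k' = k" by blast
      have "comp_hom n k' f = h"
        using compB[OF X'(1) Y'(1) I f k'(1) h] k(2) k'(2) by simp
      with k'(1) show "\<exists>k\<in>Hom n Y I. comp_hom n k f = h" by blast
    qed
  qed
qed

section \<open>Path conditions on intervals, and roots and parents of families of sets\<close>

lemma total_projective_cong:
  assumes "\<And>M. nat_rep n M \<Longrightarrow> C M \<longleftrightarrow> C' M"
  shows "total_projective n C P \<longleftrightarrow> total_projective n C' P"
proof -
  have "total_epi n C X Y f \<longleftrightarrow> total_epi n C' X Y f" for X Y f
    unfolding total_epi_def using assms by blast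
  then show ?thesis unfolding total_projective_def using assms by blast
qed

lemma bij_mat_path_interval:
  assumes "u \<le> w" "u \<in> {c..d} \<longleftrightarrow> Suc w \<in> {c..d}"
  shows "bij_mat (path (interval c d :: 'k::field rep) u (Suc w - u))"
proof (cases "u \<in> {c..d}")
  case True
  then have "path (interval c d :: 'k rep) u (Suc w - u) = 1\<^sub>m 1"
    using assms by (intro path_interval) auto
  then show ?thesis using bij_mat_one by simp
next
  case False
  then show ?thesis
    using path_dims[OF total_rep_interval[where 'a = 'k and a = c and b = d], of u "Suc w - u"] assms
    by (intro bij_mat_empty) (auto simp: vdim_interval)
qed

lemma bij_mat_path_dims:
  fixes M :: "'k::field rep"
  assumes M: "total_rep M" and b: "bij_mat (path M u (Suc w - u))" and uw: "u \<le> w"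
    and d: "\<And>v. vdim M v = (if c \<le> v \<and> v \<le> d then 1 else 0)"
  shows "u \<in> {c..d} \<longleftrightarrow> Suc w \<in> {c..d}"
proof -
  have "vdim M (Suc w) = vdim M u"
    using bij_mat_dims[OF b] path_dims[OF M, of u "Suc w - u"] uw by (auto simp: d split: if_splits)
  then show ?thesis by (auto simp: d split: if_splits)
qed

definition set_root :: "nat \<Rightarrow> (nat \<Rightarrow> 'a set) \<Rightarrow> nat \<Rightarrow> bool" where
  "set_root n I i \<longleftrightarrow> (\<forall>j\<in>{1..n}. I i \<subseteq> I j \<longrightarrow> I j = I i)"

definition set_parent :: "nat \<Rightarrow> (nat \<Rightarrow> 'a set) \<Rightarrow> nat \<Rightarrow> nat \<Rightarrow> bool" where
  "set_parent n I j i \<longleftrightarrow> j \<in> {1..n} \<and> j \<noteq> i \<and> I i \<subseteq> I j \<and>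
     (\<forall>k\<in>{1..n}. k \<noteq> i \<and> I i \<subseteq> I k \<longrightarrow> I j \<subseteq> I k)"

text \<open>Roots and parents depend only on the inclusion order. The lemma is used with
  \<open>r\<close> the identity, to pass between supports and intervals, and with
  \<open>r k = n + 1 - k\<close>, for the dual sequence.\<close>

lemma set_root_parent_reindex:
  assumes r: "\<And>k. k \<in> {1..n} \<Longrightarrow> r k \<in> {1..n}" "\<And>k. k \<in> {1..n} \<Longrightarrow> r (r k) = k"
    and sub: "\<And>j k. j \<in> {1..n} \<Longrightarrow> k \<in> {1..n} \<Longrightarrow> J (r j) \<subseteq> J (r k) \<longleftrightarrow> I j \<subseteq> I k"
    and i: "i \<in> {1..n}"
  shows "set_root n J (r i) \<longleftrightarrow> set_root n I i"
    and "j \<in> {1..n} \<Longrightarrow> set_parent n J (r j) (r i) \<longleftrightarrow> set_parent n I j i"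
proof -
  have all: "(\<forall>k\<in>{1..n}. Q k) \<longleftrightarrow> (\<forall>k\<in>{1..n}. Q (r k))" for Q
    using r by metis
  have ne: "r k \<noteq> r i \<longleftrightarrow> k \<noteq> i" if "k \<in> {1..n}" for k using r(2)[OF that] r(2)[OF i] by metis
  show "set_root n J (r i) \<longleftrightarrow> set_root n I i"
    unfolding set_root_def all[of "\<lambda>k. J (r i) \<subseteq> J k \<longrightarrow> J k = J (r i)"]
    unfolding set_eq_subset
    by (intro ball_cong refl) (simp only: sub i)
  assume j: "j \<in> {1..n}"
  have "(\<forall>k\<in>{1..n}. k \<noteq> r i \<and> J (r i) \<subseteq> J k \<longrightarrow> J (r j) \<subseteq> J k) \<longleftrightarrow>
      (\<forall>k\<in>{1..n}. k \<noteq> i \<and> I i \<subseteq> I k \<longrightarrow> I j \<subseteq> I k)"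
    unfolding all[of "\<lambda>k. k \<noteq> r i \<and> J (r i) \<subseteq> J k \<longrightarrow> J (r j) \<subseteq> J k"]
    by (intro ball_cong refl) (simp only: sub i j ne)
  then show "set_parent n J (r j) (r i) \<longleftrightarrow> set_parent n I j i"
    unfolding set_parent_def using j by (simp only: sub[OF i j] ne[OF j] r(1)[OF j])
qed

context exceptional_intervals
begin

text \<open>The path from \<open>b i + 1\<close> to \<open>d + 1\<close> is cut into the paths of
  the successive children given by \<open>next_child\<close>, each bijective because its index
  exceeds \<open>i\<close>. When \<open>b i = d\<close> the path is empty.\<close>

lemma bij_mat_path_after_child:
  fixes Z :: "'k::field rep"
  assumes Z: "total_rep Z" and gap: "gap c d g" and dn: "d \<le> n"
    and nest: "\<And>k. k \<in> {1..n} \<Longrightarrow> a k \<le> d \<Longrightarrow> c \<le> b k \<Longrightarrow>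
      c \<le> a k \<and> b k \<le> d \<or> a k \<le> c \<and> d \<le> b k"
    and "child c d i" "g < a i"
    and "\<And>k. k \<in> {1..n} \<Longrightarrow> i < k \<Longrightarrow> bij_mat (path Z (a k) (Suc (b k) - a k))"
  shows "bij_mat (path Z (Suc (b i)) (d - b i))"
  using assms(5-7)
proof (induction "d - b i" arbitrary: i rule: less_induct)
  case less
  have i: "i \<in> {1..n}" "b i \<le> d" using less.prems(1) by (auto simp: child_def)
  show ?case
  proof (cases "b i < d")
    case False
    then show ?thesis using bij_mat_one by simp
  next
    case True
    from next_child[OF less.prems(1) gap less.prems(2) True dn nest]
    obtain k where k: "child c d k" "i < k" "a k = Suc (b i)" by blast
    have k': "k \<in> {1..n}" "b k \<le> d" using k(1) by (auto simp: child_def)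
    have bk: "a k \<le> b k" using bounds[OF k'(1)] by simp
    have "bij_mat (path Z (Suc (b k)) (d - b k))"
      by (rule less.hyps[OF _ k(1)]) (use less.prems bounds[OF i(1)] k bk True in auto)
    moreover have "bij_mat (path Z (a k) (Suc (b k) - a k))" using less.prems(3) k' k by blast
    moreover have "path Z (Suc (b i)) (d - b i) = path Z (Suc (b k)) (d - b k) * path Z (a k) (Suc (b k) - a k)"
    proof -
      have "d - b i = (Suc (b k) - a k) + (d - b k)" "a k + (Suc (b k) - a k) = Suc (b k)"
        using k(3) bk k' by auto
      then show ?thesis using path_add[OF Z, of "a k" "Suc (b k) - a k" "d - b k"] k(3) by simp
    qed
    moreover have "dim_col (path Z (Suc (b k)) (d - b k)) = dim_row (path Z (a k) (Suc (b k) - a k))"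
      using path_dims[OF Z] bk by simp
    ultimately show ?thesis using bij_mat_mult by metis
  qed
qed

lemma total_projective_interval_iff:
  assumes i: "i \<in> {1..n}"
  shows "total_projective n (\<lambda>Z :: 'k::field rep. \<forall>k\<in>{Suc i..n}. perp0 (interval (a k) (b k)) Z)
      (interval (a i) (b i)) \<longleftrightarrow>
    set_root n (\<lambda>k. {a k..b k}) i \<or> (\<exists>j. set_parent n (\<lambda>k. {a k..b k}) j i \<and> i < j)"
    (is "?proj \<longleftrightarrow> ?root \<or> (\<exists>j. ?parent j \<and> i < j)")
proof -
  define K where "K = (\<lambda>k. (a k, Suc (b k) - a k)) ` {Suc i..n}"
  define C where "C Z \<longleftrightarrow> (\<forall>(u, l)\<in>K. bij_mat (path Z u l))" for Z :: "'k rep"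
  have C_iff: "C Z \<longleftrightarrow> (\<forall>k\<in>{Suc i..n}. bij_mat (path Z (a k) (Suc (b k) - a k)))" for Z
    by (auto simp: C_def K_def)
  have perp: "perp0 (interval (a k) (b k)) Z \<longleftrightarrow> bij_mat (path Z (a k) (Suc (b k) - a k))"
    if "k \<in> {1..n}" "total_rep Z" for k and Z :: "'k rep"
    using perp0_interval[OF _ that(2)] bounds[OF that(1)] by blast
  have proj: "?proj \<longleftrightarrow> total_projective n C (interval (a i) (b i))"
    using perp by (intro total_projective_cong) (auto simp: C_iff nat_rep_total)
  have sub: "{a k..b k} \<subseteq> {a j..b j} \<longleftrightarrow> a j \<le> a k \<and> b k \<le> b j" if "k \<in> {1..n}" for k j
    using bounds[OF that] by auto
  note bi = bounds[OF i]
  have child: "child (a j) (b j) i" if p: "?parent j" for j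
  proof -
    note p' = p[unfolded set_parent_def]
    have j: "j \<in> {1..n}" "a j \<le> a i" "b i \<le> b j" using p' sub[OF i] by blast+
    have "a k \<le> a j \<and> b j \<le> b k" if k: "k \<in> {1..n}" "k \<noteq> i" "a k \<le> a i" "b i \<le> b k" for k
    proof -
      have "{a j..b j} \<subseteq> {a k..b k}" using p' k sub[OF i] by blast
      then show ?thesis using sub[OF j(1)] by blast
    qed
    then show ?thesis unfolding child_def using i j by blast
  qed
  have if_root: "total_projective n C (interval (a i) (b i))" if root: ?root
  proof -
    have ch: "child 0 n i" unfolding child_def
    proof (intro conjI ballI impI)
      fix k assume k: "k \<in> {1..n}" "k \<noteq> i" "a k \<le> a i" "b i \<le> b k"
      then have "{a k..b k} = {a i..b i}" using root[unfolded set_root_def] sub[OF i] by blast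
      then have "a k = a i" "b k = b i" using bounds[OF k(1)] bi by auto
      then have False using distinct_intervals[OF k(1) i] k(2) by blast
      then show "a k \<le> 0" "n \<le> b k" by blast+
    qed (use i bi in auto)
    \<comment> \<open>No interval contains 0, so the gap required on the left comes for free in the
      case of a root.\<close>
    have g: "gap 0 n 0" unfolding gap_def using bounds by fastforce
    show ?thesis unfolding C_def
    proof (rule total_projective_interval[of 0 "a i" "b i" n])
      fix Z :: "'k rep" assume Z: "nat_rep n Z" and "\<forall>(u, l)\<in>K. bij_mat (path Z u l)"
      then have CZ: "\<And>k. k \<in> {1..n} \<Longrightarrow> i < k \<Longrightarrow> bij_mat (path Z (a k) (Suc (b k) - a k))"
        using C_iff[of Z] by (auto simp: C_def)
      have t: "total_rep Z" by (rule nat_rep_total[OF Z])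
      \<comment> \<open>The condition of the fictitious parent holds because \<open>Z\<close> is
        zero at both 0 and \<open>n + 1\<close>.\<close>
      show "bij_mat (path Z 0 (Suc n - 0))"
        using path_dims[OF t, of 0 "Suc n"] nat_rep_vdim_zero[OF Z, of 0] nat_rep_vdim_zero[OF Z, of "Suc n"]
        by (intro bij_mat_empty) (simp_all del: path.simps)
      show "bij_mat (path Z (Suc (b i)) (n - b i))"
        by (rule bij_mat_path_after_child[OF t g order_refl _ ch _ CZ]) (use bounds bi in auto)
    qed (use bi in auto)
  qed
  have if_parent: "total_projective n C (interval (a i) (b i))" if p: "?parent j" and ij: "i < j" for j
  proof -
    have j: "j \<in> {1..n}" using p by (simp only: set_parent_def)
    have ch: "child (a j) (b j) i" by (rule child[OF p])
    then have ord: "a j \<le> a i" "b i \<le> b j" by (auto simp: child_def)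
    obtain g where g: "gap (a j) (b j) g" "g < a i" using gap_before_child[OF j ch ij] by blast
    show ?thesis unfolding C_def
    proof (rule total_projective_interval[of "a j" "a i" "b i" "b j"])
      fix Z :: "'k rep" assume Z: "nat_rep n Z" and "\<forall>(u, l)\<in>K. bij_mat (path Z u l)"
      then have CZ: "\<And>k. k \<in> {1..n} \<Longrightarrow> i < k \<Longrightarrow> bij_mat (path Z (a k) (Suc (b k) - a k))"
        using C_iff[of Z] by (auto simp: C_def)
      have t: "total_rep Z" by (rule nat_rep_total[OF Z])
      show "bij_mat (path Z (a j) (Suc (b j) - a j))" by (rule CZ[OF j ij])
      show "bij_mat (path Z (Suc (b i)) (b j - b i))"
        by (rule bij_mat_path_after_child[OF t g(1) _ _ ch g(2) CZ]) (use bounds[OF j] nested[OF j] in auto)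
    qed (use ord bi in auto)
  qed
  have not_if_parent: "\<not> total_projective n C (interval (a i) (b i))" if p: "?parent j" and ji: "j < i" for j
  proof -
    have j: "j \<in> {1..n}" using p by (simp only: set_parent_def)
    note q = quotient_compatible[OF j child[OF p] ji]
    show ?thesis
    proof (rule not_total_projective_quotient)
      show "1 \<le> a i" "a i \<le> b i" "b i < b j" "b j \<le> n" using bi bounds[OF j] q(1) by auto
      show "C (interval (a i) (b i))" unfolding C_iff
      proof
        fix k assume k: "k \<in> {Suc i..n}"
        then have k': "k \<in> {1..n}" by auto
        show "bij_mat (path (interval (a i) (b i) :: 'k rep) (a k) (Suc (b k) - a k))"
          by (rule bij_mat_path_interval) (use bounds[OF k'] exceptional[OF i k'] k in auto)
      qed
      show "C (interval (a i) (b j))" unfolding C_iff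
      proof
        fix k assume k: "k \<in> {Suc i..n}"
        then have k': "k \<in> {1..n}" by auto
        show "bij_mat (path (interval (a i) (b j) :: 'k rep) (a k) (Suc (b k) - a k))"
          by (rule bij_mat_path_interval) (use bounds[OF k'] q(2)[OF k'] k in auto)
      qed
    qed
  qed
  have parent_exists: "\<exists>j. ?parent j" if "\<not> ?root"
  proof -
    \<comment> \<open>All intervals containing interval \<open>i\<close> meet one another and are
      therefore nested, so one of minimal length among them is the least under inclusion.\<close>
    define T where "T = {j\<in>{1..n}. j \<noteq> i \<and> {a i..b i} \<subseteq> {a j..b j}}"
    have "T \<noteq> {}" using that unfolding T_def set_root_def by blast
    moreover have "finite T" by (simp add: T_def)
    ultimately obtain j where jT: "j \<in> T" and jmin: "\<And>k. k \<in> T \<Longrightarrow> b j - a j \<le> b k - a k"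
      using arg_min_if_finite[of T "\<lambda>k. b k - a k"] by (meson not_less)
    have j: "j \<in> {1..n}" "j \<noteq> i" "a j \<le> a i" "b i \<le> b j" using jT sub[OF i] unfolding T_def by blast+
    have "{a j..b j} \<subseteq> {a k..b k}" if k: "k \<in> {1..n}" "k \<noteq> i \<and> {a i..b i} \<subseteq> {a k..b k}" for k
    proof -
      have "b j - a j \<le> b k - a k" using jmin k by (simp add: T_def)
      moreover have "a k \<le> a i" "b i \<le> b k" using k sub[OF i] by blast+
      ultimately show ?thesis
        unfolding sub[OF j(1)] using nested[OF j(1) k(1)] j(3,4) bi bounds[OF k(1)] bounds[OF j(1)] by linarith
    qed
    then show ?thesis using jT unfolding T_def set_parent_def by blast
  qed
  show ?thesis unfolding proj
  proof
    assume P: "total_projective n C (interval (a i) (b i))"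
    show "?root \<or> (\<exists>j. ?parent j \<and> i < j)"
    proof (cases ?root)
      case True
      then show ?thesis by (rule disjI1)
    next
      case False
      from parent_exists[OF False] obtain j where p: "?parent j" ..
      then have "j \<noteq> i" unfolding set_parent_def by (elim conjE)
      moreover have "\<not> j < i" using not_if_parent[OF p] P by blast
      ultimately have "i < j" by simp
      show ?thesis by (rule disjI2, rule exI[of _ j], rule conjI) fact+
    qed
  next
    assume "?root \<or> (\<exists>j. ?parent j \<and> i < j)"
    then show "total_projective n C (interval (a i) (b i))"
    proof
      assume "\<exists>j. ?parent j \<and> i < j"
      then obtain j where "?parent j \<and> i < j" ..
      then show ?thesis by (rule conjE) (rule if_parent)
    qed (rule if_root)
  qed
qed

end

text \<open>Stated for any exceptional family \<open>F\<close> isomorphic to intervals, so that it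
  applies both to the given sequence and to its dual in reversed order.\<close>

lemma total_projective_sequence_iff:
  fixes F :: "nat \<Rightarrow> 'k::field rep" and a b :: "nat \<Rightarrow> nat"
  assumes F: "\<And>k. k \<in> {1..n} \<Longrightarrow> nat_rep n (F k)"
    and bounds: "\<And>k. k \<in> {1..n} \<Longrightarrow> 1 \<le> a k \<and> a k \<le> b k \<and> b k \<le> n"
    and iso: "\<And>k. k \<in> {1..n} \<Longrightarrow> iso_via (F k) (interval (a k) (b k)) (r k) (s k)"
    and perp: "\<And>i j. i \<in> {1..n} \<Longrightarrow> j \<in> {1..n} \<Longrightarrow> i < j \<Longrightarrow> perp0 (F j) (F i)"
    and i: "i \<in> {1..n}"
  shows "total_projective n (\<lambda>Z. \<forall>k\<in>{Suc i..n}. perp0 (F k) Z) (F i) \<longleftrightarrow>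
    set_root n (\<lambda>k. {a k..b k}) i \<or> (\<exists>j. set_parent n (\<lambda>k. {a k..b k}) j i \<and> i < j)"
proof -
  have t: "total_rep (F k)" "total_rep (interval (a k) (b k) :: 'k rep)" if "k \<in> {1..n}" for k
    using F[OF that] by (auto intro: nat_rep_total total_rep_interval)
  have perp_iso: "perp0 (F k) Z \<longleftrightarrow> perp0 (interval (a k) (b k)) Z" if "k \<in> {1..n}" "total_rep Z" for k Z
    by (rule perp0_iso_via[OF iso[OF that(1)] t[OF that(1)] that(2)])
  interpret exceptional_intervals n a b
  proof
    fix i j assume ij: "i \<in> {1..n}" "j \<in> {1..n}" "i < j"
    have "perp0 (interval (a j) (b j)) (F i)"
      using perp[OF ij] perp_iso[OF ij(2) t(1)[OF ij(1)]] by blast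
    then have "bij_mat (path (F i) (a j) (Suc (b j) - a j))"
      using perp0_interval[OF _ t(1)[OF ij(1)]] bounds[OF ij(2)] by blast
    then show "a j \<in> {a i..b i} \<longleftrightarrow> Suc (b j) \<in> {a i..b i}"
      by (rule bij_mat_path_dims[OF t(1)[OF ij(1)]])
        (use bounds[OF ij(2)] vdim_iso_interval[OF iso[OF ij(1)]] in auto)
  qed (rule bounds)
  let ?C = "\<lambda>Z. \<forall>k\<in>{Suc i..n}. perp0 (F k) Z"
  have "total_projective n ?C (F i) \<longleftrightarrow> total_projective n ?C (interval (a i) (b i))"
    using total_projective_iso_via[OF iso[OF i] t[OF i]]
      total_projective_iso_via[OF iso_via_sym[OF iso[OF i]] t(2,1)[OF i]] by blast
  also have "\<dots> \<longleftrightarrow> total_projective n (\<lambda>Z. \<forall>k\<in>{Suc i..n}. perp0 (interval (a k) (b k)) Z) (interval (a i) (b i) :: 'k rep)"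
  proof (intro total_projective_cong ball_cong refl)
    fix M :: "'k rep" and k assume M: "nat_rep n M" and k: "k \<in> {Suc i..n}"
    show "perp0 (F k) M \<longleftrightarrow> perp0 (interval (a k) (b k)) M"
      by (rule perp_iso[OF _ nat_rep_total[OF M]]) (use k in auto)
  qed
  also note total_projective_interval_iff[OF i]
  finally show ?thesis .
qed

theorem theoremA2:
  fixes E :: "nat \<Rightarrow> 'k::field rep" and n i :: nat
  assumes "complete_exceptional_sequence n E"
    and "1 \<le> i" and "i \<le> n"
  shows "(relatively_projective n E i \<longleftrightarrow>
            forest_root n E i \<or> (\<exists>j. forest_parent n E j i \<and> i < j)) \<and>
         (relatively_injective n E i \<longleftrightarrow>
            forest_root n E i \<or> (\<exists>j. forest_parent n E j i \<and> i > j))"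
proof -
  have i: "i \<in> {1..n}" using assms by simp
  have E: "is_rep n (E k)" "indecomposable n (E k)" if "k \<in> {1..n}" for k
    using assms(1) that by (auto simp: complete_exceptional_sequence_def)
  have perp: "perp0 (extend n (E l)) (extend n (E k))" if "k \<in> {1..n}" "l \<in> {1..n}" "k < l" for k l
    using assms(1) that E(1)
    by (simp add: complete_exceptional_sequence_def perp0_def Hom_vanishes_iff[symmetric] Ext_vanishes_iff[symmetric])
  have NE: "nat_rep n (extend n (E k))" if "k \<in> {1..n}" for k by (rule nat_rep_extend[OF E(1)[OF that]])
  have "\<forall>k\<in>{1..n}. \<exists>a b f g. 1 \<le> a \<and> a \<le> b \<and> b \<le> n \<and> iso_via (extend n (E k)) (interval a b) f g"
    using indecomposable_iso_interval E(2) by blast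
  then obtain a b r s where bounds: "\<And>k. k \<in> {1..n} \<Longrightarrow> 1 \<le> a k \<and> a k \<le> b k \<and> b k \<le> n"
    and iso: "\<And>k. k \<in> {1..n} \<Longrightarrow> iso_via (extend n (E k)) (interval (a k) (b k)) (r k) (s k)"
    by metis
  have supp: "supp n (E k) = {a k..b k}" if "k \<in> {1..n}" for k
  proof -
    have "supp n (E k) = {v\<in>{1..n}. vdim (extend n (E k)) v \<noteq> 0}" by (auto simp: supp_def vdim_extend)
    also have "\<dots> = {a k..b k}" unfolding vdim_iso_interval[OF iso[OF that]] using bounds[OF that] by auto
    finally show ?thesis .
  qed
  let ?I = "\<lambda>k. {a k..b k}"
  have supp_le: "supp n (E j) \<subseteq> supp n (E k) \<longleftrightarrow> ?I j \<subseteq> ?I k" if "j \<in> {1..n}" "k \<in> {1..n}" for j k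
    by (simp only: supp that)
  let ?S = "\<lambda>k. supp n (E k)"
  have root: "forest_root n E i \<longleftrightarrow> set_root n ?I i"
  proof -
    have "forest_root n E i \<longleftrightarrow> set_root n ?S i"
      using i by (simp only: forest_root_def forest_le_def set_root_def simp_thms)
    also have "\<dots> \<longleftrightarrow> set_root n ?I i"
      by (rule set_root_parent_reindex(1)[where r = "\<lambda>k. k" and J = ?S, OF _ refl supp_le i])
    finally show ?thesis .
  qed
  have parent: "forest_parent n E j i \<longleftrightarrow> set_parent n ?I j i" for j
  proof (cases "j \<in> {1..n}")
    case True
    have "forest_parent n E j i \<longleftrightarrow> set_parent n ?S j i"
      by (simp only: forest_parent_def forest_le_def set_parent_def)
    also have "\<dots> \<longleftrightarrow> set_parent n ?I j i"
      by (rule set_root_parent_reindex(2)[where r = "\<lambda>k. k" and J = ?S, OF _ refl supp_le i True])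
    finally show ?thesis .
  next
    case False
    then show ?thesis unfolding forest_parent_def set_parent_def by (simp only: simp_thms)
  qed
  show ?thesis
  proof
    let ?Z = "rep_sum_list (map E [Suc i..<Suc n])"
    let ?C = "\<lambda>Y. \<forall>k\<in>{Suc i..n}. perp0 (extend n (E k)) Y"
    have Ms: "is_rep n M" if "M \<in> set (map E [Suc i..<Suc n])" for M using that E(1) by auto
    have "right_perp n ?Z = {Y. is_rep n Y \<and> ?C (extend n Y)}"
    proof -
      have "Hom_vanishes n ?Z Y \<and> Ext_vanishes n ?Z Y \<longleftrightarrow> ?C (extend n Y)" if Y: "is_rep n Y" for Y
      proof -
        have "Hom_vanishes n ?Z Y \<and> Ext_vanishes n ?Z Y \<longleftrightarrow> perp0 (extend n ?Z) (extend n Y)"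
          using is_rep_rep_sum_list[of "map E [Suc i..<Suc n]" n] Ms Y
          by (simp only: perp0_def Hom_vanishes_iff Ext_vanishes_iff)
        also have "\<dots> \<longleftrightarrow> (\<forall>M\<in>set (map E [Suc i..<Suc n]). perp0 (extend n M) (extend n Y))"
          by (rule perp0_rep_sum_list[OF Ms nat_rep_total[OF nat_rep_extend[OF Y]]])
        finally show ?thesis by (simp add: atLeastLessThanSuc_atLeastAtMost del: upt_Suc)
      qed
      then show ?thesis by (auto simp: right_perp_def simp del: upt_Suc)
    qed
    then have "relatively_projective n E i \<longleftrightarrow> ?C (extend n (E i)) \<and> total_projective n ?C (extend n (E i))"
      unfolding relatively_projective_def by (simp only: projective_in_iff[OF E(1)[OF i], of ?C])
    moreover have "?C (extend n (E i))" using perp i by auto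
    moreover have "total_projective n ?C (extend n (E i)) \<longleftrightarrow>
        forest_root n E i \<or> (\<exists>j. forest_parent n E j i \<and> i < j)"
      unfolding root parent
      by (rule total_projective_sequence_iff[of n "\<lambda>k. extend n (E k)" a b r s, OF NE bounds iso perp i])
    ultimately show "relatively_projective n E i \<longleftrightarrow>
        forest_root n E i \<or> (\<exists>j. forest_parent n E j i \<and> i < j)" by blast
  next
    let ?Z = "rep_sum_list (map E [1..<i])"
    let ?C = "\<lambda>X. \<forall>k\<in>{1..<i}. perp0 X (extend n (E k))"
    let ?r = "\<lambda>k. Suc n - k"
    \<comment> \<open>Duality exchanges the arguments of Hom and Ext, so the dual modules form an
      exceptional sequence in reversed order; the terms after position \<open>n + 1 - i\<close> are
      the duals of those before \<open>i\<close>.\<close>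
    let ?F = "\<lambda>k. dual n (extend n (E (?r k)))"
    have Ms: "is_rep n M" if "M \<in> set (map E [1..<i])" for M using that E(1) i by auto
    have rk: "?r k \<in> {1..n}" "?r (?r k) = k" if "k \<in> {1..n}" for k using that by auto
    have "left_perp n ?Z = {X. is_rep n X \<and> ?C (extend n X)}"
    proof -
      have "Hom_vanishes n X ?Z \<and> Ext_vanishes n X ?Z \<longleftrightarrow> ?C (extend n X)" if X: "is_rep n X" for X
      proof -
        have "Hom_vanishes n X ?Z \<and> Ext_vanishes n X ?Z \<longleftrightarrow> perp0 (extend n X) (extend n ?Z)"
          using is_rep_rep_sum_list[of "map E [1..<i]" n] Ms X
          by (simp only: perp0_def Hom_vanishes_iff Ext_vanishes_iff)
        also have "\<dots> \<longleftrightarrow> (\<forall>M\<in>set (map E [1..<i]). perp0 (extend n X) (extend n M))"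
          by (rule perp0_rep_sum_list_right[OF Ms nat_rep_extend[OF X]])
        finally show ?thesis by simp
      qed
      then show ?thesis by (auto simp: left_perp_def)
    qed
    then have "relatively_injective n E i \<longleftrightarrow>
        ?C (extend n (E i)) \<and> total_projective n (\<lambda>M. ?C (dual n M)) (dual n (extend n (E i)))"
      unfolding relatively_injective_def by (simp only: injective_in_iff[OF E(1)[OF i], of ?C])
    moreover have "?C (extend n (E i))" using perp i by auto
    moreover have "total_projective n (\<lambda>M. ?C (dual n M)) (dual n (extend n (E i))) \<longleftrightarrow>
        total_projective n (\<lambda>M. \<forall>k\<in>{Suc (?r i)..n}. perp0 (?F k) M) (?F (?r i))"
    proof -
      have "?C (dual n M) \<longleftrightarrow> (\<forall>k\<in>{Suc (?r i)..n}. perp0 (?F k) M)" if M: "nat_rep n M" for M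
      proof -
        have "perp0 (dual n M) (extend n (E k)) \<longleftrightarrow> perp0 (dual n (extend n (E k))) M" if "k \<in> {1..n}" for k
          using perp0_dual[OF nat_rep_dual[OF M] NE[OF that]] by (simp add: dual_dual M)
        then have "?C (dual n M) \<longleftrightarrow> (\<forall>k\<in>{1..<i}. perp0 (dual n (extend n (E k))) M)" using i by auto
        also have "\<dots> \<longleftrightarrow> (\<forall>k\<in>{Suc (?r i)..n}. perp0 (?F k) M)"
        proof -
          have "{1..<i} = ?r ` {Suc (?r i)..n}"
          proof (intro equalityI subsetI)
            fix k assume "k \<in> {1..<i}"
            then show "k \<in> ?r ` {Suc (?r i)..n}" using i by (intro image_eqI[of _ _ "?r k"]) auto
          qed (use i in auto)
          then show ?thesis by (simp only: ball_simps)
        qed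
        finally show ?thesis .
      qed
      then show ?thesis using total_projective_cong[of n "\<lambda>M. ?C (dual n M)"] rk(2)[OF i] by simp
    qed
    moreover have "total_projective n (\<lambda>M. \<forall>k\<in>{Suc (?r i)..n}. perp0 (?F k) M) (?F (?r i)) \<longleftrightarrow>
        forest_root n E i \<or> (\<exists>j. forest_parent n E j i \<and> j < i)"
    proof -
      \<comment> \<open>Duality reflects \<open>[a, b]\<close> to
        \<open>[n + 1 - b, n + 1 - a]\<close>. Reflection preserves inclusions, so roots and parents
        correspond, while the comparison of indices is reversed.\<close>
      let ?a = "\<lambda>k. Suc n - b (?r k)" and ?b = "\<lambda>k. Suc n - a (?r k)"
      let ?J = "\<lambda>k. {?a k..?b k}"
      have sub: "?J (?r j) \<subseteq> ?J (?r k) \<longleftrightarrow> ?I j \<subseteq> ?I k" if "j \<in> {1..n}" "k \<in> {1..n}" for j k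
        using bounds[OF that(1)] bounds[OF that(2)] rk(2)[OF that(1)] rk(2)[OF that(2)] by auto
      have "total_projective n (\<lambda>M. \<forall>k\<in>{Suc (?r i)..n}. perp0 (?F k) M) (?F (?r i)) \<longleftrightarrow>
        set_root n ?J (?r i) \<or> (\<exists>j. set_parent n ?J j (?r i) \<and> ?r i < j)"
      proof (rule total_projective_sequence_iff)
        fix k assume k: "k \<in> {1..n}"
        show "nat_rep n (?F k)" by (intro nat_rep_dual NE rk k)
        show "1 \<le> ?a k \<and> ?a k \<le> ?b k \<and> ?b k \<le> n" using bounds[OF rk(1)[OF k]] by auto
        have I: "nat_rep n (interval (a (?r k)) (b (?r k)) :: 'k rep)"
          using bounds[OF rk(1)[OF k]] by (intro nat_rep_interval) auto
        show "iso_via (?F k) (interval (?a k) (?b k)) (dual_hom n (s (?r k))) (dual_hom n (r (?r k)))"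
          using iso_via_dual[OF NE[OF rk(1)[OF k]] I iso[OF rk(1)[OF k]]] bounds[OF rk(1)[OF k]]
          by (simp add: dual_interval)
      next
        fix k l assume kl: "k \<in> {1..n}" "l \<in> {1..n}" "k < l"
        then have "perp0 (extend n (E (?r k))) (extend n (E (?r l)))"
          by (intro perp rk) auto
        then show "perp0 (?F l) (?F k)"
          using perp0_dual[OF NE[OF rk(1)[OF kl(1)]] NE[OF rk(1)[OF kl(2)]]] by simp
      qed (rule rk(1)[OF i])
      also have "\<dots> \<longleftrightarrow> forest_root n E i \<or> (\<exists>j. forest_parent n E j i \<and> j < i)"
      proof -
        have "(\<exists>j. set_parent n ?J j (?r i) \<and> ?r i < j) \<longleftrightarrow> (\<exists>j. set_parent n ?I j i \<and> j < i)"
        proof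
          assume "\<exists>j. set_parent n ?J j (?r i) \<and> ?r i < j"
          then obtain j where j: "set_parent n ?J j (?r i)" "?r i < j" by blast
          then have jn: "j \<in> {1..n}" by (simp only: set_parent_def)
          then have "set_parent n ?I (?r j) i"
            using set_root_parent_reindex(2)[where n = n and r = ?r and J = ?J and I = ?I, OF rk sub i rk(1)[OF jn]] j(1)
            by (simp only: rk(2)[OF jn])
          moreover have "?r j < i" using j(2) i by auto
          ultimately show "\<exists>j. set_parent n ?I j i \<and> j < i" by (intro exI[of _ "?r j"] conjI)
        next
          assume "\<exists>j. set_parent n ?I j i \<and> j < i"
          then obtain j where j: "set_parent n ?I j i" "j < i" by blast
          then have jn: "j \<in> {1..n}" by (simp only: set_parent_def)
          then have "set_parent n ?J (?r j) (?r i)"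
            using set_root_parent_reindex(2)[where n = n and r = ?r and J = ?J and I = ?I, OF rk sub i jn] j(1) by (simp only:)
          moreover have "?r i < ?r j" using j(2) i by auto
          ultimately show "\<exists>j. set_parent n ?J j (?r i) \<and> ?r i < j" by (intro exI[of _ "?r j"] conjI)
        qed
        then show ?thesis
          unfolding root parent using set_root_parent_reindex(1)[where n = n and r = ?r and J = ?J and I = ?I, OF rk sub i] by (simp only:)
      qed
      finally show ?thesis .
    qed
    ultimately show "relatively_injective n E i \<longleftrightarrow>
        forest_root n E i \<or> (\<exists>j. forest_parent n E j i \<and> i > j)" by blast
  qed
qed

end
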